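(* The stable and unstable vector fields are $C^1(\mathbb T^2\setminus\{0\})$ and, more precisely, there is a constant $C>0$ depending only on $T$ such that for each $\xi\in\mathbb T^2\setminus\{0\}$ $$|Du(\xi)|\le C\,\theta(\xi)^{-1},$$ where $\theta(\xi)=u(\xi)+v(\xi)$.
   Context: Let $\mathbb T^1=\mathbb R/\mathbb Z$, $\mathbb T^2=\mathbb T^1\times\mathbb T^1$, and let $m$ be Lebesgue measure on $\mathbb T^2$. Let $h\in C^\infty(\mathbb T^1,\mathbb T^1)$ satisfy: (1) $h(0)=0$; (2) $h'(0)=0$; (3) $h'(x)>0$ for each $x\ne 0$; (4) $h'''(0)>0$; (5) $h(-x)=-h(x)$. Define $T:\mathbb T^2\to\mathbb T^2$ by $T(x,y)=(x+h(x)+y,\ h(x)+y) \bmod 1$, an $m$-preserving diffeomorphism. At $m$-a.e. $\xi$ the map $T$ has one positive and one negative Lyapunov exponent; the corresponding Oseledets directions (unstable and stable directions) are spanned by vectors $(1,u(\xi))$ and $(1,-v(\xi))$, respectively, with $u(\xi),v(\xi)\ge0$. The functions $u,v$ extend to continuous functions on all of $\mathbb T^2$, and $u,v$ denote these extensions; $(1,u)$ and $(1,-v)$ are the unstable and stable vector fields. *)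

theory Defs
  imports "HOL-Analysis.Analysis"
begin

text \<open>
  The torus \<open>\<real>\<^sup>2/\<int>\<^sup>2\<close> is treated through its universal cover. A point is given by any of its
  representatives in \<open>real \<times> real\<close>, a real function on the torus is a \<open>\<int>\<^sup>2\<close>-periodic function on
  \<open>real \<times> real\<close>, and a map of the circle or of the torus is given by a lift. Equations between
  points of the circle become equations modulo \<open>\<int>\<close>, and the point \<open>0\<close> of the torus is the
  lattice \<open>\<int> \<times> \<int>\<close>. The covering projection is a local isometry, so derivatives of lifts are the
  derivatives of the maps themselves.
\<close>

definition circle_lift :: "(real \<Rightarrow> real) \<Rightarrow> bool" where
  "circle_lift h \<longleftrightarrow> continuous_on UNIV h \<and> (\<forall>x. h (x + 1) - h x \<in> \<int>)"

definition smooth :: "(real \<Rightarrow> real) \<Rightarrow> bool" where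
  "smooth h \<longleftrightarrow> (\<forall>n x. (deriv ^^ n) h field_differentiable at x)"

definition torus_lattice :: "(real \<times> real) set" where
  "torus_lattice = \<int> \<times> \<int>"

definition torus_periodic :: "(real \<times> real \<Rightarrow> 'a) \<Rightarrow> bool" where
  "torus_periodic f \<longleftrightarrow> (\<forall>\<xi>. \<forall>k\<in>torus_lattice. f (\<xi> + k) = f \<xi>)"

text \<open>Lebesgue measure on the torus, carried by a fundamental domain.\<close>

definition torus_measure :: "(real \<times> real) measure" where
  "torus_measure = lebesgue_on ({0..<1} \<times> {0..<1})"

definition torus_map :: "(real \<Rightarrow> real) \<Rightarrow> real \<times> real \<Rightarrow> real \<times> real" where
  "torus_map h = (\<lambda>(x, y). (x + h x + y, h x + y))"

text \<open>
  The Oseledets subspace of an invertible map for the exponent \<open>\<mu>\<close>: the vectors whose growth rate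
  is \<open>\<mu>\<close> in both time directions, that is \<open>ln \<bar>DT\<^sup>n w\<bar> / n \<longlonglongrightarrow> \<mu>\<close> as \<open>n\<close> tends to plus and to
  minus infinity. The number \<open>\<mu>\<close> is a Lyapunov exponent when this space is not zero.
\<close>

definition oseledets_space ::
    "(real \<times> real \<Rightarrow> real \<times> real) \<Rightarrow> real \<times> real \<Rightarrow> real \<Rightarrow> (real \<times> real) set" where
  "oseledets_space T \<xi> \<mu> = {w. w = 0 \<or>
     ((\<lambda>n. ln (norm (frechet_derivative (T ^^ n) (at \<xi>) w)) / real n) \<longlonglongrightarrow> \<mu>) \<and>
     ((\<lambda>n. ln (norm (frechet_derivative ((inv T) ^^ n) (at \<xi>) w)) / (- real n)) \<longlonglongrightarrow> \<mu>)}"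

text \<open>
  \<open>u\<close> and \<open>v\<close> are the continuous extensions to the whole torus of the almost everywhere defined
  slopes of the unstable direction \<open>(1, u)\<close> and of the stable direction \<open>(1, -v)\<close>. Continuity
  makes them unique, because a set of full measure is dense.
\<close>

definition unstable_stable_slopes ::
    "(real \<times> real \<Rightarrow> real \<times> real) \<Rightarrow> (real \<times> real \<Rightarrow> real) \<Rightarrow> (real \<times> real \<Rightarrow> real) \<Rightarrow> bool" where
  "unstable_stable_slopes T u v \<longleftrightarrow>
     torus_periodic u \<and> torus_periodic v \<and>
     continuous_on UNIV u \<and> continuous_on UNIV v \<and>
     (AE \<xi> in torus_measure. u \<xi> \<ge> 0 \<and> v \<xi> \<ge> 0 \<and>
        (\<exists>\<mu> \<nu>. \<mu> > 0 \<and> \<nu> < 0 \<and>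
           oseledets_space T \<xi> \<mu> = span {(1, u \<xi>)} \<and>
           oseledets_space T \<xi> \<nu> = span {(1, - v \<xi>)}))"

definition C1_on ::
    "('a::real_normed_vector) set \<Rightarrow> ('a \<Rightarrow> 'b::real_normed_vector) \<Rightarrow> bool" where
  "C1_on S f \<longleftrightarrow> (\<exists>f' :: 'a \<Rightarrow> 'a \<Rightarrow>\<^sub>L 'b.
     (\<forall>x\<in>S. (f has_derivative blinfun_apply (f' x)) (at x)) \<and> continuous_on S f')"

end

theory Submission
  imports Defs
begin

text \<open>An invariant slope field satisfies \<open>u (T \<xi>) = F (h' x + u \<xi>)\<close> with \<open>F s = s / (1 + s)\<close>: the Oseledets growth
  rates force this almost everywhere, and continuity extends it to all points. Differentiating along
  the backward orbit writes \<open>Du\<close> as a series; split along the vectors \<open>(1, u)\<close> and \<open>(1, - v)\<close>, and using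
  that \<open>T\<close> preserves area, it is bounded by a constant times \<open>1 / \<theta>\<close> plus the sum of the products
  \<open>\<Lambda>\<^sub>n\<close> of the contraction rates \<open>1 / (1 + h' x + u)\<close> along the first \<open>n\<close> backward steps. It remains to
  show that this sum is at most \<open>C / \<theta>\<close>.

  Only orbits near the fixed point matter. There \<open>\<theta>\<close> is comparable to \<open>r = sqrt (\<bar>y\<bar> + x\<^sup>2)\<close>, up to a scaling
  of the coordinates. A comparison principle for the slope equation and an explicit subsolution
  show that \<open>u\<close> exceeds the growth rate of \<open>r\<close> by a definite multiple of \<open>r\<close>, and this makes a multiple
  of \<open>1 / r\<close> a supersolution of the recursion satisfied by the sum. The stable field is reduced to the
  unstable one by the time-reversal symmetry \<open>(x, y) \<mapsto> (x - y, - y)\<close>.\<close>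

section \<open>The model near the fixed point\<close>

text \<open>The contraction rate tends to 1 at the fixed point, and backward orbits on the unstable
  manifold stay near it forever, so the sum is not geometric. The choice of \<open>radius\<close>
  makes its growth explicit: the model flow gives \<open>radius' = x * radius\<close> for
  \<open>y > 0\<close> and \<open>radius' = - x * radius\<close> for \<open>y < 0\<close>. A slope
  that merely dominated this growth rate would bound \<Lambda>_n by a quotient of radii; on the
  unstable manifold these decay like 1/n, and the sum could diverge logarithmically. Hence the need
  for a surplus of order \<open>radius\<close>. \<open>subslope\<close> is homogeneous for the
  weights 1 of \<open>x\<close> and 2 of \<open>y\<close>, which reduces its inequality to
  polynomials in \<open>x / radius x y\<close>. It is continuous across \<open>x = 0\<close> but
  drops from 17/10 to 11/10 of \<open>\<bar>x\<bar>\<close> when an orbit crosses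
  \<open>y = 0\<close>; a subsolution may drop, and the comparison principle asks for no continuity.
  A bounded sum has no rate of convergence, yet continuity of the derivative needs locally uniform
  convergence; that comes from the divergence of a harmonic series.\<close>

definition radius :: "real \<Rightarrow> real \<Rightarrow> real" where
  "radius x y = sqrt (\<bar>y\<bar> + x\<^sup>2)"

text \<open>In coordinates where \<open>h x\<close> is close to \<open>2 * x ^ 3\<close>, the map is close to the time-one map of
  \<open>x' = y\<close>, \<open>y' = 2 * x ^ 3\<close>, and the slope equation is close to \<open>u' = 6 * x\<^sup>2 - u\<^sup>2\<close>. The function
  \<open>subslope\<close> is a subsolution of the latter; \<open>x * y \<ge> 0\<close> are the outgoing points. The coefficients make
  it exceed \<open>\<bar>x\<bar>\<close>, the largest growth rate of \<open>radius\<close>, by a multiple of \<open>radius\<close>; on the unstable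
  manifold \<open>y = x\<^sup>2\<close> the true slope is \<open>2 * x\<close>. At the origin the quotient is \<open>0 / 0 = 0\<close>.\<close>

definition subslope :: "real \<Rightarrow> real \<Rightarrow> real" where
  "subslope x y = (if x * y \<ge> 0 then 4/5 * radius x y - 9/10 * \<bar>x\<bar> + 6/5 * x\<^sup>2 / radius x y
     else 4/5 * radius x y + 9/10 * \<bar>x\<bar>)"

lemma radius_minus: "radius (- x) (- y) = radius x y"
  by (simp add: radius_def)

lemma subslope_minus: "subslope (- x) (- y) = subslope x y"
  by (simp add: subslope_def radius_minus)

lemma radius_nonneg: "radius x y \<ge> 0"
  by (simp add: radius_def)

lemma radius_sq: "(radius x y)\<^sup>2 = \<bar>y\<bar> + x\<^sup>2"
  by (simp add: radius_def)

lemma abs_le_radius: "\<bar>x\<bar> \<le> radius x y"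
  unfolding radius_def by (rule real_le_rsqrt) simp

lemma abs_le_radius_sq: "\<bar>y\<bar> \<le> (radius x y)\<^sup>2"
  by (simp add: radius_sq)

section \<open>One step of the model map: the change of \<open>radius\<close>\<close>

lemma cube_fourth_power_le:
  fixes r :: real
  assumes "0 \<le> r" "r \<le> e"
  shows "r^3 \<le> e * r^2" "r^4 \<le> e * r^3"
proof -
  show "r^3 \<le> e * r^2" using mult_right_mono[OF assms(2), of "r^2"] assms(1)
    by (simp add: power3_eq_cube power2_eq_square)
  show "r^4 \<le> e * r^3" using mult_right_mono[OF assms(2), of "r^3"] assms(1)
    by (simp add: eval_nat_numeral)
qed

text \<open>For \<open>y \<ge> 0\<close> the model flow satisfies \<open>(radius\<^sup>2)' = 2 * x *
  y + 2 * x ^ 3 = 2 * x * radius\<^sup>2\<close>, so one step multiplies the radius by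
  \<open>1 + x\<close> up to a small multiple of \<open>r\<close> in relative size. The squares are
  compared first, because they are polynomials in the coordinates.\<close>

lemma radius_step_upper_half:
  fixes x y k :: real
  defines "r \<equiv> radius x y" and "r1 \<equiv> radius (x + y + k) (y + k)"
  assumes y: "y \<ge> 0" and y1: "y + k \<ge> 0" and k: "\<bar>k - 2 * x^3\<bar> \<le> 1/100000 * \<bar>x\<bar>^3"
    and r: "r \<le> 1/100000"
  shows "\<bar>r1 - r * (1 + x)\<bar> \<le> 24/100000 * r\<^sup>2"
proof (cases "r = 0")
  case True
  then have "x = 0" "y = 0" using abs_le_radius[of x y] abs_le_radius_sq[of y x] by (auto simp: r_def)
  then show ?thesis using k True by (simp add: r1_def radius_def)
next
  case False
  \<comment> \<open>The number \<open>e\<close> is both the relative error of the cubic term and the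
    bound on \<open>r\<close>, so terms of order \<open>r^4\<close> are absorbed into
    \<open>e * r^3\<close>.\<close>
  define e :: real where "e = 1/100000"
  have r0: "r > 0" using False radius_nonneg[of x y] by (simp add: r_def)
  have xr: "\<bar>x\<bar> \<le> r" unfolding r_def by (rule abs_le_radius)
  have yr: "y \<le> r^2" using abs_le_radius_sq[of y x] y by (simp add: r_def)
  have re: "r \<le> e" using r by (simp add: e_def)
  have r3: "r^3 \<le> e * r^2" and r4: "r^4 \<le> e * r^3" using cube_fourth_power_le[of r e] r0 re by auto
  have x3: "\<bar>x\<bar>^3 \<le> r^3" using xr by (intro power_mono) auto
  have k3: "\<bar>k\<bar> \<le> 3 * r^3"
  proof -
    have "\<bar>k\<bar> \<le> \<bar>k - 2 * x^3\<bar> + 2 * \<bar>x\<bar>^3" by (simp add: power_abs[symmetric])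
    moreover have "0 \<le> \<bar>x\<bar>^3" by simp
    ultimately show ?thesis using k x3 by linarith
  qed
  have yk: "y + k \<le> 2 * r^2"
  proof -
    have "k \<le> r^2" using k3 r3 zero_le_power2[of r] unfolding e_def by linarith
    then show ?thesis using yr by simp
  qed
  have yk2: "(y + k)^2 \<le> 4 * r^4"
  proof -
    have "(y + k)^2 \<le> (2 * r^2)^2" by (rule power_mono[OF yk y1])
    then show ?thesis by (simp add: power_mult_distrib flip: power_mult)
  qed
  have xk: "\<bar>2 * x * k\<bar> \<le> 6 * r^4"
  proof -
    have "\<bar>x\<bar> * \<bar>k\<bar> \<le> r * (3 * r^3)" using xr k3 r0 by (intro mult_mono) auto
    moreover have "r * (3 * r^3) = 3 * r^4" by (simp add: eval_nat_numeral)
    moreover have "\<bar>2 * x * k\<bar> = 2 * (\<bar>x\<bar> * \<bar>k\<bar>)" by (simp add: abs_mult)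
    ultimately show ?thesis by linarith
  qed
  have x2r2: "x^2 * r^2 \<le> r^4"
  proof -
    have "x^2 \<le> r^2" using power_mono[OF xr, of 2] by simp
    then have "x^2 * r^2 \<le> r^2 * r^2" by (rule mult_right_mono) simp
    then show ?thesis by (simp flip: power_add)
  qed
  have r12: "r1^2 = (y + k) + (x + y + k)^2" using y1 by (simp add: r1_def radius_sq)
  have r2: "r^2 = y + x^2" using y by (simp add: r_def radius_sq)
  have E: "r1^2 - (r * (1 + x))^2 = (k - 2 * x^3) + (y + k)^2 + 2 * x * k - x^2 * r^2"
    unfolding r12 power_mult_distrib r2 by (simp add: power2_eq_square power3_eq_cube algebra_simps)
  have "\<bar>r1^2 - (r * (1 + x))^2\<bar> \<le> e * r^3 + 4 * r^4 + 6 * r^4 + r^4"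
  proof -
    have "\<bar>k - 2 * x^3\<bar> \<le> e * r^3" using k x3 unfolding e_def by linarith
    moreover have "0 \<le> (y + k)^2" "0 \<le> x^2 * r^2" by auto
    ultimately show ?thesis using yk2 xk x2r2 unfolding E by linarith
  qed
  also have "\<dots> \<le> 12 * e * r^3" using r4 by linarith
  finally have b: "\<bar>r1^2 - (r * (1 + x))^2\<bar> \<le> 12 * e * r^3" .
  have x1: "1 + x \<ge> 1/2" using xr re unfolding e_def by linarith
  have s: "r1 + r * (1 + x) \<ge> r / 2"
  proof -
    have "r * (1/2) \<le> r * (1 + x)" using x1 r0 by (intro mult_left_mono) auto
    moreover have "r1 \<ge> 0" by (simp add: r1_def radius_nonneg)
    ultimately show ?thesis by simp
  qed
  have "\<bar>r1 - r * (1 + x)\<bar> * (r / 2) \<le> \<bar>r1 - r * (1 + x)\<bar> * (r1 + r * (1 + x))"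
    using s by (intro mult_left_mono) auto
  also have "\<dots> = \<bar>r1^2 - (r * (1 + x))^2\<bar>"
  proof -
    have "r1^2 - (r * (1 + x))^2 = (r1 - r * (1 + x)) * (r1 + r * (1 + x))"
      by (simp add: power2_eq_square algebra_simps)
    moreover have "r1 + r * (1 + x) \<ge> 0" using s r0 by linarith
    ultimately show ?thesis by (simp add: abs_mult)
  qed
  also have "\<dots> \<le> (24 * e * r^2) * (r / 2)" using b by (simp add: power3_eq_cube power2_eq_square)
  finally show ?thesis using r0 by (simp add: e_def)
qed

text \<open>A step can leave the upper half only where \<open>y\<close> is at most of order
  \<open>\<bar>x\<bar>^3\<close>. The growth rate of \<open>radius\<close> switches from
  \<open>x\<close> to \<open>- x\<close> on the way, so only bounds in terms of
  \<open>\<bar>x\<bar>\<close> survive.\<close>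

lemma radius_step_crossing:
  fixes x y k :: real
  defines "r \<equiv> radius x y" and "r1 \<equiv> radius (x + y + k) (y + k)"
  assumes y: "y \<ge> 0" and y1: "y + k \<le> 0" and k: "\<bar>k - 2 * x^3\<bar> \<le> 1/100000 * \<bar>x\<bar>^3"
    and r: "r \<le> 1/100000" and x: "x \<le> 0"
  shows "r1 \<le> r * (1 + \<bar>x\<bar> + 24/100000 * r)" "r * (1 - \<bar>x\<bar> - 24/100000 * r) \<le> r1"
    "y \<le> 3 * \<bar>x\<bar>^3" "\<bar>k\<bar> \<le> 3 * \<bar>x\<bar>^3"
proof -
  define e :: real where "e = 1/100000"
  define a where "a = - x"
  have a0: "a \<ge> 0" using x by (simp add: a_def)
  have xa: "x = - a" by (simp add: a_def)
  have absx: "\<bar>x\<bar> = a" using x by (simp add: a_def)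
  have r0: "r \<ge> 0" by (simp add: r_def radius_nonneg)
  have ar: "a \<le> r" using abs_le_radius[of x y] absx by (simp add: r_def)
  have re: "r \<le> e" using r by (simp add: e_def)
  have r3: "r^3 \<le> e * r^2" and r4: "r^4 \<le> e * r^3" using cube_fourth_power_le[of r e] r0 re by auto
  have a3: "a^3 \<le> r^3" using ar a0 by (intro power_mono) auto
  have a30: "0 \<le> a^3" using a0 by simp
  have kk: "\<bar>k + 2 * a^3\<bar> \<le> e * a^3"
    using k unfolding absx by (simp add: xa e_def power3_eq_cube)
  have e1: "e * a^3 \<le> a^3" using a30 unfolding e_def by linarith
  show k3: "\<bar>k\<bar> \<le> 3 * \<bar>x\<bar>^3" unfolding absx using kk e1 a30 by linarith
  show y3: "y \<le> 3 * \<bar>x\<bar>^3" unfolding absx using kk e1 y1 by linarith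
  define q where "q = - k - y"
  have q0: "q \<ge> 0" using y1 by (simp add: q_def)
  have q3: "q \<le> 3 * r^3" using kk e1 y a3 a30 unfolding q_def by linarith
  have qu: "q \<le> 2 * a^3 + e * r^3"
    using kk y mult_left_mono[OF a3, of e] unfolding q_def e_def by linarith
  have yu: "y \<le> 2 * a^3 + e * r^3"
    using kk y1 mult_left_mono[OF a3, of e] unfolding e_def by linarith
  have r12: "r1^2 = q + (a + q)^2"
  proof -
    have "\<bar>y + k\<bar> = q" using y1 by (simp add: q_def)
    moreover have "x + y + k = - (a + q)" by (simp add: xa q_def)
    ultimately show ?thesis unfolding r1_def radius_sq by (metis power2_minus)
  qed
  have r2: "r^2 = y + a^2" using y by (simp add: r_def radius_sq xa)
  have aq: "0 \<le> a * q" "a * q \<le> 3 * r^4"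
  proof -
    show "0 \<le> a * q" using a0 q0 by simp
    have "a * q \<le> r * (3 * r^3)" using ar q3 a0 q0 r0 by (intro mult_mono) auto
    then show "a * q \<le> 3 * r^4" by (simp add: eval_nat_numeral)
  qed
  have qq: "q^2 \<le> 3 * r^4"
  proof -
    have "q \<le> r" 
    proof -
      have "r^2 \<le> r" using re r0 unfolding e_def by (simp add: power2_eq_square mult_left_le)
      then show ?thesis using q3 r3 r0 unfolding e_def by linarith
    qed
    then have "q * q \<le> r * (3 * r^3)" using q3 q0 r0 by (intro mult_mono) auto
    then show ?thesis by (simp add: eval_nat_numeral)
  qed
  have E: "r1^2 - r^2 = q - y + 2 * (a * q) + q^2"
    unfolding r12 r2 by (simp add: power2_eq_square algebra_simps)
  have aa: "a^3 \<le> a * r^2"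
  proof -
    have "a^2 \<le> r^2" using ar a0 by (intro power_mono)
    then have "a * a^2 \<le> a * r^2" using a0 by (rule mult_left_mono)
    then show ?thesis by (simp add: power3_eq_cube power2_eq_square)
  qed
  have up: "r1^2 - r^2 \<le> 2 * (a * r^2) + 10 * e * r^3"
    using E qu y aq qq r4 aa by linarith
  have lo: "r1^2 - r^2 \<ge> - 2 * (a * r^2) - 10 * e * r^3"
  proof -
    have "r1^2 - r^2 \<ge> - y" using E q0 aq zero_le_power2[of q] by linarith
    moreover have "0 \<le> e * r^3" using r0 by (simp add: e_def)
    ultimately show ?thesis using yu aa by linarith
  qed
  have b: "1 - a - 24 * e * r \<ge> 0" using ar re unfolding e_def by linarith
  show "r1 \<le> r * (1 + \<bar>x\<bar> + 24/100000 * r)" unfolding absx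
  proof (rule power2_le_imp_le)
    have "(r * (1 + a + 24 * e * r))^2 = r^2 + 2 * (a * r^2) + 48 * e * r^3 + (r * (a + 24 * e * r))^2"
      by (simp add: power2_eq_square power3_eq_cube algebra_simps)
    moreover have "0 \<le> e * r^3" using r0 by (simp add: e_def)
    ultimately have "r1^2 \<le> (r * (1 + a + 24 * e * r))^2" using up zero_le_power2[of "r * (a + 24 * e * r)"] by linarith
    then show "r1\<^sup>2 \<le> (r * (1 + a + 24 / 100000 * r))\<^sup>2" by (simp add: e_def)
    show "0 \<le> r * (1 + a + 24 / 100000 * r)" using r0 a0 by simp
  qed
  show "r * (1 - \<bar>x\<bar> - 24/100000 * r) \<le> r1" unfolding absx
  proof (rule power2_le_imp_le)
    have "(r * (1 - a - 24 * e * r))^2 = r^2 - 2 * (a * r^2) - 48 * e * r^3 + (r * (a + 24 * e * r))^2"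
      by (simp add: power2_eq_square power3_eq_cube algebra_simps)
    moreover have "(r * (a + 24 * e * r))^2 \<le> 4 * e * r^3"
    proof -
      have "a + 24 * e * r \<le> 2 * r" using ar r0 unfolding e_def by linarith
      from mult_left_mono[OF this r0] have "r * (a + 24 * e * r) \<le> 2 * r^2" by (simp add: power2_eq_square)
      then have "(r * (a + 24 * e * r))^2 \<le> (2 * r^2)^2" using r0 a0 by (intro power_mono) (auto simp: e_def)
      then show ?thesis using r4 by (simp add: power_mult_distrib flip: power_mult)
    qed
    moreover have "0 \<le> e * r^3" using r0 by (simp add: e_def)
    ultimately have "(r * (1 - a - 24 * e * r))^2 \<le> r1^2" using lo by linarith
    then show "(r * (1 - a - 24 / 100000 * r))\<^sup>2 \<le> r1\<^sup>2" by (simp add: e_def)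
    show "0 \<le> r1" by (simp add: r1_def radius_nonneg)
  qed
qed

section \<open>One step of the model map: the subsolution inequality\<close>

text \<open>The slack in the subsolution inequality at outgoing points, divided by \<open>r\<^sup>2\<close>, where \<open>s = x / r\<close>.\<close>

lemma quartic_ge:
  fixes s :: real
  assumes "0 \<le> s" "s \<le> 1"
  shows "1/50 \<le> 26/100 - 176/100 * s + 237/100 * s^2 + 576/100 * s^3 - 144/100 * s^4"
proof -
  have a: "s^4 \<le> s^3" using assms by (simp add: power_decreasing)
  \<comment> \<open>The tangent to \<open>s^3\<close> at 23/100, close to the minimiser of the cubic
    left after \<open>s^4 \<le> s^3\<close>; the number 2267/10000 then minimises the remaining
    quadratic.\<close>
  have b: "s^3 \<ge> 1587/10000 * s - 12167/500000"
  proof -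
    have "s^3 - (1587/10000 * s - 12167/500000) = (s - 23/100)^2 * (s + 46/100)"
      by (simp add: power2_eq_square power3_eq_cube field_simps)
    moreover have "\<dots> \<ge> 0" using assms by simp
    ultimately show ?thesis by linarith
  qed
  have c: "0 \<le> (s - 2267/10000)^2" by simp
  have d: "(s - 2267/10000)^2 = s^2 - 4534/10000 * s + 5139289/100000000"
    by (simp add: power2_eq_square field_simps)
  show ?thesis using a b c assms unfolding d by linarith
qed

text \<open>Points with \<open>x, y \<ge> 0\<close> keep this property, so one branch of
  \<open>subslope\<close> serves before and after the step. The derivative of \<open>l\<close> along
  the model flow minus \<open>6 * x^2 - l^2\<close> is \<open>- r^2\<close> times the polynomial of
  \<open>quartic_ge\<close>; half of its lower bound 1/50 absorbs the errors of the discrete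
  step.\<close>

lemma subslope_step_out:
  fixes x y k :: real
  defines "r \<equiv> radius x y" and "l \<equiv> subslope x y"
  assumes x: "x \<ge> 0" and y: "y \<ge> 0" and k: "\<bar>k - 2 * x^3\<bar> \<le> 1/100000 * \<bar>x\<bar>^3"
    and r: "r \<le> 1/100000"
  shows "subslope (x + y + k) (y + k) \<le> l + 6 * x^2 - l^2 - r^2 / 100"
proof (cases "r = 0")
  case True
  then have "x = 0" "y = 0" using abs_le_radius[of x y] abs_le_radius_sq[of y x] by (auto simp: r_def)
  then show ?thesis using k True by (simp add: l_def subslope_def radius_def)
next
  case False
  define e :: real where "e = 1/100000"
  define r1 where "r1 = radius (x + y + k) (y + k)"
  define x1 where "x1 = x + y + k"
  have r0: "r > 0" using False radius_nonneg[of x y] by (simp add: r_def)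
  have xr: "x \<le> r" using abs_le_radius[of x y] x unfolding r_def by linarith
  have yr: "y \<le> r^2" using abs_le_radius_sq[of y x] y by (simp add: r_def)
  have re: "r \<le> e" using r by (simp add: e_def)
  have e0: "e > 0" by (simp add: e_def)
  have r3: "r^3 \<le> e * r^2" and r4: "r^4 \<le> e * r^3" using cube_fourth_power_le[of r e] r0 re by auto
  have x30: "0 \<le> x^3" using x by simp
  have x3: "x^3 \<le> r^3" using xr x by (intro power_mono) auto
  have kb: "\<bar>k - 2 * x^3\<bar> \<le> e * x^3" using k x by (simp add: e_def)
  have ex3: "e * x^3 \<le> x^3" using x30 unfolding e_def by linarith
  have k0: "k \<ge> 0" using kb ex3 x30 by linarith
  have k3: "k \<le> 3 * r^3" using kb ex3 x3 by linarith
  have r2: "r^2 = y + x^2" using y by (simp add: r_def radius_sq)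
  have step: "\<bar>r1 - r * (1 + x)\<bar> \<le> 24 * e * r\<^sup>2"
    using radius_step_upper_half[of y k x] y k0 k r unfolding r_def r1_def e_def by simp
  have r1pos: "r1 \<ge> r * (1 + x - 24 * e * r)" using step by (simp add: abs_le_iff algebra_simps power2_eq_square)
  have half: "1 + x - 24 * e * r \<ge> 99/100" using x r0 re unfolding e_def by linarith
  have "r * (1 + x - 24 * e * r) > 0" using r0 half by (intro mult_pos_pos) linarith+
  then have r1gt: "r1 > 0" using r1pos by linarith
  have x1sq: "x1^2 \<le> x^2 + 2 * x * y + 10 * e * r^3"
  proof -
    have a: "x1^2 = x^2 + 2 * x * y + 2 * (x * k) + (y + k)^2"
      unfolding x1_def by (simp add: power2_eq_square algebra_simps)
    have "x * k \<le> r * (3 * r^3)" using xr k3 k0 x r0 by (intro mult_mono) auto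
    then have b: "x * k \<le> 3 * r^4" by (simp add: eval_nat_numeral)
    have "k \<le> r^2" using k3 r3 zero_le_power2[of r] unfolding e_def by linarith
    then have "y + k \<le> 2 * r^2" using yr by linarith
    then have "(y + k)^2 \<le> (2 * r^2)^2" using y k0 by (intro power_mono) auto
    then have c: "(y + k)^2 \<le> 4 * r^4" by (simp add: power_mult_distrib flip: power_mult)
    show ?thesis unfolding a using b c r4 by linarith
  qed
  \<comment> \<open>\<open>B / r\<close> is \<open>x1^2 / r1\<close> expanded with \<open>r1\<close>
    replaced by \<open>r * (1 + x)\<close>, up to terms of higher order.\<close>
  define B where "B = x^2 + 2 * x * y - x^3"
  have xy: "0 \<le> x * y" using x y by simp
  have xle1: "x \<le> 1/100" using xr re unfolding e_def by linarith
  have x3x2: "x^3 \<le> x^2" using mult_right_mono[of x 1 "x^2"] xle1 by (simp add: power3_eq_cube power2_eq_square)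
  have B0: "B \<ge> 0" unfolding B_def using x3x2 xy by linarith
  have B3: "B \<le> 3 * r^2"
  proof -
    have xyy: "x * y \<le> y" using mult_right_mono[of x 1 y] xle1 y by simp
    moreover have "B = x^2 + 2 * (x * y) - x^3" by (simp add: B_def)
    ultimately show ?thesis unfolding r2 distrib_left using x30 y zero_le_power2[of x] by linarith
  qed
  have quot: "x1^2 / r1 \<le> B / r + 120 * e * r^2"
  proof -
    have "x1^2 \<le> (1 + x - 24 * e * r) * (B + 120 * e * r^3)"
    proof -
      have i: "(1 + x) * B = x^2 + 2 * x * y + 2 * x^2 * y - x^4"
        unfolding B_def by (simp add: eval_nat_numeral algebra_simps)
      have ii: "x^4 \<le> e * r^3" using power_mono[OF xr x, of 4] r4 by linarith
      have iii: "24 * e * r * B \<le> 72 * e * r^3"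
      proof -
        have "(24 * e * r) * B \<le> (24 * e * r) * (3 * r^2)" using B3 r0 e0 by (intro mult_left_mono) auto
        then show ?thesis by (simp add: power3_eq_cube power2_eq_square)
      qed
      have iv: "(1 + x - 24 * e * r) * (120 * e * r^3) \<ge> 99/100 * (120 * e * r^3)"
        using half r0 e0 by (intro mult_right_mono) auto
      have v: "0 \<le> x^2 * y" using y by simp
      have vi: "0 \<le> e * r^3" using e0 r0 by simp
      have "(1 + x - 24 * e * r) * (B + 120 * e * r^3) =
         (1 + x) * B - 24 * e * r * B + (1 + x - 24 * e * r) * (120 * e * r^3)"
        by (simp add: algebra_simps)
      then show ?thesis using i ii iii iv v vi x1sq by linarith
    qed
    also have "\<dots> = (r * (1 + x - 24 * e * r)) * (B / r + 120 * e * r^2)"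
      using r0 by (simp add: field_simps power2_eq_square power3_eq_cube)
    also have "\<dots> \<le> r1 * (B / r + 120 * e * r^2)"
      using r1pos B0 r0 e0 by (intro mult_right_mono) auto
    finally show ?thesis using r1gt by (simp add: divide_le_eq mult.commute)
  qed
  have l: "l = 4/5 * r - 9/10 * x + 6/5 * x^2 / r"
    using x y by (simp add: l_def subslope_def r_def)
  have l1: "subslope (x + y + k) (y + k) = 4/5 * r1 - 9/10 * x1 + 6/5 * (x1^2 / r1)"
  proof -
    have "(x + y + k) * (y + k) \<ge> 0" using x y k0 by simp
    then show ?thesis using x y k0 by (simp add: subslope_def r1_def x1_def)
  qed
  define s where "s = x / r"
  have xs: "x = s * r" using r0 by (simp add: s_def)
  have s01: "0 \<le> s" "s \<le> 1" using x xr r0 by (auto simp: s_def)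
  have ys: "y = r^2 * (1 - s^2)" using r2 by (simp add: xs power_mult_distrib algebra_simps)
  have r1up: "r1 \<le> r + x * r + 24 * e * r^2" using step by (simp add: abs_le_iff algebra_simps)
  have "subslope (x + y + k) (y + k) \<le>
     4/5 * (r + x * r + 24 * e * r^2) - 9/10 * (x + y) + 6/5 * (B / r + 120 * e * r^2)"
  proof -
    have "x1 \<ge> x + y" using k0 by (simp add: x1_def)
    then show ?thesis unfolding l1 using r1up quot
      mult_left_mono[OF quot, of "6/5"] mult_left_mono[OF r1up, of "4/5"] by argo
  qed
  also have "\<dots> = l + (4/5 * x * r - 9/10 * y + 6/5 * ((2 * x * y - x^3) / r)) + 816/5 * e * r^2"
    unfolding l B_def using r0 by (simp add: field_simps power2_eq_square power3_eq_cube)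
  also have "(4/5 * x * r - 9/10 * y + 6/5 * ((2 * x * y - x^3) / r)) = 
      6 * x^2 - l^2 - r^2 * (26/100 - 176/100 * s + 237/100 * s^2 + 576/100 * s^3 - 144/100 * s^4)"
  proof -
    have ls: "l = r * (4/5 - 9/10 * s + 6/5 * s^2)" unfolding l xs using r0
      by (simp add: field_simps power2_eq_square)
    have q: "(2 * x * y - x^3) / r = r^2 * (2 * s - 3 * s^3)" unfolding ys xs using r0
      by (simp add: field_simps power2_eq_square power3_eq_cube)
    show ?thesis unfolding q unfolding ls ys xs
      by (simp add: power2_eq_square power3_eq_cube field_simps power4_eq_xxxx)
  qed
  also have "l + (6 * x^2 - l^2 - r^2 * (26/100 - 176/100 * s + 237/100 * s^2 + 576/100 * s^3 - 144/100 * s^4))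
      + 816/5 * e * r^2 \<le> l + 6 * x^2 - l^2 - r^2 / 100"
  proof -
    have "r^2 * (1/50) \<le> r^2 * (26/100 - 176/100 * s + 237/100 * s^2 + 576/100 * s^3 - 144/100 * s^4)"
      using quartic_ge[OF s01] by (intro mult_left_mono) auto
    moreover have "0 \<le> r^2" by simp
    ultimately show ?thesis unfolding e_def by linarith
  qed
  finally show ?thesis .
qed

text \<open>An incoming point stays incoming, crosses \<open>x = 0\<close>, or crosses
  \<open>y = 0\<close>. At \<open>x = 0\<close> the two branches of \<open>subslope\<close> agree to
  leading order; at \<open>y = 0\<close> the new branch is smaller by about
  \<open>6/10 * \<bar>x\<bar>\<close>, far more than any error.\<close>

lemma subslope_step_in:
  fixes x y k :: real
  defines "r \<equiv> radius x y" and "l \<equiv> subslope x y"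
  assumes x: "x < 0" and y: "y > 0" and k: "\<bar>k - 2 * x^3\<bar> \<le> 1/100000 * \<bar>x\<bar>^3"
    and r: "r \<le> 1/100000"
  shows "subslope (x + y + k) (y + k) \<le> l + 6 * x^2 - l^2 - r^2 / 100"
proof -
  define e :: real where "e = 1/100000"
  define a where "a = - x"
  have a0: "a > 0" using x by (simp add: a_def)
  have xa: "x = - a" by (simp add: a_def)
  have absx: "\<bar>x\<bar> = a" using x by (simp add: a_def)
  define r1 where "r1 = radius (x + y + k) (y + k)"
  define x1 where "x1 = x + y + k"
  have ar: "a \<le> r" using abs_le_radius[of x y] absx by (simp add: r_def)
  have r0: "r > 0" using ar a0 by simp
  have yr: "y \<le> r^2" using abs_le_radius_sq[of y x] y by (simp add: r_def)
  have re: "r \<le> e" using r by (simp add: e_def)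
  have e0: "e > 0" by (simp add: e_def)
  have r3: "r^3 \<le> e * r^2" and r4: "r^4 \<le> e * r^3" using cube_fourth_power_le[of r e] r0 re by auto
  have r2e: "r^2 \<le> e * r" using mult_right_mono[OF re, of r] r0 by (simp add: power2_eq_square)
  have a3: "a^3 \<le> r^3" using ar a0 by (intro power_mono) auto
  have a30: "0 \<le> a^3" using a0 by simp
  have kk: "\<bar>k + 2 * a^3\<bar> \<le> e * a^3"
    using k unfolding absx by (simp add: xa e_def power3_eq_cube)
  have e1: "e * a^3 \<le> a^3" using a30 unfolding e_def by linarith
  have r2: "r^2 = y + a^2" using y by (simp add: r_def radius_sq xa)
  have l: "l = 4/5 * r + 9/10 * a"
  proof -
    have "\<not> x * y \<ge> 0" using x y by (simp add: mult_neg_pos not_le)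
    then show ?thesis by (simp add: l_def subslope_def r_def absx)
  qed
  have x2: "x^2 = a^2" by (simp add: xa)
  show ?thesis
  proof (cases "y + k > 0")
    case True
    have step: "\<bar>r1 - r * (1 + x)\<bar> \<le> 24 * e * r\<^sup>2"
      using radius_step_upper_half[of y k x] y True k r unfolding r_def r1_def e_def by simp
    have r1up: "r1 \<le> r - a * r + 24 * e * r^2" using step by (simp add: abs_le_iff algebra_simps xa)
    have r1lo: "r1 \<ge> r / 2"
    proof -
      have "r * a \<le> r * e" using ar re r0 by (intro mult_left_mono) auto
      moreover have "r * (1 + x) = r - r * a" by (simp add: xa algebra_simps)
      moreover have "r1 \<ge> r * (1 + x) - 24 * e * r^2" using step by (simp add: abs_le_iff)
      ultimately show ?thesis using r2e r0 unfolding e_def by linarith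
    qed
    have kneg: "k \<ge> - 3 * e * r^2" using kk e1 a3 a30 r3 by linarith
    have bound: "subslope (x + y + k) (y + k) \<le> 4/5 * r1 - 9/10 * x1 + 48/5 * e * r^2"
    proof (cases "x1 < 0")
      case neg: True
      then have "\<not> (x + y + k) * (y + k) \<ge> 0" using True by (simp add: mult_neg_pos not_le x1_def)
      then have "subslope (x + y + k) (y + k) = 4/5 * r1 + 9/10 * \<bar>x1\<bar>"
        by (simp add: subslope_def r1_def x1_def)
      then have "subslope (x + y + k) (y + k) = 4/5 * r1 - 9/10 * x1" using neg by linarith
      then show ?thesis using e0 by simp
    next
      case nn: False
      then have "(x + y + k) * (y + k) \<ge> 0" using True by (simp add: x1_def)
      then have eq: "subslope (x + y + k) (y + k) = 4/5 * r1 - 9/10 * x1 + 6/5 * (x1^2 / r1)"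
        using nn by (simp add: subslope_def r1_def x1_def)
      have "k \<le> 0" using kk e1 a30 by linarith
      then have "x1 \<le> 2 * r^2" using yr a0 xa zero_le_power2[of r] unfolding x1_def by linarith
      then have "x1^2 \<le> (2 * r^2)^2" using nn by (intro power_mono) auto
      also have "\<dots> = 4 * r^4" by (simp add: power_mult_distrib flip: power_mult)
      also have "\<dots> \<le> 4 * e * r^3" using r4 by simp
      also have "\<dots> = (8 * e * r^2) * (r / 2)" by (simp add: power3_eq_cube power2_eq_square)
      also have "\<dots> \<le> (8 * e * r^2) * r1" using r1lo e0 by (intro mult_left_mono) auto
      finally have "x1^2 / r1 \<le> 8 * e * r^2" using r1lo r0 by (simp add: divide_le_eq)
      then show ?thesis unfolding eq by simp
    qed
    have "subslope (x + y + k) (y + k) \<le> l - 4/5 * (a * r) - 9/10 * y + 32 * e * r^2"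
      proof -
      have "0 \<le> e * r^2" using e0 by simp
      moreover have "x1 = y + k - a" by (simp add: x1_def xa)
      ultimately show ?thesis using bound r1up kneg unfolding l mult.assoc by linarith
    qed
    also have "\<dots> \<le> l + 6 * x^2 - l^2 - r^2 / 100"
    proof -
      have lsq: "l^2 = 64/100 * r^2 + 144/100 * (a * r) + 81/100 * a^2" unfolding l
        by (simp add: power2_eq_square algebra_simps)
      \<comment> \<open>What remains is a positive definite quadratic form in \<open>a\<close> and
        \<open>r\<close>; \<open>3/40 * r\<close> is near its minimiser in \<open>a\<close>.\<close>
      have "0 \<le> (a - 3/40 * r)^2" by simp
      then have "a^2 - 6/40 * (a * r) + 9/1600 * r^2 \<ge> 0" by (simp add: power2_eq_square algebra_simps)
      moreover have "0 \<le> r^2" "0 \<le> a^2" by auto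
      moreover have "y = r^2 - a^2" using r2 by simp
      ultimately show ?thesis unfolding lsq x2 e_def by linarith
    qed
    finally show ?thesis .
  next
    case False
    have k': "radius x y \<le> 1/100000" using r by (simp add: r_def)
    have r1up: "r1 \<le> r * (1 + a + 24 * e * r)" and y3: "y \<le> 3 * a^3" and k3: "\<bar>k\<bar> \<le> 3 * a^3"
      using radius_step_crossing[of y k x, OF _ _ k k'] False y x unfolding r_def r1_def e_def absx by auto
    have r1r: "r1 \<le> r + 2 * r^2"
    proof -
      have "r * (1 + a + 24 * e * r) \<le> r * (1 + 2 * r)" using ar r0 unfolding e_def
        by (intro mult_left_mono) linarith+
      then show ?thesis using r1up by (simp add: algebra_simps power2_eq_square)
    qed
    \<comment> \<open>Near the crossing \<open>y\<close> is of third order, so \<open>r\<close> is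
      almost \<open>a\<close>; the drop by \<open>6/10 * a\<close> then dominates the terms of order
      \<open>r^2\<close>.\<close>
    have rr: "r \<le> 11/10 * a"
    proof (rule power2_le_imp_le)
      have "a * a^2 \<le> e * a^2" using ar re by (intro mult_right_mono) auto
      then have "a^3 \<le> e * a^2" by (simp add: power3_eq_cube power2_eq_square)
      then have "r^2 \<le> (1 + 3 * e) * a^2" using r2 y3 by (simp add: algebra_simps)
      also have "\<dots> \<le> 121/100 * a^2" unfolding e_def by (intro mult_right_mono) auto
      finally show "r^2 \<le> (11/10 * a)^2" by (simp add: power_mult_distrib power2_eq_square)
      show "0 \<le> 11/10 * a" using a0 by simp
    qed
    have x1neg: "x1 < 0" using False x unfolding x1_def by linarith
    have r1x: "\<bar>x1\<bar> \<le> r1" using abs_le_radius[of x1 "y + k"] by (simp add: r1_def x1_def)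
    have r1p: "r1 > 0" using r1x x1neg by linarith
    have "x1^2 \<le> \<bar>x1\<bar> * r1" using mult_left_mono[OF r1x, of "\<bar>x1\<bar>"] by (simp add: power2_eq_square)
    then have q: "x1^2 / r1 \<le> \<bar>x1\<bar>" using r1p by (simp add: divide_le_eq)
    have "(x + y + k) * (y + k) \<ge> 0" using x1neg False by (simp add: x1_def mult_nonpos_nonpos)
    then have "subslope (x + y + k) (y + k) = 4/5 * r1 - 9/10 * \<bar>x1\<bar> + 6/5 * (x1^2 / r1)"
      by (simp add: subslope_def r1_def x1_def)
    also have "\<dots> \<le> 4/5 * r1 + 3/10 * \<bar>x1\<bar>" using q by linarith
    also have "\<dots> \<le> 4/5 * (r + 2 * r^2) + 3/10 * (a + 3 * e * r^2)"
    proof -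
      have "\<bar>x1\<bar> \<le> a + 3 * a^3" using x1neg y k3 unfolding x1_def xa by linarith
      then show ?thesis using r1r a3 r3 unfolding mult.assoc distrib_left by linarith
    qed
    also have "\<dots> \<le> l + 6 * x^2 - l^2 - r^2 / 100"
    proof -
      have "l \<le> 17/10 * r" using ar unfolding l by linarith
      moreover have "l \<ge> 0" using a0 r0 unfolding l by simp
      ultimately have "l^2 \<le> (17/10 * r)^2" by (rule power_mono)
      then have "l^2 \<le> 3 * r^2" using zero_le_power2[of r] unfolding power_mult_distrib power2_eq_square[of "17/10"] by linarith
      moreover have "0 \<le> x^2" "0 \<le> r^2" by auto
      ultimately show ?thesis using l rr r2e r0 a0 unfolding e_def distrib_left by linarith
    qed
    finally show ?thesis .
  qed
qed

lemma subslope_step: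
  fixes x y k :: real
  assumes k: "\<bar>k - 2 * x^3\<bar> \<le> 1/100000 * \<bar>x\<bar>^3" and r: "radius x y \<le> 1/100000"
  shows "subslope (x + y + k) (y + k) \<le>
    subslope x y + 6 * x^2 - (subslope x y)^2 - (radius x y)^2 / 100"
proof -
  have k': "\<bar>- k - 2 * (- x)^3\<bar> \<le> 1/100000 * \<bar>- x\<bar>^3"
    using k by (simp add: abs_minus_commute)
  have m: "subslope (- x + - y + - k) (- y + - k) = subslope (x + y + k) (y + k)"
    using subslope_minus[of "x + y + k" "y + k"] by simp
  have r': "radius (- x) (- y) \<le> 1/100000" using r by (simp add: radius_minus)
  consider "x \<ge> 0 \<and> y \<ge> 0" | "- x \<ge> 0 \<and> - y \<ge> 0" | "x < 0 \<and> y > 0" | "- x < 0 \<and> - y > 0" by linarith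
  then show ?thesis
  proof cases
    case 1 then show ?thesis using subslope_step_out[OF _ _ k r] by simp
  next
    case 2 then show ?thesis using subslope_step_out[OF _ _ k' r'] m by (simp add: subslope_minus radius_minus)
  next
    case 3 then show ?thesis using subslope_step_in[OF _ _ k r] by simp
  next
    case 4 then show ?thesis using subslope_step_in[OF _ _ k' r'] m by (simp add: subslope_minus radius_minus)
  qed
qed

lemma radius_step:
  fixes x y k :: real
  defines "r \<equiv> radius x y" and "r1 \<equiv> radius (x + y + k) (y + k)"
  assumes k: "\<bar>k - 2 * x^3\<bar> \<le> 1/100000 * \<bar>x\<bar>^3" and r: "r \<le> 1/100000"
  shows "r1 \<le> r * (1 + \<bar>x\<bar> + 24/100000 * r)" "r * (1 - \<bar>x\<bar> - 24/100000 * r) \<le> r1"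
proof -
  have same: "radius (x + y + k) (y + k) \<le> radius x y * (1 + \<bar>x\<bar> + 24/100000 * radius x y) \<and>
     radius x y * (1 - \<bar>x\<bar> - 24/100000 * radius x y) \<le> radius (x + y + k) (y + k)"
    if y: "y \<ge> 0" and k: "\<bar>k - 2 * x^3\<bar> \<le> 1/100000 * \<bar>x\<bar>^3" and r: "radius x y \<le> 1/100000"
    for x y k :: real
  proof (cases "y + k \<ge> 0")
    case True
    have "\<bar>radius (x + y + k) (y + k) - radius x y * (1 + x)\<bar> \<le> 24/100000 * (radius x y)\<^sup>2"
      by (rule radius_step_upper_half[OF y True k r])
    moreover have "radius x y * x \<le> radius x y * \<bar>x\<bar>" "radius x y * - \<bar>x\<bar> \<le> radius x y * x"
      by (rule mult_left_mono; simp add: radius_nonneg)+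
    ultimately show ?thesis
      by (simp only: abs_le_iff distrib_left right_diff_distrib power2_eq_square mult_1_right
          mult_minus_right mult.assoc mult.left_commute) linarith
  next
    case False
    \<comment> \<open>The increment \<open>k\<close> has the sign of \<open>x\<close>, so the upper
      half is never left where \<open>x\<close> is positive.\<close>
    have "x \<le> 0"
    proof (rule ccontr)
      assume "\<not> x \<le> 0"
      then have "x^3 > 0" "\<bar>x\<bar>^3 = x^3" by auto
      then have "k > 0" using k by linarith
      then show False using False y by linarith
    qed
    then show ?thesis using radius_step_crossing[OF y _ k r] False by simp
  qed
  have "radius (x + y + k) (y + k) \<le> radius x y * (1 + \<bar>x\<bar> + 24/100000 * radius x y) \<and>
     radius x y * (1 - \<bar>x\<bar> - 24/100000 * radius x y) \<le> radius (x + y + k) (y + k)"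
  proof (cases "y \<ge> 0")
    case True then show ?thesis using same[OF True k] r by (simp add: r_def)
  next
    case False
    have k': "\<bar>- k - 2 * (- x)^3\<bar> \<le> 1/100000 * \<bar>- x\<bar>^3"
      using k by (simp add: abs_minus_commute)
    have m: "radius (- x + - y + - k) (- y + - k) = radius (x + y + k) (y + k)"
      using radius_minus[of "x + y + k" "y + k"] by simp
    have r': "radius (- x) (- y) \<le> 1/100000" using r by (simp add: r_def radius_minus)
    show ?thesis using same[OF _ k' r'] False m by (simp add: radius_minus)
  qed
  then show "r1 \<le> r * (1 + \<bar>x\<bar> + 24/100000 * r)" "r * (1 - \<bar>x\<bar> - 24/100000 * r) \<le> r1"
    by (auto simp: r_def r1_def)
qed

section \<open>The slope equation and the barriers for it\<close>

text \<open>The action of the derivative of the map on slopes is \<open>u \<mapsto> slope_map (h' x + u)\<close>.\<close>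

definition slope_map :: "real \<Rightarrow> real" where
  "slope_map s = s / (1 + s)"

lemma slope_map_diff:
  assumes "0 \<le> a" "0 \<le> b"
  shows "slope_map a - slope_map b = (a - b) / ((1 + a) * (1 + b))"
proof -
  have "1 + a \<noteq> 0" "1 + b \<noteq> 0" using assms by auto
  then show ?thesis by (simp add: slope_map_def field_simps)
qed

lemma slope_map_mono: "0 \<le> a \<Longrightarrow> a \<le> b \<Longrightarrow> slope_map a \<le> slope_map b"
  unfolding slope_map_def by (simp add: field_simps)

lemma slope_map_bounds:
  assumes "0 \<le> s"
  shows "0 \<le> slope_map s" "slope_map s < 1" "s - s^2 \<le> slope_map s" "slope_map s \<le> s"
proof -
  have "(s - s^2) * (1 + s) \<le> s" using assms by (simp add: algebra_simps power2_eq_square)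
  then show "s - s^2 \<le> slope_map s" using assms by (simp add: slope_map_def le_divide_eq)
qed (use assms in \<open>auto simp: slope_map_def field_simps\<close>)

text \<open>The surplus \<open>radius x y / 25\<close> over the growth rate of the radius is what
  makes \<open>200 / radius\<close> a supersolution later. For outgoing points it is a quadratic
  inequality in \<open>\<bar>x\<bar> / radius x y\<close> whose discriminant is only just
  negative.\<close>

lemma subslope_bounds:
  "\<bar>x\<bar> + radius x y / 25 \<le> subslope x y" "subslope x y \<le> 2 * radius x y"
proof -
  define r where "r = radius x y"
  define a where "a = \<bar>x\<bar>"
  have a: "0 \<le> a" "a \<le> r" "x^2 = a^2" unfolding a_def r_def by (auto simp: abs_le_radius)
  have "a + r / 25 \<le> subslope x y \<and> subslope x y \<le> 2 * r"
  proof (cases "x * y \<ge> 0")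
    case False
    then show ?thesis using a by (simp add: subslope_def flip: r_def a_def)
  next
    case True
    show ?thesis
    proof (cases "r = 0")
      case True
      then have "radius x y = 0" "x = 0" "a = 0" using a by (auto simp: r_def)
      then show ?thesis using True by (simp add: subslope_def)
    next
      case False
      then have r: "r > 0" using a by simp
      have "0 \<le> (a - 19/24 * r)^2" by simp
      then have "a^2 - 19/12 * (a * r) + 361/576 * r^2 \<ge> 0" by (simp add: power2_eq_square algebra_simps)
      moreover have "(a + r/25 - 4/5 * r + 9/10 * a) * r = 19/10 * (a * r) - 19/25 * r^2"
        by (simp add: power2_eq_square field_simps)
      ultimately have "(a + r/25 - 4/5 * r + 9/10 * a) * r \<le> 6/5 * a^2" using zero_le_power2[of r] by linarith
      then have 1: "a + r/25 - 4/5 * r + 9/10 * a \<le> 6/5 * a^2 / r" using r by (simp add: le_divide_eq)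
      have "a^2 \<le> a * r" using mult_left_mono[OF a(2,1)] by (simp add: power2_eq_square)
      then have "6/5 * a^2 / r \<le> 6/5 * a" using r by (simp add: divide_le_eq)
      then show ?thesis using 1 a True by (simp add: subslope_def flip: r_def a_def)
    qed
  qed
  then show "\<bar>x\<bar> + radius x y / 25 \<le> subslope x y" "subslope x y \<le> 2 * radius x y"
    by (auto simp: r_def a_def)
qed

lemma subslope_nonneg: "0 \<le> subslope x y"
  using subslope_bounds(1)[of x y] radius_nonneg[of x y] by linarith

text \<open>Dividing by \<open>1 + K * r\<close> makes the subsolution smaller than any given constant away from the fixed
  point, where no bound on the slope is known except positivity.\<close>

lemma scaled_subslope_step:
  fixes x y k p K :: real
  defines "r \<equiv> radius x y" and "r1 \<equiv> radius (x + y + k) (y + k)"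
    and "l \<equiv> subslope x y" and "l1 \<equiv> subslope (x + y + k) (y + k)"
  assumes k: "\<bar>k - 2 * x^3\<bar> \<le> 1/100000 * \<bar>x\<bar>^3" and p: "\<bar>p - 6 * x^2\<bar> \<le> 1/100000 * x^2"
    and r: "r \<le> 1/100000" and K: "K \<ge> 0"
  shows "l1 / (1 + K * r1) \<le> slope_map (p + l / (1 + K * r))"
proof -
  define e :: real where "e = 1/100000"
  have e0: "e > 0" by (simp add: e_def)
  have r0: "r \<ge> 0" by (simp add: r_def radius_nonneg)
  have re: "r \<le> e" using r by (simp add: e_def)
  have xr: "\<bar>x\<bar> \<le> r" unfolding r_def by (rule abs_le_radius)
  have l0: "0 \<le> l" "0 \<le> l1" by (auto simp: l_def l1_def subslope_nonneg)
  have l2r: "l \<le> 2 * r" unfolding l_def r_def by (rule subslope_bounds)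
  have x2r: "x^2 \<le> r^2" using power_mono[OF xr, of 2] by simp
  have r2: "r^2 \<le> e * r" using mult_right_mono[OF re r0] by (simp add: power2_eq_square)
  define E where "E = \<bar>x\<bar> + 24 * e * r"
  have E: "0 \<le> E" "E \<le> 101/100 * r" using xr r0 by (auto simp: E_def e_def)
  \<comment> \<open>To first order the relative change of \<open>q\<close> is \<open>- t\<close>
    times that of \<open>r\<close>, where \<open>t = 1 - q\<close>; so \<open>t\<close> measures
    what the scaling costs.\<close>
  define q where "q = 1 / (1 + K * r)"
  define q1 where "q1 = 1 / (1 + K * r1)"
  define t where "t = 1 - q"
  have Kr: "K * r \<ge> 0" using K r0 by simp
  have q: "0 < q" "q \<le> 1" using Kr by (auto simp: q_def)
  have t: "0 \<le> t" "t \<le> 1" using q by (auto simp: t_def)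
  have tq: "K * r = t / q" unfolding t_def q_def using Kr by (simp add: field_simps)
  have r1lo: "r * (1 - E) \<le> r1"
    using radius_step(2)[OF k r[unfolded r_def]] unfolding r1_def r_def E_def e_def
    by (simp add: algebra_simps)
  have tE: "t * E \<le> 1/100"
  proof -
    have "t * E \<le> 1 * E" using t E by (intro mult_right_mono) auto
    then show ?thesis using E re unfolding e_def by linarith
  qed
  have q1le: "q1 \<le> q * (1 + t * (\<bar>x\<bar> + 28 * e * r))"
  proof -
    have "1 + K * r1 \<ge> 1 + K * (r * (1 - E))" using mult_left_mono[OF r1lo K] by simp
    also have "1 + K * (r * (1 - E)) = 1 + (K * r) * (1 - E)" by simp
    also have "\<dots> = (1 - t * E) / q" unfolding tq using q by (simp add: field_simps t_def)
    finally have a: "(1 - t * E) / q \<le> 1 + K * r1" .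
    have b: "(1 - t * E) / q > 0" using tE q by simp
    then have "q1 \<le> 1 / ((1 - t * E) / q)" unfolding q1_def using a b by (intro frac_le) auto
    also have "\<dots> = q * (1 / (1 - t * E))" by simp
    also have "\<dots> \<le> q * (1 + t * (\<bar>x\<bar> + 28 * e * r))"
    proof (rule mult_left_mono)
      define z where "z = t * E"
      have z: "0 \<le> z" "z \<le> 1/100" using t E tE by (auto simp: z_def)
      have "z^2 * z \<le> z^2 * (1/2)" using z by (intro mult_left_mono) auto
      moreover have "(1 + z + 2 * z^2) * (1 - z) = 1 + z^2 - 2 * (z^2 * z)"
        by (simp add: algebra_simps power2_eq_square)
      ultimately have "1 \<le> (1 + z + 2 * z^2) * (1 - z)" by linarith
      then have "1 / (1 - z) \<le> 1 + z + 2 * z^2" using z by (simp add: divide_le_eq)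
      moreover have "z^2 \<le> 2 * e * (t * r)"
      proof -
        have "t^2 \<le> t" using t by (simp add: power2_eq_square mult_left_le)
        moreover have "E^2 \<le> 2 * e * r"
        proof -
          have "E^2 \<le> (101/100 * r)^2" using E by (intro power_mono) auto
          also have "\<dots> \<le> 2 * r^2" by (simp add: power_mult_distrib power2_eq_square)
          finally show ?thesis using r2 by simp
        qed
        ultimately have "t^2 * E^2 \<le> t * (2 * e * r)" using t by (intro mult_mono) auto
        then show ?thesis by (simp add: z_def power_mult_distrib algebra_simps)
      qed
      ultimately have "1 / (1 - z) \<le> 1 + z + 4 * e * (t * r)" by simp
      then show "1 / (1 - t * E) \<le> 1 + t * (\<bar>x\<bar> + 28 * e * r)"
        by (simp add: z_def E_def algebra_simps)
    qed (use q in auto)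
    finally show ?thesis .
  qed
  define h where "h = \<bar>x\<bar> + 28 * e * r"
  have h0: "0 \<le> h" and h2: "h \<le> 2 * r" using r0 e0 xr by (auto simp: h_def e_def)
  have l1le: "l1 \<le> l + 6 * x^2 - l^2 - r^2 / 100"
    unfolding l1_def l_def r_def by (rule subslope_step[OF k r[unfolded r_def]])
  have p7: "p \<le> 7 * x^2" and plo: "p \<ge> 6 * x^2 - e * x^2" and p0: "p \<ge> 0"
    using p zero_le_power2[of x] unfolding e_def by linarith+
  have ql: "0 \<le> q * l" "q * l \<le> 2 * r" 
    using q l0 l2r mult_right_mono[of q 1 l] by auto
  have xx: "x^2 \<le> e * e"
  proof -
    have "x^2 \<le> e^2" using power_mono[of "\<bar>x\<bar>" e 2] xr re by simp
    then show ?thesis by (simp add: power2_eq_square)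
  qed
  have p2: "p^2 \<le> e * x^2"
  proof -
    have "p * p \<le> (7 * x^2) * (7 * (e * e))" using p7 p0 xx by (intro mult_mono) auto
    also have "\<dots> = (49 * e) * (e * x^2)" by simp
    also have "\<dots> \<le> 1 * (e * x^2)" using e0 by (intro mult_right_mono) (auto simp: e_def)
    finally show ?thesis by (simp add: power2_eq_square)
  qed
  have pql: "p * (q * l) \<le> 14 * e * x^2"
  proof -
    have "q * l \<le> 2 * e" using ql re by linarith
    from mult_mono[OF p7 this _ ql(1)] have "p * (q * l) \<le> (7 * x^2) * (2 * e)" by simp
    then show ?thesis by (simp add: mult_ac)
  qed
  have s0: "0 \<le> p + q * l" using p0 ql by simp
  have F: "6 * x^2 - 30 * e * x^2 + q * l - (q * l)^2 \<le> slope_map (p + q * l)"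
  proof -
    have "(p + q * l) - (p + q * l)^2 = p + q * l - p^2 - 2 * (p * (q * l)) - (q * l)^2"
      by (simp add: power2_eq_square algebra_simps)
    then show ?thesis using slope_map_bounds(3)[OF s0] plo p2 pql by linarith
  qed
  \<comment> \<open>The scaling loses about \<open>q * t * \<bar>x\<bar> * l\<close>, which is at
    most \<open>q * t * (x^2 + l^2 / 4)\<close>. It gains \<open>6 * t * x^2\<close>, because the
    forcing term is not scaled, and \<open>q * t * l^2\<close>, because \<open>(q * l)^2\<close> is
    smaller than \<open>q * l^2\<close> by this amount.\<close>
  have main: "0 \<le> t * (6 * x^2) - 30 * e * x^2 + q * t * l^2 + q * (r^2 / 100) - q * t * (h * (l + 6 * x^2))"
  proof -
    have a: "h * (l + 6 * x^2) \<le> x^2 + l^2 / 4 + 56 * e * r^2 + 12 * e * x^2"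
    proof -
      have "0 \<le> (\<bar>x\<bar> - l / 2)^2" by simp
      then have 1: "\<bar>x\<bar> * l \<le> x^2 + l^2 / 4" by (simp add: power2_eq_square algebra_simps)
      have "28 * e * (r * l) \<le> 28 * e * (r * (2 * r))"
        using l2r r0 e0 by (intro mult_left_mono) auto
      then have 2: "28 * e * (r * l) \<le> 56 * e * r^2" by (simp add: power2_eq_square)
      have "h * x^2 \<le> (2 * e) * x^2" using h2 re by (intro mult_right_mono) auto
      then have 3: "h * (6 * x^2) \<le> 12 * e * x^2" by simp
      have "h * (l + 6 * x^2) = \<bar>x\<bar> * l + 28 * e * (r * l) + h * (6 * x^2)"
        by (simp add: h_def algebra_simps)
      then show ?thesis using 1 2 3 by linarith
    qed
    have "q * t * (h * (l + 6 * x^2)) \<le> q * t * (x^2 + l^2 / 4 + 56 * e * r^2 + 12 * e * x^2)"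
      using a q t by (intro mult_left_mono) auto
    moreover have "q * t * (x^2) \<le> t * x^2" using q t by (intro mult_right_mono) (auto simp: mult_left_le_one_le)
    moreover have "q * t * (56 * e * r^2) \<le> q * (56 * e * r^2)"
      using q t e0 by (intro mult_right_mono) (auto simp: mult_left_le)
    moreover have "q * t * (12 * e * x^2) \<le> 12 * e * x^2"
      using q t e0 mult_mono[of q 1 t 1] mult_right_mono[of "q * t" 1 "12 * e * x^2"] by simp
    moreover have "0 \<le> q * t * l^2" using q t by simp
    moreover have "q * x^2 \<le> q * r^2" using x2r q by (intro mult_left_mono) auto
    moreover have "t * x^2 + q * x^2 = x^2" by (simp add: t_def algebra_simps)
    moreover have "0 \<le> t * x^2" "0 \<le> q * x^2" using t q by auto
    ultimately show ?thesis unfolding e_def by (simp add: algebra_simps)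
  qed
  have "q1 * l1 \<le> q * (1 + t * h) * l1" using q1le l0 unfolding h_def by (intro mult_right_mono) auto
  also have "\<dots> \<le> q * (1 + t * h) * (l + 6 * x^2 - l^2 - r^2 / 100)"
    using l1le q t h0 by (intro mult_left_mono) auto
  also have "\<dots> = q * (l + 6 * x^2 - l^2 - r^2 / 100) + q * t * h * (l + 6 * x^2) - q * t * h * (l^2 + r^2 / 100)"
    by (simp add: algebra_simps)
  also have "\<dots> \<le> q * (l + 6 * x^2 - l^2 - r^2 / 100) + q * t * h * (l + 6 * x^2)"
    using q t h0 by simp
  also have "\<dots> \<le> 6 * x^2 - 30 * e * x^2 + q * l - (q * l)^2"
  proof -
    have "(q * l)^2 = q * l^2 - q * t * l^2" by (simp add: t_def power2_eq_square algebra_simps)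
    moreover have "q * (6 * x^2) = 6 * x^2 - t * (6 * x^2)" by (simp add: t_def algebra_simps)
    ultimately show ?thesis using main by (simp add: algebra_simps)
  qed
  also note F
  finally show ?thesis unfolding q1_def q_def by simp
qed

text \<open>For \<open>K * r \<le> 1/600\<close> at least half of the surplus \<open>r / 25\<close>
  survives the division by \<open>1 + K * r\<close>, which gives \<open>D - E = r / 50\<close>. The
  factor 200 is 4 times 50, where 4 bounds \<open>(1 + D) * (1 + E)\<close>.\<close>

lemma inverse_radius_step:
  fixes x y k p u K :: real
  defines "r \<equiv> radius x y" and "r1 \<equiv> radius (x + y + k) (y + k)"
  assumes k: "\<bar>k - 2 * x^3\<bar> \<le> 1/100000 * \<bar>x\<bar>^3"
    and r: "0 < r" "r \<le> 1/100000" and K: "K \<ge> 0" "K * r \<le> 1/600"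
    and p: "p \<ge> 0" and u: "subslope x y / (1 + K * r) \<le> u"
  shows "1 + 1 / (1 + p + u) * (200 / r) \<le> 200 / r1"
proof -
  define E where "E = \<bar>x\<bar> + 24/100000 * r"
  have E: "0 \<le> E" "E \<le> 1/100" "E \<le> 2 * r" using abs_le_radius[of x y] r by (auto simp: E_def r_def)
  have r1: "r1 \<le> r * (1 + E)" "r * (1 - E) \<le> r1"
    using radius_step[OF k r(2)[unfolded r_def]] unfolding r1_def r_def E_def
    by (simp_all add: algebra_simps)
  have "r * (1 - E) > 0" using E r by simp
  then have r1p: "r1 > 0" using r1 by linarith
  have Kr: "K * r \<ge> 0" using K r by simp
  have "subslope x y * (K * r) \<le> (2 * r) * (1/600)"
    using K Kr subslope_bounds(2)[of x y] r unfolding r_def by (intro mult_mono) auto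
  then have "subslope x y - (2 * r) * (1/600) \<le> subslope x y * (1 - K * r)"
    by (simp add: algebra_simps)
  also have "\<dots> \<le> subslope x y * (1 / (1 + K * r))"
  proof (rule mult_left_mono[OF _ subslope_nonneg])
    have "(1 - K * r) * (1 + K * r) \<le> 1" by (simp add: algebra_simps flip: power2_eq_square)
    then show "1 - K * r \<le> 1 / (1 + K * r)" using Kr by (simp add: le_divide_eq)
  qed
  finally have u0: "E + r / 50 \<le> u" 
    using u subslope_bounds(1)[of x y] r unfolding E_def r_def[symmetric] by simp
  define D where "D = E + r / 50"
  have D: "0 \<le> D" "D \<le> 1" using E r by (auto simp: D_def)
  have "1 / (1 + p + u) \<le> 1 / (1 + D)" using u0 p D by (intro divide_left_mono) (auto simp: D_def)
  then have "1 / (1 + p + u) * (200 / r) \<le> 1 / (1 + D) * (200 / r)" using r by (intro mult_right_mono) auto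
  also have "1 + 1 / (1 + D) * (200 / r) \<le> 200 / (r * (1 + E))"
  proof -
    have nz: "1 + E \<noteq> 0" "1 + D \<noteq> 0" "r \<noteq> 0" using D E r by auto
    have "(1 + D) * (1 + E) \<le> 2 * 2" using D E by (intro mult_mono) auto
    then have "r * ((1 + D) * (1 + E)) \<le> r * 4" using r by (intro mult_left_mono) auto
    also have "\<dots> = 200 * (D - E)" by (simp add: D_def)
    finally have "r * ((1 + D) * (1 + E)) + 200 * (1 + E) \<le> 200 * (1 + D)" by (simp add: algebra_simps)
    then have "(r * ((1 + D) * (1 + E)) + 200 * (1 + E)) / (r * ((1 + D) * (1 + E)))
        \<le> 200 * (1 + D) / (r * ((1 + D) * (1 + E)))" using r D E by (intro divide_right_mono) auto
    moreover have "(r * ((1 + D) * (1 + E)) + 200 * (1 + E)) / (r * ((1 + D) * (1 + E))) 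
        = 1 + 1 / (1 + D) * (200 / r)" using nz by (simp add: divide_simps) (simp add: algebra_simps)
    moreover have "200 * (1 + D) / (r * ((1 + D) * (1 + E))) = 200 / (r * (1 + E))"
      using nz by (simp add: divide_simps)
    ultimately show ?thesis by simp
  qed
  also have "\<dots> \<le> 200 / r1" using r1 r1p r E by (intro divide_left_mono) auto
  finally show ?thesis by simp
qed

section \<open>The torus map\<close>

text \<open>Signed, so that the expansion of \<open>h\<close> at 0 applies on both sides of every
  integer. It jumps at half-integers; only its absolute value is continuous.\<close>

definition frac_part :: "real \<Rightarrow> real" where
  "frac_part x = x - of_int (round x)"

lemma frac_part_le_half: "\<bar>frac_part x\<bar> \<le> 1/2"
  using of_int_round_abs_le[of x] by (simp add: frac_part_def abs_minus_commute)

lemma frac_part_minimal: "\<bar>frac_part x\<bar> \<le> \<bar>x - of_int m\<bar>"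
  unfolding frac_part_def by (rule round_diff_minimal)

lemma frac_part_eqI: "\<bar>x - of_int m\<bar> < 1/2 \<Longrightarrow> frac_part x = x - of_int m"
  unfolding frac_part_def by (simp add: round_unique')

lemma frac_part_add_int [simp]: "frac_part (x + of_int m) = frac_part x"
proof -
  have "round (x + of_int m) = round x + m"
    unfolding round_def by (metis add.commute add.left_commute floor_add_int)
  then show ?thesis by (simp add: frac_part_def)
qed

lemma frac_part_eq_0_iff: "frac_part x = 0 \<longleftrightarrow> x \<in> \<int>"
proof
  assume "x \<in> \<int>"
  then obtain m where "x = of_int m" by (auto elim: Ints_cases)
  then show "frac_part x = 0" by (simp add: frac_part_def)
next
  assume "frac_part x = 0"
  then show "x \<in> \<int>" unfolding frac_part_def by (metis Ints_of_int eq_iff_diff_eq_0)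
qed

lemma continuous_abs_frac_part: "continuous_on S (\<lambda>x. \<bar>frac_part x\<bar>)"
proof -
  have a: "\<bar>frac_part x\<bar> \<le> \<bar>frac_part y\<bar> + \<bar>x - y\<bar>" for x y
    using frac_part_minimal[of x "round y"] unfolding frac_part_def[of y] by linarith
  have "\<bar>\<bar>frac_part x\<bar> - \<bar>frac_part y\<bar>\<bar> \<le> \<bar>x - y\<bar>" for x y
    using a[of x y] a[of y x] by linarith
  then show ?thesis unfolding continuous_on_iff dist_real_def
    by (metis le_less_trans)
qed

lemma torus_lattice_iff: "(x, y) \<in> torus_lattice \<longleftrightarrow> x \<in> \<int> \<and> y \<in> \<int>"
  by (simp add: torus_lattice_def)

lemma torus_lattice_add: "a \<in> torus_lattice \<Longrightarrow> b \<in> torus_lattice \<Longrightarrow> a + b \<in> torus_lattice"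
  by (cases a; cases b) (auto simp: torus_lattice_iff)

lemma torus_lattice_diff: "a \<in> torus_lattice \<Longrightarrow> b \<in> torus_lattice \<Longrightarrow> a - b \<in> torus_lattice"
  by (cases a; cases b) (auto simp: torus_lattice_iff)

lemma torus_periodicD: "torus_periodic f \<Longrightarrow> k \<in> torus_lattice \<Longrightarrow> f (\<xi> + k) = f \<xi>"
  unfolding torus_periodic_def by blast

lemma torus_representative:
  obtains k where "k \<in> torus_lattice" "\<xi> - k \<in> {0..<1} \<times> {0..<1}"
proof
  show "(of_int \<lfloor>fst \<xi>\<rfloor>, of_int \<lfloor>snd \<xi>\<rfloor>) \<in> torus_lattice" by (simp add: torus_lattice_iff)
  show "\<xi> - (of_int \<lfloor>fst \<xi>\<rfloor>, of_int \<lfloor>snd \<xi>\<rfloor>) \<in> {0..<1} \<times> {0..<1}"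
    by (cases \<xi>) (simp, linarith)
qed

text \<open>Periodic functions take all their values on the unit square, which is compact. With
  \<open>d = rad\<close> and \<open>r > 0\<close> the condition removes a neighbourhood of the
  lattice, where \<open>u\<close> has no positive lower bound.\<close>

lemma torus_periodic_bounded_below:
  fixes g :: "real \<times> real \<Rightarrow> real"
  assumes g: "continuous_on UNIV g" "torus_periodic g"
    and d: "continuous_on UNIV d" "torus_periodic d"
    and pos: "\<And>\<xi>. (r::real) \<le> d \<xi> \<Longrightarrow> 0 < g \<xi>"
  obtains m where "0 < m" "\<And>\<xi>. r \<le> d \<xi> \<Longrightarrow> m \<le> g \<xi>"
proof -
  define S where "S = cbox (0, 0) (1, 1 :: real) \<inter> {\<xi>. r \<le> d \<xi>}"
  have rep: "\<exists>\<eta>\<in>S. g \<xi> = g \<eta>" if "r \<le> d \<xi>" for \<xi>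
  proof -
    obtain k where k: "k \<in> torus_lattice" "\<xi> - k \<in> {0..<1} \<times> {0..<1}" by (rule torus_representative)
    have "g (\<xi> - k + k) = g (\<xi> - k)" "d (\<xi> - k + k) = d (\<xi> - k)"
      using g(2) d(2) k(1) by (blast intro: torus_periodicD)+
    moreover have "\<xi> - k \<in> cbox (0, 0) (1, 1)" using k(2) by (auto simp: cbox_Pair_eq)
    ultimately show ?thesis using that by (auto simp: S_def intro!: bexI[of _ "\<xi> - k"])
  qed
  have "closed {\<xi>. r \<le> d \<xi>}" using d(1) by (intro closed_Collect_le) auto
  then have "compact S" unfolding S_def by (intro compact_Int_closed compact_cbox)
  show ?thesis
  proof (cases "S = {}")
    case True
    then show ?thesis using that[of 1] rep by auto
  next
    case False
    obtain \<eta> where "\<eta> \<in> S" "\<And>\<xi>. \<xi> \<in> S \<Longrightarrow> g \<eta> \<le> g \<xi>"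
      using continuous_attains_inf[OF \<open>compact S\<close> False continuous_on_subset[OF g(1)]] by auto
    then show ?thesis using that[of "g \<eta>"] pos[of \<eta>] rep by (fastforce simp: S_def)
  qed
qed

section \<open>Circle lifts: degree, periodicity, Taylor expansion\<close>

locale slow_torus_map =
  fixes h :: "real \<Rightarrow> real"
  assumes lift: "circle_lift h" and smooth: "smooth h"
    and h_0: "h 0 \<in> \<int>"
    and h'_0: "deriv h 0 = 0"
    and h'_pos: "\<And>x. x \<notin> \<int> \<Longrightarrow> deriv h x > 0"
    and h'''_pos: "(deriv ^^ 3) h 0 > 0"
begin

abbreviation p :: "real \<Rightarrow> real" where "p \<equiv> deriv h"
abbreviation q :: "real \<Rightarrow> real" where "q \<equiv> deriv (deriv h)"
abbreviation T :: "real \<times> real \<Rightarrow> real \<times> real" where "T \<equiv> torus_map h"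

definition Ti :: "real \<times> real \<Rightarrow> real \<times> real" where
  "Ti = (\<lambda>(x, y). (x - y, y - h (x - y)))"

definition h0 :: "real \<Rightarrow> real" where "h0 x = h x - h 0"

lemma DERIV_iterate: "((deriv ^^ n) h has_real_derivative (deriv ^^ Suc n) h x) (at x)"
  using smooth by (auto simp: smooth_def DERIV_deriv_iff_field_differentiable)

lemma DERIV_h: "(h has_real_derivative p x) (at x)"
  using DERIV_iterate[of 0] by simp

lemma DERIV_p: "(p has_real_derivative q x) (at x)"
  using DERIV_iterate[of 1] by simp

lemma DERIV_q: "(q has_real_derivative (deriv ^^ 3) h x) (at x)"
  using DERIV_iterate[of 2] by (simp add: eval_nat_numeral)

lemma continuous_h [continuous_intros]: "continuous_on S f \<Longrightarrow> continuous_on S (\<lambda>x. h (f x))"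
  using DERIV_h DERIV_continuous_on[of UNIV h p] continuous_on_compose2[of UNIV h S f] by auto

lemma continuous_p [continuous_intros]: "continuous_on S f \<Longrightarrow> continuous_on S (\<lambda>x. p (f x))"
  using DERIV_p DERIV_continuous_on[of UNIV p q] continuous_on_compose2[of UNIV p S f] by auto

lemma continuous_q [continuous_intros]: "continuous_on S f \<Longrightarrow> continuous_on S (\<lambda>x. q (f x))"
  using DERIV_q DERIV_continuous_on[of UNIV q] continuous_on_compose2[of UNIV q S f] by auto

lemma integer_valued_continuous_const:
  fixes g :: "real \<Rightarrow> real"
  assumes "continuous_on UNIV g" "\<And>x. g x \<in> \<int>"
  shows "g x = g 0"
proof -
  have "g constant_on UNIV"
  proof (rule continuous_discrete_range_constant[OF connected_UNIV assms(1)])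
    fix x
    show "\<exists>e>0. \<forall>y. y \<in> UNIV \<and> g y \<noteq> g x \<longrightarrow> e \<le> norm (g y - g x)"
      by (rule exI[of _ 1]) (metis assms(2) Ints_diff Ints_nonzero_abs_ge1 right_minus_eq real_norm_def zero_less_one)
  qed
  then show ?thesis by (auto simp: constant_on_def)
qed

text \<open>The function \<open>h (x + 1) - h x\<close> is continuous and integer valued, hence
  constant; \<open>d\<close> is the degree of the circle map.\<close>

lemma h_shift: "\<exists>d :: int. \<forall>x k. h (x + of_int k) = h x + of_int (k * d)"
proof -
  have "h (x + 1) - h x = h (0 + 1) - h 0" for x
    by (rule integer_valued_continuous_const[of "\<lambda>x. h (x + 1) - h x"])
      (use lift in \<open>auto simp: circle_lift_def intro!: continuous_intros\<close>)
  moreover have "h (0 + 1) - h 0 \<in> \<int>" using lift unfolding circle_lift_def by blast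
  then obtain d :: int where "h (0 + 1) - h 0 = of_int d" by (auto elim: Ints_cases)
  ultimately have 1: "h (x + 1) = h x + of_int d" for x by (metis add_diff_cancel_left' diff_add_cancel add.commute)
  have "h (x + of_int k) = h x + of_int (k * d)" for x k
  proof (induction k rule: int_induct[where k = 0])
    case (step1 i)
    then show ?case using 1[of "x + of_int i"] by (simp add: algebra_simps)
  next
    case (step2 i)
    then show ?case using 1[of "x + of_int (i - 1)"] by (simp add: algebra_simps)
  qed simp
  then show ?thesis by blast
qed

lemma p_periodic: "p (x + of_int k) = p x"
proof -
  obtain d where d: "\<And>x k. h (x + of_int k) = h x + of_int (k * d)" using h_shift by blast
  have "((\<lambda>x. h (x + of_int k)) has_real_derivative p (x + of_int k)) (at x)"
    using DERIV_h[of "x + of_int k"] by (simp add: DERIV_shift)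
  moreover have "((\<lambda>x. h (x + of_int k)) has_real_derivative p x) (at x)"
    unfolding d by (auto intro!: derivative_eq_intros DERIV_h)
  ultimately show ?thesis by (rule DERIV_unique)
qed

lemma q_periodic: "q (x + of_int k) = q x"
proof -
  have "((\<lambda>x. p (x + of_int k)) has_real_derivative q (x + of_int k)) (at x)"
    using DERIV_p[of "x + of_int k"] by (simp add: DERIV_shift)
  then have "(p has_real_derivative q (x + of_int k)) (at x)" by (simp add: p_periodic)
  then show ?thesis using DERIV_p by (rule DERIV_unique)
qed

lemma p_frac_part: "p x = p (frac_part x)" and q_frac_part: "q x = q (frac_part x)"
  using p_periodic[of "frac_part x" "round x"] q_periodic[of "frac_part x" "round x"]
  by (auto simp: frac_part_def)

lemma p_nonneg: "0 \<le> p x"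
proof (cases "x \<in> \<int>")
  case True
  then show ?thesis using p_frac_part[of x] h'_0 by (simp add: iffD2[OF frac_part_eq_0_iff])
next
  case False
  then show ?thesis using h'_pos[of x] by simp
qed

lemma p_eq_0_iff: "p x = 0 \<longleftrightarrow> x \<in> \<int>"
  by (metis h'_pos p_frac_part h'_0 frac_part_eq_0_iff less_irrefl)

text \<open>The nonnegative function \<open>p\<close> has a minimum at 0.\<close>

lemma q_0: "q 0 = 0"
  using DERIV_local_min[OF DERIV_p zero_less_one] p_nonneg h'_0 by auto

lemma h0_0 [simp]: "h0 0 = 0" by (simp add: h0_def)

lemma DERIV_h0: "(h0 has_real_derivative p x) (at x)"
  unfolding h0_def by (auto intro!: derivative_eq_intros DERIV_h)

text \<open>Scaling both coordinates by \<open>c\<close> normalises the cubic term of \<open>h\<close> to \<open>2 * x ^ 3\<close>.\<close>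

definition c :: real where "c = sqrt ((deriv ^^ 3) h 0 / 12)"

lemma c_pos: "c > 0" and c_sq: "c\<^sup>2 = (deriv ^^ 3) h 0 / 12"
  using h'''_pos by (auto simp: c_def)

text \<open>The mean value inequality, without the factor \<open>1 / Suc n\<close> that integration
  would give. It carries an error bound from \<open>q\<close> to \<open>p\<close> to
  \<open>h0\<close>.\<close>

lemma DERIV_bound_power:
  fixes f f' :: "real \<Rightarrow> real"
  assumes D: "\<And>x. (f has_real_derivative f' x) (at x)" and 0: "f 0 = 0"
    and b: "\<And>x. \<bar>x\<bar> \<le> r \<Longrightarrow> \<bar>f' x\<bar> \<le> e * \<bar>x\<bar>^n" and x: "\<bar>x\<bar> \<le> r" and e: "0 \<le> e"
  shows "\<bar>f x\<bar> \<le> e * \<bar>x\<bar>^Suc n"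
proof -
  have "norm (f x - f 0) \<le> (e * \<bar>x\<bar>^n) * norm (x - 0)"
  proof (rule field_differentiable_bound[where S = "closed_segment 0 x" and f' = f'])
    fix z assume "z \<in> closed_segment 0 x"
    then have z: "\<bar>z\<bar> \<le> \<bar>x\<bar>" by (auto simp: closed_segment_eq_real_ivl split: if_splits)
    have "\<bar>f' z\<bar> \<le> e * \<bar>z\<bar>^n" using b z x by simp
    also have "\<dots> \<le> e * \<bar>x\<bar>^n" using z e by (intro mult_left_mono power_mono) auto
    finally show "norm (f' z) \<le> e * \<bar>x\<bar>^n" by simp
  qed (auto intro: has_field_derivative_at_within D)
  then show ?thesis using 0 by (simp add: algebra_simps)
qed

lemma local_expansion:
  obtains \<rho> where "\<rho> > 0"
    "\<And>x. \<bar>x\<bar> \<le> \<rho> \<Longrightarrow> \<bar>c * h0 x - 2 * (c * x)^3\<bar> \<le> 1/100000 * \<bar>c * x\<bar>^3"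
    "\<And>x. \<bar>x\<bar> \<le> \<rho> \<Longrightarrow> \<bar>p x - 6 * (c * x)^2\<bar> \<le> 1/100000 * (c * x)^2"
proof -
  define D where "D = (deriv ^^ 3) h 0"
  define e where "e = 1/100000 * c^2"
  have D12: "D = 12 * c^2" by (simp add: D_def c_sq)
  have e: "e > 0" using c_pos by (simp add: e_def)
  have "(q has_real_derivative D) (at 0)" unfolding D_def by (rule DERIV_q)
  then have "(\<lambda>x. (q x - q 0) / (x - 0)) \<midarrow>0\<rightarrow> D" by (simp add: has_field_derivative_iff)
  then obtain s where s: "s > 0" "\<And>x. x \<noteq> 0 \<Longrightarrow> \<bar>x\<bar> < s \<Longrightarrow> \<bar>q x / x - D\<bar> < e"
    using e unfolding LIM_eq by (auto simp: q_0)
  have q: "\<bar>q x - D * x\<bar> \<le> e * \<bar>x\<bar>^1" if "\<bar>x\<bar> \<le> s / 2" for x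
  proof (cases "x = 0")
    case False
    then have "\<bar>q x / x - D\<bar> \<le> e" using s that by (intro less_imp_le) auto
    then have "\<bar>x\<bar> * \<bar>q x / x - D\<bar> \<le> \<bar>x\<bar> * e" by (intro mult_left_mono) auto
    moreover have "\<bar>x\<bar> * \<bar>q x / x - D\<bar> = \<bar>x * (q x / x - D)\<bar>" by (simp add: abs_mult)
    moreover have "x * (q x / x - D) = q x - D * x" using False by (simp add: right_diff_distrib mult.commute)
    ultimately show ?thesis by (simp add: mult.commute[of e])
  qed (simp add: q_0)
  have p: "\<bar>p x - D / 2 * x^2\<bar> \<le> e * \<bar>x\<bar>^2" if "\<bar>x\<bar> \<le> s / 2" for x
  proof -
    have "\<bar>p x - D / 2 * x^2\<bar> \<le> e * \<bar>x\<bar>^Suc 1"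
      by (rule DERIV_bound_power[where f' = "\<lambda>x. q x - D * x", OF _ _ q that less_imp_le[OF e]])
        (auto intro!: derivative_eq_intros DERIV_p simp: h'_0)
    then show ?thesis by (simp only: Suc_1)
  qed
  have h: "\<bar>h0 x - D / 6 * x^3\<bar> \<le> e * \<bar>x\<bar>^3" if "\<bar>x\<bar> \<le> s / 2" for x
  proof -
    have "\<bar>h0 x - D / 6 * x^3\<bar> \<le> e * \<bar>x\<bar>^Suc 2"
      by (rule DERIV_bound_power[where f' = "\<lambda>x. p x - D / 2 * x^2", OF _ _ p that less_imp_le[OF e]])
        (auto intro!: derivative_eq_intros DERIV_h0)
    then show ?thesis by (simp add: numeral_3_eq_3)
  qed
  show thesis
  proof (rule that[of "s / 2"])
    fix x assume x: "\<bar>x\<bar> \<le> s / 2"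
    have "c * \<bar>h0 x - D / 6 * x^3\<bar> \<le> c * (e * \<bar>x\<bar>^3)" using h[OF x] c_pos by (intro mult_left_mono) auto
    moreover have "c * \<bar>h0 x - D / 6 * x^3\<bar> = \<bar>c * h0 x - 2 * (c * x)^3\<bar>"
    proof -
      have "c * h0 x - 2 * (c * x)^3 = c * (h0 x - D / 6 * x^3)"
        unfolding D12 by (simp add: power3_eq_cube power2_eq_square algebra_simps)
      then show ?thesis using c_pos by (simp add: abs_mult)
    qed
    moreover have "c * (e * \<bar>x\<bar>^3) = 1/100000 * \<bar>c * x\<bar>^3"
      using c_pos by (simp add: e_def abs_mult power_mult_distrib power3_eq_cube power2_eq_square)
    ultimately show "\<bar>c * h0 x - 2 * (c * x)^3\<bar> \<le> 1/100000 * \<bar>c * x\<bar>^3" by simp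
    show "\<bar>p x - 6 * (c * x)^2\<bar> \<le> 1/100000 * (c * x)^2"
      using p[OF x] unfolding D12 by (simp add: e_def power_mult_distrib mult.assoc)
  qed (use s in auto)
qed

text \<open>\<open>q\<close> is the source term of the recursion for the gradients; its linear
  vanishing at the integers later allows it to be dominated by a multiple of
  \<open>u\<close>.\<close>

lemma q_bound: obtains B where "B > 0" "\<And>x. \<bar>q x\<bar> \<le> B * \<bar>frac_part x\<bar>"
proof -
  have "continuous_on {-1/2..1/2} ((deriv ^^ 3) h)"
    using DERIV_iterate[of 3] by (auto intro!: DERIV_continuous_on intro: has_field_derivative_at_within)
  then have "bounded ((deriv ^^ 3) h ` {-1/2..1/2})" by (intro compact_imp_bounded compact_continuous_image) auto
  then obtain B where B: "B > 0" "\<And>x. x \<in> {-1/2..1/2} \<Longrightarrow> \<bar>(deriv ^^ 3) h x\<bar> \<le> B"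
    unfolding bounded_pos by auto
  have "\<bar>q x\<bar> \<le> B * \<bar>frac_part x\<bar>" for x
  proof -
    have "\<bar>(deriv ^^ 3) h z\<bar> \<le> B * \<bar>z\<bar>^0" if "\<bar>z\<bar> \<le> 1/2" for z
    proof -
      have "z \<in> {-1/2..1/2}" using that unfolding atLeastAtMost_iff abs_le_iff by linarith
      then show ?thesis using B(2)[of z] by simp
    qed
    from DERIV_bound_power[OF DERIV_q q_0 this frac_part_le_half] B(1) q_frac_part[of x]
    show ?thesis by simp
  qed
  then show thesis using that B(1) by blast
qed

section \<open>The map, its inverse and the lattice\<close>

lemma T_apply: "T (x, y) = (x + h x + y, h x + y)" by (simp add: torus_map_def)

lemma Ti_apply: "Ti (x, y) = (x - y, y - h (x - y))" by (simp add: Ti_def)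

lemma T_Ti [simp]: "T (Ti \<xi>) = \<xi>" and Ti_T [simp]: "Ti (T \<xi>) = \<xi>"
  by (cases \<xi>; simp add: T_apply Ti_apply)+

lemma inv_T: "inv T = Ti"
  by (rule inv_unique_comp) (auto simp: fun_eq_iff)

lemma T_translate:
  assumes "k \<in> torus_lattice"
  obtains k' where "k' \<in> torus_lattice" "\<And>\<xi>. T (\<xi> + k) = T \<xi> + k'"
proof -
  obtain d where d: "\<And>x k. h (x + of_int k) = h x + of_int (k * d)" using h_shift by blast
  obtain i j :: int where k: "k = (of_int i, of_int j)" using assms
    by (cases k) (auto simp: torus_lattice_iff elim!: Ints_cases)
  show thesis
    by (rule that[of "(of_int (i + i * d + j), of_int (i * d + j))"])
      (auto simp: torus_lattice_iff T_apply k d)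
qed

lemma Ti_translate:
  assumes "k \<in> torus_lattice"
  obtains k' where "k' \<in> torus_lattice" "\<And>\<xi>. Ti (\<xi> + k) = Ti \<xi> + k'"
proof -
  obtain d where d: "\<And>x k. h (x + of_int k) = h x + of_int (k * d)" using h_shift by blast
  obtain i j :: int where k: "k = (of_int i, of_int j)" using assms
    by (cases k) (auto simp: torus_lattice_iff elim!: Ints_cases)
  have *: "h (x + of_int i - (y + of_int j)) = h (x - y) + of_int ((i - j) * d)" for x y
    using d[of "x - y" "i - j"] by (simp add: algebra_simps)
  show thesis
    by (rule that[of "(of_int (i - j), of_int (j - (i - j) * d))"])
      (auto simp: torus_lattice_iff Ti_apply k *)
qed

lemma T_0: "T 0 \<in> torus_lattice"
  using h_0 by (simp add: zero_prod_def T_apply torus_lattice_iff)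

lemma T_lattice: "\<xi> \<in> torus_lattice \<Longrightarrow> T \<xi> \<in> torus_lattice"
  using T_translate[of \<xi>] T_0 torus_lattice_add by (metis add_0)

lemma Ti_lattice: "\<xi> \<in> torus_lattice \<Longrightarrow> Ti \<xi> \<in> torus_lattice"
proof -
  assume \<xi>: "\<xi> \<in> torus_lattice"
  \<comment> \<open>Translating \<open>T 0\<close>, whose preimage is 0, by
    \<open>\<xi> - T 0\<close> reaches \<open>\<xi>\<close>.\<close>
  obtain k' where k': "k' \<in> torus_lattice" "\<And>\<xi>'. Ti (\<xi>' + (\<xi> - T 0)) = Ti \<xi>' + k'"
    using Ti_translate[of "\<xi> - T 0"] \<xi> T_0 torus_lattice_diff by metis
  from k'(2)[of "T 0"] have "Ti \<xi> = k'" by simp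
  then show ?thesis using k' by simp
qed

lemma T_lattice_iff [simp]: "T \<xi> \<in> torus_lattice \<longleftrightarrow> \<xi> \<in> torus_lattice"
  by (metis T_lattice Ti_lattice Ti_T)

lemma Ti_lattice_iff [simp]: "Ti \<xi> \<in> torus_lattice \<longleftrightarrow> \<xi> \<in> torus_lattice"
  by (metis T_lattice Ti_lattice T_Ti)

lemma torus_periodic_compose_T: "torus_periodic g \<Longrightarrow> torus_periodic (\<lambda>\<xi>. g (T \<xi>))"
  unfolding torus_periodic_def by (metis T_translate)

lemma continuous_T [continuous_intros]: "continuous_on S f \<Longrightarrow> continuous_on S (\<lambda>x. T (f x))"
  unfolding torus_map_def case_prod_beta by (intro continuous_intros)

lemma continuous_Ti [continuous_intros]: "continuous_on S f \<Longrightarrow> continuous_on S (\<lambda>x. Ti (f x))"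
  unfolding Ti_def case_prod_beta by (intro continuous_intros)

section \<open>Scaled coordinates around the lattice\<close>

definition rad :: "real \<times> real \<Rightarrow> real" where
  "rad \<xi> = radius (c * frac_part (fst \<xi>)) (c * frac_part (snd \<xi>))"

definition sub :: "real \<times> real \<Rightarrow> real" where
  "sub \<xi> = subslope (c * frac_part (fst \<xi>)) (c * frac_part (snd \<xi>))"

lemma continuous_rad: "continuous_on UNIV rad"
proof -
  define A B where "A \<xi> = \<bar>frac_part (snd \<xi>)\<bar>" and "B \<xi> = \<bar>frac_part (fst \<xi>)\<bar>" for \<xi> :: "real \<times> real"
  have "rad = (\<lambda>\<xi>. sqrt (c * A \<xi> + c^2 * (B \<xi>)^2))"
    using c_pos by (auto simp: A_def B_def rad_def radius_def fun_eq_iff abs_mult power_mult_distrib)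
  moreover have "continuous_on UNIV A" "continuous_on UNIV B"
    unfolding A_def B_def by (rule continuous_on_compose2[OF continuous_abs_frac_part[of UNIV]];
      auto intro: continuous_on_fst continuous_on_snd continuous_on_id)+
  ultimately show ?thesis by (auto intro!: continuous_intros)
qed

lemma rad_periodic: "torus_periodic rad"
  by (auto simp: torus_periodic_def rad_def torus_lattice_def elim!: Ints_cases)

lemma rad_nonneg: "0 \<le> rad \<xi>"
  by (simp add: rad_def radius_nonneg)

lemma rad_eq_0_iff: "rad \<xi> = 0 \<longleftrightarrow> \<xi> \<in> torus_lattice"
  using c_pos by (cases \<xi>) (auto simp: rad_def radius_def add_nonneg_eq_0_iff torus_lattice_iff frac_part_eq_0_iff)

lemma rad_pos_iff: "0 < rad \<xi> \<longleftrightarrow> \<xi> \<notin> torus_lattice"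
  using rad_nonneg[of \<xi>] rad_eq_0_iff[of \<xi>] by auto

lemma rad_bounded: obtains R where "R > 0" "\<And>\<xi>. rad \<xi> \<le> R"
proof (rule that[of "sqrt (c + c^2)"])
  show "rad \<xi> \<le> sqrt (c + c^2)" for \<xi>
  proof -
    have "c * \<bar>frac_part (snd \<xi>)\<bar> \<le> c * 1" using frac_part_le_half[of "snd \<xi>"] c_pos by (intro mult_left_mono) auto
    moreover have "\<bar>frac_part (fst \<xi>)\<bar>^2 \<le> 1^2" using frac_part_le_half[of "fst \<xi>"] by (intro power_mono) auto
    then have "c^2 * \<bar>frac_part (fst \<xi>)\<bar>^2 \<le> c^2 * 1" by (intro mult_left_mono) auto
    ultimately have "\<bar>c * frac_part (snd \<xi>)\<bar> + (c * frac_part (fst \<xi>))\<^sup>2 \<le> c + c^2"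
      using c_pos by (simp only: abs_mult power_mult_distrib power2_abs abs_of_pos mult_1_right)
    then show ?thesis unfolding rad_def radius_def by (rule real_sqrt_le_mono)
  qed
qed (use c_pos in \<open>simp add: add_pos_pos\<close>)

text \<open>Packs the hypotheses of the model lemmas. \<open>k\<close> is the scaled increment of
  the second coordinate, and the last two equations say that no coordinate wraps around modulo 1 in
  this step.\<close>

definition nearly_cubic :: "real \<times> real \<Rightarrow> bool" where
  "nearly_cubic \<xi> \<longleftrightarrow> (let x = c * frac_part (fst \<xi>); y = c * frac_part (snd \<xi>) in
    \<exists>k. \<bar>k - 2 * x^3\<bar> \<le> 1/100000 * \<bar>x\<bar>^3 \<and> \<bar>p (fst \<xi>) - 6 * x^2\<bar> \<le> 1/100000 * x^2 \<and>
      c * frac_part (fst (T \<xi>)) = x + y + k \<and> c * frac_part (snd (T \<xi>)) = y + k)"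

lemma near_lattice:
  obtains \<rho> where "\<rho> > 0" "\<rho> \<le> 1/100000"
    "\<And>\<xi>. rad \<xi> \<le> \<rho> \<Longrightarrow> nearly_cubic \<xi>"
proof -
  obtain s where s: "s > 0"
    "\<And>x. \<bar>x\<bar> \<le> s \<Longrightarrow> \<bar>c * h0 x - 2 * (c * x)^3\<bar> \<le> 1/100000 * \<bar>c * x\<bar>^3"
    "\<And>x. \<bar>x\<bar> \<le> s \<Longrightarrow> \<bar>p x - 6 * (c * x)^2\<bar> \<le> 1/100000 * (c * x)^2"
    using local_expansion by blast
  obtain d where d: "\<And>x k. h (x + of_int k) = h x + of_int (k * d)" using h_shift by blast
  obtain m :: int where m: "h 0 = of_int m" using h_0 by (auto elim: Ints_cases)
  \<comment> \<open>\<open>c * s\<close> keeps the point in the range of the expansion;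
    \<open>c / 8\<close> keeps the two coordinates and \<open>h0\<close> below 1/8 each, so that
    their sum stays below 1/2 and is its own \<open>frac_part\<close>.\<close>
  define r where "r = min (1/100000) (min (c * s) (c / 8))"
  show thesis
  proof (rule that[of r])
    show "r > 0" using c_pos s by (simp add: r_def)
    show "r \<le> 1/100000" by (simp add: r_def)
    fix \<xi> assume "rad \<xi> \<le> r"
    moreover obtain x y where \<xi>: "\<xi> = (x, y)" by fastforce
    ultimately have xy: "rad (x, y) \<le> r" by simp
    define X Y where "X = frac_part x" and "Y = frac_part y"
    have R: "rad (x, y) = radius (c * X) (c * Y)" by (simp add: rad_def X_def Y_def)
    have "0 \<le> r" "r \<le> 1" using c_pos s by (simp_all add: r_def)
    then have rr: "r^2 \<le> r" by (simp add: power2_eq_square mult_left_le)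
    have X: "\<bar>c * X\<bar> \<le> r" using abs_le_radius[of "c * X" "c * Y"] xy R by linarith
    have "(rad (x, y))^2 \<le> r^2" using xy rad_nonneg by (intro power_mono)
    then have Y: "\<bar>c * Y\<bar> \<le> r" using abs_le_radius_sq[of "c * Y" "c * X"] rr unfolding R by linarith
    have "r \<le> c * s" by (simp add: r_def)
    moreover have "c * \<bar>X\<bar> = \<bar>c * X\<bar>" using c_pos by (simp add: abs_mult)
    ultimately have "c * \<bar>X\<bar> \<le> c * s" using X by linarith
    then have Xs: "\<bar>X\<bar> \<le> s" using c_pos by simp
    note e = s(2,3)[OF Xs]
    have k3: "\<bar>c * h0 X\<bar> \<le> r"
    proof -
      have "\<bar>c * h0 X\<bar> \<le> \<bar>c * h0 X - 2 * (c * X)^3\<bar> + 2 * \<bar>c * X\<bar>^3" by (simp add: power_abs[symmetric])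
      also have "\<dots> \<le> 3 * \<bar>c * X\<bar>^3" using e(1) zero_le_power[OF abs_ge_zero[of "c * X"], of 3] by linarith
      also have "\<bar>c * X\<bar>^3 \<le> \<bar>c * X\<bar> * (1/3)"
      proof -
        have "\<bar>c * X\<bar> \<le> 1/100000" using X unfolding r_def by linarith
        then have "\<bar>c * X\<bar>^2 \<le> (1/100000)^2" by (intro power_mono) auto
        then have "\<bar>c * X\<bar>^2 \<le> 1/3" by (simp add: power2_eq_square)
        then have "\<bar>c * X\<bar> * \<bar>c * X\<bar>^2 \<le> \<bar>c * X\<bar> * (1/3)" by (rule mult_left_mono) simp
        then show ?thesis unfolding power3_eq_cube power2_eq_square by (simp only: mult.assoc)
      qed
      finally show ?thesis using X by simp
    qed
    have small: "\<bar>z\<bar> \<le> 1/8" if "\<bar>c * z\<bar> \<le> r" for z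
    proof -
      have "r \<le> c * (1/8)" by (simp add: r_def)
      moreover have "c * \<bar>z\<bar> = \<bar>c * z\<bar>" using c_pos by (simp add: abs_mult)
      ultimately have "c * \<bar>z\<bar> \<le> c * (1/8)" using that by linarith
      then show ?thesis using c_pos by (simp only: mult_le_cancel_left_pos)
    qed
    have b: "\<bar>X\<bar> \<le> 1/8" "\<bar>Y\<bar> \<le> 1/8" "\<bar>h0 X\<bar> \<le> 1/8" using small X Y k3 by auto
    have hx: "h x = h0 X + of_int (m + round x * d)"
      using d[of X "round x"] m by (simp add: X_def frac_part_def h0_def)
    have x: "x = X + of_int (round x)" and y: "y = Y + of_int (round y)"
      by (auto simp: X_def Y_def frac_part_def)
    have "frac_part (x + h x + y) = X + Y + h0 X"
    proof -
      have "frac_part (x + h x + y) = frac_part (X + Y + h0 X + of_int (round x + round y + m + round x * d))"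
        by (subst x, subst y, subst hx) (simp add: algebra_simps)
      also have "\<dots> = frac_part (X + Y + h0 X)" by (rule frac_part_add_int)
      also have "\<dots> = X + Y + h0 X" using frac_part_eqI[of "X + Y + h0 X" 0] b unfolding of_int_0 diff_0_right by linarith
      finally show ?thesis .
    qed
    moreover have "frac_part (h x + y) = Y + h0 X"
    proof -
      have "frac_part (h x + y) = frac_part (Y + h0 X + of_int (round y + m + round x * d))"
        by (subst y, subst hx) (simp add: algebra_simps)
      also have "\<dots> = frac_part (Y + h0 X)" by (rule frac_part_add_int)
      also have "\<dots> = Y + h0 X" using frac_part_eqI[of "Y + h0 X" 0] b unfolding of_int_0 diff_0_right by linarith
      finally show ?thesis .
    qed
    moreover have "p x = p X" unfolding X_def by (rule p_frac_part)
    ultimately show "nearly_cubic \<xi>"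
      unfolding \<xi> nearly_cubic_def Let_def fst_conv snd_conv using e by (intro exI[of _ "c * h0 X"]) (simp add: T_apply X_def Y_def algebra_simps)
  qed
qed

abbreviation dp :: "real \<times> real \<Rightarrow> real" where "dp \<xi> \<equiv> p (fst \<xi>)"

lemma has_derivative_h: "(h has_derivative (\<lambda>w. w * p z)) (at z)"
  and has_derivative_p: "(p has_derivative (\<lambda>w. w * q z)) (at z)"
  using DERIV_h[of z] DERIV_p[of z] by (simp_all add: has_field_derivative_def mult_commute_abs)

lemma has_derivative_Ti:
  "(Ti has_derivative (\<lambda>w. (fst w - snd w, snd w - dp (Ti \<xi>) * (fst w - snd w)))) (at \<xi>)"
proof -
  have "((\<lambda>\<xi>. h (fst \<xi> - snd \<xi>)) has_derivative (\<lambda>w. (fst w - snd w) * p (fst \<xi> - snd \<xi>))) (at \<xi>)"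
    by (rule has_derivative_compose[OF _ has_derivative_h]) (auto intro!: derivative_eq_intros)
  then have "((\<lambda>\<xi>. (fst \<xi> - snd \<xi>, snd \<xi> - h (fst \<xi> - snd \<xi>))) has_derivative
     (\<lambda>w. (fst w - snd w, snd w - (fst w - snd w) * p (fst \<xi> - snd \<xi>)))) (at \<xi>)"
    by (intro has_derivative_Pair has_derivative_diff has_derivative_fst has_derivative_snd has_derivative_ident)
  moreover have "Ti = (\<lambda>\<xi>. (fst \<xi> - snd \<xi>, snd \<xi> - h (fst \<xi> - snd \<xi>)))"
    by (auto simp: Ti_def)
  ultimately show ?thesis by (simp add: mult.commute)
qed

section \<open>Comparison of slope fields and time reversal\<close>

text \<open>A positive difference \<open>d = A \<xi> - B \<xi>\<close> would grow at least by the factor \<open>1 + d\<close> along each step of the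
  backward orbit.\<close>

lemma slope_comparison:
  assumes A: "\<And>\<xi>. 0 \<le> A \<xi>" "\<And>\<xi>. A \<xi> \<le> M" and B: "\<And>\<xi>. 0 \<le> B \<xi>"
    and step: "\<And>\<xi>. A (T \<xi>) \<le> B (T \<xi>) \<or>
      A (T \<xi>) \<le> slope_map (dp \<xi> + A \<xi>) \<and> slope_map (dp \<xi> + B \<xi>) \<le> B (T \<xi>)"
  shows "A \<xi> \<le> B \<xi>"
proof (rule ccontr)
  assume neg: "\<not> A \<xi> \<le> B \<xi>"
  define d where "d = A \<xi> - B \<xi>"
  have d: "d > 0" using neg by (simp add: d_def)
  have bwd: "(1 + d) * (A \<eta> - B \<eta>) \<le> A (Ti \<eta>) - B (Ti \<eta>)" if "d \<le> A \<eta> - B \<eta>" for \<eta>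
  proof -
    define \<zeta> where "\<zeta> = Ti \<eta>"
    have T: "T \<zeta> = \<eta>" by (simp add: \<zeta>_def)
    define a b where "a = dp \<zeta> + A \<zeta>" and "b = dp \<zeta> + B \<zeta>"
    have ab: "0 \<le> a" "0 \<le> b" using A B p_nonneg by (auto simp: a_def b_def)
    \<comment> \<open>The first alternative of \<open>step\<close> would give
      \<open>A \<eta> \<le> B \<eta>\<close>, against \<open>d > 0\<close>.\<close>
    have "A \<eta> - B \<eta> \<le> slope_map a - slope_map b" using step[of \<zeta>] that d unfolding T a_def b_def by auto
    also have "\<dots> = (A \<zeta> - B \<zeta>) / ((1 + a) * (1 + b))" using slope_map_diff[OF ab] by (simp add: a_def b_def)
    finally have le: "(A \<eta> - B \<eta>) * ((1 + a) * (1 + b)) \<le> A \<zeta> - B \<zeta>" using ab by (simp add: le_divide_eq)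
    have pos: "A \<eta> - B \<eta> > 0" using that d by simp
    have "A \<eta> - B \<eta> \<le> (A \<eta> - B \<eta>) * ((1 + a) * (1 + b))"
    proof -
      have "1 * 1 \<le> (1 + a) * (1 + b)" using ab by (intro mult_mono) auto
      then show ?thesis using pos by simp
    qed
    then have "d \<le> A \<zeta> - B \<zeta>" using le that by linarith
    then have "d \<le> a" using B[of \<zeta>] p_nonneg[of "fst \<zeta>"] by (simp add: a_def)
    then have "(1 + d) * 1 \<le> (1 + a) * (1 + b)" using ab d by (intro mult_mono) auto
    then have "(A \<eta> - B \<eta>) * (1 + d) \<le> (A \<eta> - B \<eta>) * ((1 + a) * (1 + b))" using pos by simp
    then show ?thesis using le by (simp add: \<zeta>_def mult.commute)
  qed
  have grow: "(1 + d)^n * d \<le> A ((Ti ^^ n) \<xi>) - B ((Ti ^^ n) \<xi>)" for n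
  proof (induction n)
    case (Suc n)
    have "1 * d \<le> (1 + d)^n * d" using d by (intro mult_right_mono) (auto intro: one_le_power)
    then have "(1 + d) * (A ((Ti ^^ n) \<xi>) - B ((Ti ^^ n) \<xi>)) \<le> A (Ti ((Ti ^^ n) \<xi>)) - B (Ti ((Ti ^^ n) \<xi>))"
      using Suc by (intro bwd) simp
    moreover have "(1 + d) * ((1 + d)^n * d) \<le> (1 + d) * (A ((Ti ^^ n) \<xi>) - B ((Ti ^^ n) \<xi>))"
      using Suc d by (intro mult_left_mono) auto
    ultimately show ?case by (simp add: mult.assoc)
  qed (simp add: d_def)
  obtain n where "M / d < (1 + d)^n" using real_arch_pow[of "1 + d" "M / d"] d by auto
  then have "M < (1 + d)^n * d" using d by (simp add: divide_less_eq)
  then show False using grow[of n] A(2)[of "(Ti ^^ n) \<xi>"] B[of "(Ti ^^ n) \<xi>"] by linarith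
qed

definition reversor :: "real \<times> real \<Rightarrow> real \<times> real" where
  "reversor = (\<lambda>(x, y). (x - y, - y))"

lemma reversor_reversor [simp]: "reversor (reversor \<xi>) = \<xi>"
  by (cases \<xi>) (simp add: reversor_def)

lemma T_reversor_T: "T (reversor (T \<xi>)) = reversor \<xi>"
  by (cases \<xi>) (simp add: reversor_def T_apply)

lemma fst_reversor_T: "fst (reversor (T \<xi>)) = fst \<xi>"
  by (cases \<xi>) (simp add: reversor_def T_apply)

lemma reversor_lattice_iff [simp]: "reversor \<xi> \<in> torus_lattice \<longleftrightarrow> \<xi> \<in> torus_lattice"
proof -
  have "reversor \<xi> \<in> torus_lattice" if "\<xi> \<in> torus_lattice" for \<xi>
    using that by (cases \<xi>) (auto simp: reversor_def torus_lattice_iff)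
  from this[of \<xi>] this[of "reversor \<xi>"] show ?thesis by auto
qed

lemma continuous_reversor [continuous_intros]: "continuous_on S f \<Longrightarrow> continuous_on S (\<lambda>x. reversor (f x))"
  unfolding reversor_def case_prod_beta by (intro continuous_intros)

text \<open>Since \<open>y\<close> enters \<open>rad\<close> with its first power, passing from
  \<open>x\<close> to \<open>x - y\<close> changes the square only by multiples of
  \<open>\<bar>y\<bar>\<close> and of the new square. This moves the upper bound for
  \<open>u\<close> over to \<open>v\<close>.\<close>

lemma rad_reversor: obtains C where "C > 0" "\<And>\<xi>. rad \<xi> \<le> C * rad (reversor \<xi>)"
proof (rule that[of "sqrt (1 + 2 * c + 2)"])
  fix \<xi> :: "real \<times> real"
  obtain x y where xy: "\<xi> = (x, y)" by fastforce
  define X Y Z where "X = \<bar>frac_part x\<bar>" and "Y = \<bar>frac_part y\<bar>" and "Z = \<bar>frac_part (x - y)\<bar>"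
  have nn: "0 \<le> X" "0 \<le> Y" "0 \<le> Z" "Y \<le> 1" using frac_part_le_half[of y] by (auto simp: X_def Y_def Z_def)
  have XYZ: "X \<le> Y + Z" using frac_part_minimal[of x "round y + round (x - y)"]
    by (simp add: X_def Y_def Z_def frac_part_def)
  have Ym: "\<bar>frac_part (- y)\<bar> = Y"
  proof -
    have "\<bar>frac_part (- y)\<bar> \<le> \<bar>frac_part y\<bar>" for y
      using frac_part_minimal[of "- y" "- round y"] by (simp add: frac_part_def[of y])
    from this[of y] this[of "- y"] show ?thesis by (simp add: Y_def)
  qed
  have 1: "(rad \<xi>)^2 = c * Y + c^2 * X^2"
    using c_pos by (simp add: rad_def radius_sq xy X_def Y_def abs_mult power_mult_distrib)
  have 2: "(rad (reversor \<xi>))^2 = c * Y + c^2 * Z^2"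
    using c_pos Ym by (simp add: rad_def radius_sq xy reversor_def Z_def abs_mult power_mult_distrib)
  have "X^2 \<le> 2 * Y + 2 * Z^2"
  proof -
    have "X^2 \<le> (Y + Z)^2" using XYZ nn by (intro power_mono) auto
    also have "\<dots> \<le> 2 * Y^2 + 2 * Z^2" using zero_le_power2[of "Y - Z"] by (simp add: power2_eq_square algebra_simps)
    also have "Y^2 \<le> Y" using nn by (simp add: power2_eq_square mult_left_le)
    finally show ?thesis by simp
  qed
  then have "c^2 * X^2 \<le> c^2 * (2 * Y + 2 * Z^2)" by (intro mult_left_mono) auto
  then have "(rad \<xi>)^2 \<le> c * Y + 2 * c * (c * Y) + 2 * (c^2 * Z^2)"
    unfolding 1 by (simp add: power2_eq_square algebra_simps)
  also have "\<dots> \<le> (1 + 2 * c + 2) * (c * Y + c^2 * Z^2)"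
    using nn c_pos by (simp add: algebra_simps)
  finally have "(rad \<xi>)^2 \<le> (sqrt (1 + 2 * c + 2) * rad (reversor \<xi>))^2"
    using c_pos by (simp add: power_mult_distrib 2)
  then show "rad \<xi> \<le> sqrt (1 + 2 * c + 2) * rad (reversor \<xi>)"
    by (rule power2_le_imp_le) (use c_pos rad_nonneg in auto)
qed (use c_pos in auto)

end

section \<open>Invariant slope fields\<close>

text \<open>What the estimates use of the Oseledets directions: invariance under the derivative, at
  every point. \<open>u_step\<close> determines a slope from the past, \<open>v_step\<close> from
  the future; the latter is the action on \<open>(1, - v)\<close> solved for
  \<open>v \<xi>\<close>.\<close>

locale slope_fields = slow_torus_map h for h :: "real \<Rightarrow> real" +
  fixes u v :: "real \<times> real \<Rightarrow> real"
  assumes u_periodic: "torus_periodic u" and v_periodic: "torus_periodic v"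
    and u_cont: "continuous_on UNIV u" and v_cont: "continuous_on UNIV v"
    and u_nonneg: "\<And>\<xi>. 0 \<le> u \<xi>" and v_nonneg: "\<And>\<xi>. 0 \<le> v \<xi>"
    and u_step: "\<And>\<xi>. u (T \<xi>) = slope_map (dp \<xi> + u \<xi>)"
    and v_step: "\<And>\<xi>. v \<xi> = dp \<xi> + slope_map (v (T \<xi>))"
begin

lemma u_less_1: "u \<xi> < 1"
  using u_step[of "Ti \<xi>"] slope_map_bounds(2)[of "dp (Ti \<xi>) + u (Ti \<xi>)"] u_nonneg p_nonneg by simp

text \<open>Comparison in both directions; \<open>slope_map\<close> bounds every nonnegative
  solution by 1. Uniqueness gives the time-reversal symmetry below and makes the final constant
  independent of the chosen pair of slopes.\<close>

lemma u_unique: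
  assumes "\<And>\<xi>. 0 \<le> w \<xi>" "\<And>\<xi>. w (T \<xi>) = slope_map (dp \<xi> + w \<xi>)"
  shows "w \<xi> = u \<xi>"
proof (rule antisym)
  have "w \<xi> \<le> 1" for \<xi>
    using assms(2)[of "Ti \<xi>"] slope_map_bounds(2)[of "dp (Ti \<xi>) + w (Ti \<xi>)"] assms(1) p_nonneg by simp
  then show "w \<xi> \<le> u \<xi>" by (intro slope_comparison[of w 1 u]) (use assms u_nonneg u_step in auto)
  show "u \<xi> \<le> w \<xi>" by (rule slope_comparison[of u 1 w]) (use assms u_nonneg u_step u_less_1 in \<open>auto intro: less_imp_le\<close>)
qed

text \<open>The map is conjugate to its inverse by an involution that exchanges the two cone fields.\<close>

lemma v_reversor: "u \<xi> = slope_map (v (reversor \<xi>))"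
proof (rule u_unique[symmetric])
  show "0 \<le> slope_map (v (reversor \<xi>))" for \<xi> using v_nonneg by (rule slope_map_bounds)
  fix \<xi>
  have "v (reversor (T \<xi>)) = dp \<xi> + slope_map (v (reversor \<xi>))"
    using v_step[of "reversor (T \<xi>)"] by (simp add: T_reversor_T fst_reversor_T)
  then show "slope_map (v (reversor (T \<xi>))) = slope_map (dp \<xi> + slope_map (v (reversor \<xi>)))" by simp
qed

lemma v_eq: "v \<xi> = u (reversor \<xi>) / (1 - u (reversor \<xi>))"
proof -
  have v: "1 + v \<xi> > 0" using v_nonneg[of \<xi>] by linarith
  have u: "u (reversor \<xi>) = v \<xi> / (1 + v \<xi>)" using v_reversor[of "reversor \<xi>"] by (simp add: slope_map_def)
  have "1 - u (reversor \<xi>) = 1 / (1 + v \<xi>)" unfolding u using v by (simp add: field_simps)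
  then show ?thesis unfolding u using v by simp
qed

text \<open>A zero of \<open>u\<close> propagates backwards and forces \<open>dp = 0\<close>, so
  \<open>Ti \<xi>\<close> and its preimage both have an integral first coordinate. If
  \<open>Ti \<xi> = (x, y)\<close>, these coordinates are \<open>x\<close> and \<open>x - y\<close>,
  which puts \<open>Ti \<xi>\<close> in the lattice.\<close>

lemma u_pos: assumes "\<xi> \<notin> torus_lattice" shows "0 < u \<xi>"
proof (rule ccontr)
  assume "\<not> 0 < u \<xi>"
  then have 0: "u \<xi> = 0" using u_nonneg[of \<xi>] by simp
  have bwd: "u (Ti \<eta>) = 0 \<and> dp (Ti \<eta>) = 0" if "u \<eta> = 0" for \<eta>
  proof -
    have "slope_map (dp (Ti \<eta>) + u (Ti \<eta>)) = 0" using u_step[of "Ti \<eta>"] that by simp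
    then show ?thesis using u_nonneg[of "Ti \<eta>"] p_nonneg[of "fst (Ti \<eta>)"]
      by (auto simp: slope_map_def divide_eq_0_iff)
  qed
  obtain x y where xy: "Ti \<xi> = (x, y)" by fastforce
  have "x \<in> \<int>" using bwd[OF 0] xy p_eq_0_iff by auto
  moreover have "x - y \<in> \<int>" using bwd[of "Ti \<xi>"] bwd[OF 0] xy p_eq_0_iff by (auto simp: Ti_apply)
  ultimately have "Ti \<xi> \<in> torus_lattice" unfolding xy torus_lattice_iff using Ints_diff[of x "x - y"] by simp
  then show False using assms by simp
qed

section \<open>Bounds of the slopes by the distance to the lattice\<close>

lemma u_lower: obtains K where "K \<ge> 0" "\<And>\<xi>. sub \<xi> / (1 + K * rad \<xi>) \<le> u \<xi>"
proof -
  obtain \<rho> where \<rho>: "\<rho> > 0" "\<rho> \<le> 1/100000"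
    and near: "\<And>\<xi>. rad \<xi> \<le> \<rho> \<Longrightarrow> nearly_cubic \<xi>"
    using near_lattice by blast
  obtain m where m: "0 < m" "\<And>\<xi>. \<rho> \<le> rad \<xi> \<Longrightarrow> m \<le> u \<xi>"
  proof (rule torus_periodic_bounded_below[OF u_cont u_periodic continuous_rad rad_periodic])
    show "0 < u \<xi>" if "\<rho> \<le> rad \<xi>" for \<xi> using that \<rho>(1) rad_pos_iff[of \<xi>] u_pos by simp
  qed blast
  obtain R where R: "R > 0" "\<And>\<xi>. rad \<xi> \<le> R" using rad_bounded by blast
  \<comment> \<open>\<open>sub / (1 + K * rad)\<close> never exceeds \<open>2 / K\<close>; this
    \<open>K\<close> makes it at most \<open>slope_map m\<close>, a lower bound of
    \<open>u (T \<xi>)\<close> for \<open>\<xi>\<close> away from the lattice.\<close>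
  define K where "K = 2 / slope_map m"
  have sm: "0 < slope_map m" using m by (simp add: slope_map_def)
  have K: "K > 0" using sm by (simp add: K_def)
  have subb: "0 \<le> sub \<xi>" "sub \<xi> \<le> 2 * rad \<xi>" for \<xi>
    unfolding sub_def rad_def by (auto intro: subslope_nonneg subslope_bounds)
  have den: "1 + K * rad \<xi> > 0" for \<xi> using K rad_nonneg[of \<xi>] by (simp add: add_pos_nonneg)
  have "sub \<xi> / (1 + K * rad \<xi>) \<le> u \<xi>" for \<xi>
  proof (rule slope_comparison[where M = "2 * R"])
    fix \<xi>
    show "0 \<le> sub \<xi> / (1 + K * rad \<xi>)" using subb den[of \<xi>] by simp
    have "sub \<xi> / (1 + K * rad \<xi>) \<le> sub \<xi> / 1" using subb den[of \<xi>] K rad_nonneg[of \<xi>]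
      by (intro divide_left_mono) auto
    then show "sub \<xi> / (1 + K * rad \<xi>) \<le> 2 * R" using subb(2)[of \<xi>] R(2)[of \<xi>] by simp
    show "0 \<le> u \<xi>" by (rule u_nonneg)
    obtain x y where xy: "\<xi> = (x, y)" by fastforce
    show "sub (T \<xi>) / (1 + K * rad (T \<xi>)) \<le> u (T \<xi>) \<or>
      sub (T \<xi>) / (1 + K * rad (T \<xi>)) \<le> slope_map (dp \<xi> + sub \<xi> / (1 + K * rad \<xi>)) \<and>
      slope_map (dp \<xi> + u \<xi>) \<le> u (T \<xi>)"
    proof (cases "rad \<xi> \<le> \<rho>")
      case True
      then obtain k where k: "\<bar>k - 2 * (c * frac_part x)^3\<bar> \<le> 1/100000 * \<bar>c * frac_part x\<bar>^3"
        "\<bar>p x - 6 * (c * frac_part x)^2\<bar> \<le> 1/100000 * (c * frac_part x)^2"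
        "c * frac_part (fst (T (x, y))) = c * frac_part x + c * frac_part y + k"
        "c * frac_part (snd (T (x, y))) = c * frac_part y + k"
        using near[of \<xi>, unfolded nearly_cubic_def Let_def] xy by auto
      have "radius (c * frac_part x) (c * frac_part y) \<le> 1/100000" using True \<rho> xy by (simp add: rad_def)
      from scaled_subslope_step[OF k(1,2) this less_imp_le[OF K]] show ?thesis
        by (simp add: sub_def rad_def xy k(3,4) u_step)
    next
      case False
      have "sub (T \<xi>) / (1 + K * rad (T \<xi>)) \<le> 2 / K"
      proof -
        have "K * sub (T \<xi>) \<le> K * (2 * rad (T \<xi>))" using subb(2) K by (intro mult_left_mono) auto
        then have "sub (T \<xi>) * K \<le> 2 * (1 + K * rad (T \<xi>))" by (simp add: algebra_simps)
        then show ?thesis using den[of "T \<xi>"] K by (simp add: field_simps)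
      qed
      also have "\<dots> = slope_map m" by (simp add: K_def)
      also have "\<dots> \<le> slope_map (dp \<xi> + u \<xi>)" using m(1) m(2)[of \<xi>] False p_nonneg[of "fst \<xi>"]
        by (intro slope_map_mono) auto
      finally show ?thesis by (simp add: u_step)
    qed
  qed
  then show thesis using that[of K] K by simp
qed

lemma u_ge_rad: obtains b where "b > 0" "\<And>\<xi>. b * rad \<xi> \<le> u \<xi>"
proof -
  obtain K where K: "K \<ge> 0" "\<And>\<xi>. sub \<xi> / (1 + K * rad \<xi>) \<le> u \<xi>" using u_lower by blast
  obtain R where R: "R > 0" "\<And>\<xi>. rad \<xi> \<le> R" using rad_bounded by blast
  have 1: "1 + K * R > 0" using K R by (simp add: add_pos_nonneg)
  have "1 / (25 * (1 + K * R)) * rad \<xi> \<le> u \<xi>" for \<xi>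
  proof -
    have s: "rad \<xi> / 25 \<le> sub \<xi>"
      unfolding sub_def rad_def using subslope_bounds(1)[of "c * frac_part (fst \<xi>)" "c * frac_part (snd \<xi>)"] by linarith
    have "K * rad \<xi> \<le> K * R" using K R by (intro mult_left_mono) auto
    moreover have "K * rad \<xi> \<ge> 0" using K rad_nonneg by simp
    ultimately have "(rad \<xi> / 25) / (1 + K * R) \<le> sub \<xi> / (1 + K * rad \<xi>)"
      using s rad_nonneg[of \<xi>] by (intro frac_le) auto
    then show ?thesis using K(2)[of \<xi>] by simp
  qed
  then show thesis using that[of "1 / (25 * (1 + K * R))"] 1 by simp
qed

lemma rad_step: obtains \<rho> where "\<rho> > 0" "\<rho> \<le> 1/100000"
    "\<And>\<xi>. rad \<xi> \<le> \<rho> \<Longrightarrow> rad \<xi> * (1 - 2 * rad \<xi>) \<le> rad (T \<xi>)"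
    "\<And>\<xi>. rad \<xi> \<le> \<rho> \<Longrightarrow> rad (T \<xi>) \<le> rad \<xi> * (1 + 2 * rad \<xi>)"
    "\<And>\<xi>. rad \<xi> \<le> \<rho> \<Longrightarrow> dp \<xi> \<le> 7 * (rad \<xi>)^2"
    "\<And>\<xi> K. rad \<xi> \<le> \<rho> \<Longrightarrow> 0 < rad \<xi> \<Longrightarrow> 0 \<le> K \<Longrightarrow> K * rad \<xi> \<le> 1/600 \<Longrightarrow> 
      sub \<xi> / (1 + K * rad \<xi>) \<le> u \<xi> \<Longrightarrow> 1 + 1 / (1 + dp \<xi> + u \<xi>) * (200 / rad \<xi>) \<le> 200 / rad (T \<xi>)"
proof -
  obtain \<rho> where \<rho>: "\<rho> > 0" "\<rho> \<le> 1/100000"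
    and near: "\<And>\<xi>. rad \<xi> \<le> \<rho> \<Longrightarrow> nearly_cubic \<xi>"
    using near_lattice by blast
  have *: "rad \<xi> * (1 - 2 * rad \<xi>) \<le> rad (T \<xi>) \<and> rad (T \<xi>) \<le> rad \<xi> * (1 + 2 * rad \<xi>) \<and>
      dp \<xi> \<le> 7 * (rad \<xi>)^2 \<and> (\<forall>K. 0 < rad \<xi> \<longrightarrow> 0 \<le> K \<longrightarrow> K * rad \<xi> \<le> 1/600 \<longrightarrow>
      sub \<xi> / (1 + K * rad \<xi>) \<le> u \<xi> \<longrightarrow> 1 + 1 / (1 + dp \<xi> + u \<xi>) * (200 / rad \<xi>) \<le> 200 / rad (T \<xi>))"
    if r: "rad \<xi> \<le> \<rho>" for \<xi>
  proof -
    obtain x y where xy: "\<xi> = (x, y)" by fastforce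
    obtain k where k: "\<bar>k - 2 * (c * frac_part x)^3\<bar> \<le> 1/100000 * \<bar>c * frac_part x\<bar>^3"
      "\<bar>p x - 6 * (c * frac_part x)^2\<bar> \<le> 1/100000 * (c * frac_part x)^2"
      "c * frac_part (fst (T (x, y))) = c * frac_part x + c * frac_part y + k"
      "c * frac_part (snd (T (x, y))) = c * frac_part y + k"
      using near[of \<xi>, unfolded nearly_cubic_def Let_def] xy r by auto
    define X Y where "X = c * frac_part x" and "Y = c * frac_part y"
    have R: "rad \<xi> = radius X Y" "rad (T \<xi>) = radius (X + Y + k) (Y + k)" "sub \<xi> = subslope X Y"
      using k(3,4) by (auto simp: rad_def sub_def xy X_def Y_def)
    have small: "radius X Y \<le> 1/100000" using r \<rho> R by simp
    have kX: "\<bar>k - 2 * X^3\<bar> \<le> 1/100000 * \<bar>X\<bar>^3" using k(1) by (simp add: X_def)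
    have XR: "\<bar>X\<bar> \<le> rad \<xi>" unfolding R by (rule abs_le_radius)
    have X2: "X^2 \<le> (rad \<xi>)^2" using power_mono[OF XR, of 2] by simp
    have e: "\<bar>X\<bar> + 24/100000 * rad \<xi> \<le> 2 * rad \<xi>" using XR rad_nonneg[of \<xi>] by linarith
    have 1: "rad \<xi> * (1 - 2 * rad \<xi>) \<le> rad \<xi> * (1 - \<bar>X\<bar> - 24/100000 * rad \<xi>)"
      using e rad_nonneg[of \<xi>] by (intro mult_left_mono) auto
    have 2: "rad \<xi> * (1 + \<bar>X\<bar> + 24/100000 * rad \<xi>) \<le> rad \<xi> * (1 + 2 * rad \<xi>)"
      using e rad_nonneg[of \<xi>] by (intro mult_left_mono) auto
    have 3: "dp \<xi> \<le> 7 * (rad \<xi>)^2" using k(2) X2 zero_le_power2[of X] unfolding xy X_def[symmetric] fst_conv abs_le_iff by linarith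
    show ?thesis using 1 2 3 radius_step[OF kX small, folded R]
        inverse_radius_step[OF kX _ small, folded R] p_nonneg by fastforce
  qed
  show thesis by (rule that[OF \<rho>]) (use * in blast)+
qed

text \<open>A large multiple of \<open>rad\<close> is a supersolution of the slope equation: the
  quadratic loss \<open>(C * r)^2\<close> beats the forcing \<open>7 * r^2\<close> together with the
  possible decrease \<open>2 * C * r^2\<close> of \<open>C * rad\<close>.\<close>

lemma u_le_rad: obtains C where "C > 0" "\<And>\<xi>. u \<xi> \<le> C * rad \<xi>"
proof -
  obtain \<rho> where \<rho>: "\<rho> > 0" "\<rho> \<le> 1/100000"
    "\<And>\<xi>. rad \<xi> \<le> \<rho> \<Longrightarrow> rad \<xi> * (1 - 2 * rad \<xi>) \<le> rad (T \<xi>)"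
    "\<And>\<xi>. rad \<xi> \<le> \<rho> \<Longrightarrow> dp \<xi> \<le> 7 * (rad \<xi>)^2"
    using rad_step by metis
  obtain m where m: "0 < m" "\<And>\<xi>. \<rho> \<le> rad \<xi> \<Longrightarrow> m \<le> rad (T \<xi>)"
  proof (rule torus_periodic_bounded_below[of "\<lambda>\<xi>. rad (T \<xi>)" rad \<rho>])
    show "continuous_on UNIV (\<lambda>\<xi>. rad (T \<xi>))"
      by (rule continuous_on_compose2[OF continuous_rad]) (auto intro!: continuous_intros)
    show "0 < rad (T \<xi>)" if "\<rho> \<le> rad \<xi>" for \<xi> using that \<rho>(1) rad_pos_iff[of \<xi>] rad_pos_iff[of "T \<xi>"] by simp
  qed (auto intro: torus_periodic_compose_T rad_periodic continuous_rad)
  \<comment> \<open>8 suffices for \<open>7 + 2 * C \<le> C * C / 2\<close>; \<open>1 / m\<close>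
    makes \<open>C * rad (T \<xi>) \<ge> 1\<close> away from the lattice, where \<open>u < 1\<close>
    is enough.\<close>
  define C where "C = max 8 (1 / m)"
  have C: "8 \<le> C" "1 / m \<le> C" by (auto simp: C_def)
  have "u \<xi> \<le> C * rad \<xi>" for \<xi>
  proof (rule slope_comparison[of u 1])
    fix \<xi>
    show "0 \<le> C * rad \<xi>" using C rad_nonneg by simp
    show "u (T \<xi>) \<le> C * rad (T \<xi>) \<or>
      u (T \<xi>) \<le> slope_map (dp \<xi> + u \<xi>) \<and> slope_map (dp \<xi> + C * rad \<xi>) \<le> C * rad (T \<xi>)"
    proof (cases "rad \<xi> \<le> \<rho>")
      case True
      define r where "r = rad \<xi>"
      define P where "P = dp \<xi>"
      have r: "0 \<le> r" "r \<le> 1/100000" using True \<rho>(2) rad_nonneg by (auto simp: r_def)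
      have P: "0 \<le> P" "P \<le> 7 * r^2" using \<rho>(4)[OF True] p_nonneg by (auto simp: r_def P_def)
      have "P + C * r \<le> C * (r * (1 - 2 * r)) * (1 + P + C * r)"
      proof -
        have half: "1/2 \<le> 1 - 2 * r" using r by simp
        have "(C * r) * (1/2) * (C * r) \<le> (C * r) * (1 - 2 * r) * (P + C * r)"
          using half P r C by (intro mult_mono mult_nonneg_nonneg) auto
        moreover have "P + 2 * (C * r^2) \<le> (C * r) * (1/2) * (C * r)"
        proof -
          have "7 + 2 * C \<le> C * C / 2"
          proof -
            have "8 * C \<le> C * C" using C by (intro mult_right_mono) auto
            then show ?thesis using C by linarith
          qed
          then have "(7 + 2 * C) * r^2 \<le> (C * C / 2) * r^2" by (intro mult_right_mono) auto
          then show ?thesis using P by (simp add: algebra_simps power2_eq_square)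
        qed
        ultimately show ?thesis by (simp add: algebra_simps power2_eq_square)
      qed
      then have "slope_map (P + C * r) \<le> C * (r * (1 - 2 * r))"
        using P r C by (simp add: slope_map_def divide_le_eq add_pos_nonneg add.assoc)
      also have "\<dots> \<le> C * rad (T \<xi>)" using \<rho>(3)[OF True] C by (intro mult_left_mono) (auto simp: r_def)
      finally show ?thesis by (simp add: r_def P_def u_step)
    next
      case False
      have "1 \<le> C * m" using C m by (simp add: divide_le_eq)
      also have "\<dots> \<le> C * rad (T \<xi>)" using m(2)[of \<xi>] False C by (intro mult_left_mono) auto
      finally show ?thesis using u_less_1[of "T \<xi>"] by simp
    qed
  qed (use u_nonneg u_less_1 in \<open>auto intro: less_imp_le\<close>)
  then show thesis using that[of C] C by simp
qed

lemma v_le_rad: obtains C where "C > 0" "\<And>\<xi>. v \<xi> \<le> C * rad \<xi>"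
proof -
  obtain C1 where C1: "C1 > 0" "\<And>\<xi>. u \<xi> \<le> C1 * rad \<xi>" using u_le_rad by blast
  obtain C2 where C2: "C2 > 0" "\<And>\<xi>. rad \<xi> \<le> C2 * rad (reversor \<xi>)" using rad_reversor by blast
  \<comment> \<open>The condition \<open>0 \<le> rad \<xi>\<close> always holds, so this is a bound
    on the whole torus.\<close>
  obtain m where m: "0 < m" "\<And>\<xi>. 0 \<le> rad \<xi> \<Longrightarrow> m \<le> 1 - u \<xi>"
  proof (rule torus_periodic_bounded_below[of "\<lambda>\<xi>. 1 - u \<xi>" rad 0])
    show "torus_periodic (\<lambda>\<xi>. 1 - u \<xi>)" using u_periodic by (simp add: torus_periodic_def)
  qed (use u_less_1 in \<open>auto intro!: continuous_intros u_cont rad_periodic continuous_rad\<close>)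
  have "v \<xi> \<le> (C1 * C2 / m) * rad \<xi>" for \<xi>
  proof -
    have "v \<xi> \<le> u (reversor \<xi>) / m" unfolding v_eq using m rad_nonneg u_nonneg u_less_1[of "reversor \<xi>"]
      by (intro divide_left_mono) auto
    also have "\<dots> \<le> (C1 * (C2 * rad \<xi>)) / m"
    proof (rule divide_right_mono)
      have "u (reversor \<xi>) \<le> C1 * rad (reversor \<xi>)" by (rule C1)
      also have "\<dots> \<le> C1 * (C2 * rad \<xi>)" using C2(2)[of "reversor \<xi>"] C1 by (intro mult_left_mono) auto
      finally show "u (reversor \<xi>) \<le> C1 * (C2 * rad \<xi>)" .
    qed (use m in simp)
    finally show ?thesis by simp
  qed
  then show thesis using that[of "C1 * C2 / m"] C1 C2 m by simp
qed

text \<open>The reciprocal of \<open>lam \<xi>\<close> is the first component of the image of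
  \<open>(1, u \<xi>)\<close> under the derivative of \<open>T\<close>.\<close>

definition lam :: "real \<times> real \<Rightarrow> real" where
  "lam \<xi> = 1 / (1 + dp \<xi> + u \<xi>)"

lemma lam_bounds: "0 < lam \<xi>" "lam \<xi> \<le> 1"
  using p_nonneg[of "fst \<xi>"] u_nonneg[of \<xi>] by (auto simp: lam_def)

text \<open>Iterating the first inequality bounds the sum of the products of \<open>lam\<close> along a backward orbit.\<close>

lemma supersolution:
  obtains M C where "M > 0" "C \<ge> 1"
    "\<And>\<xi>. \<xi> \<notin> torus_lattice \<Longrightarrow> 1 + lam \<xi> * (200 / rad \<xi> + M) \<le> 200 / rad (T \<xi>) + M"
    "\<And>\<xi>. \<xi> \<notin> torus_lattice \<Longrightarrow> 200 / rad \<xi> + M \<le> 200 / rad (T \<xi>) + M + C"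
    "\<And>\<xi>. \<xi> \<notin> torus_lattice \<Longrightarrow> (200 / rad \<xi> + M) * (u \<xi> + v \<xi>) \<le> C"
    "1 \<le> M"
proof -
  obtain K where K: "K \<ge> 0" "\<And>\<xi>. sub \<xi> / (1 + K * rad \<xi>) \<le> u \<xi>" using u_lower by blast
  obtain \<rho> where \<rho>: "\<rho> > 0" "\<rho> \<le> 1/100000"
    "\<And>\<xi>. rad \<xi> \<le> \<rho> \<Longrightarrow> rad \<xi> * (1 - 2 * rad \<xi>) \<le> rad (T \<xi>)"
    "\<And>\<xi>. rad \<xi> \<le> \<rho> \<Longrightarrow> rad (T \<xi>) \<le> rad \<xi> * (1 + 2 * rad \<xi>)"
    "\<And>\<xi> K. rad \<xi> \<le> \<rho> \<Longrightarrow> 0 < rad \<xi> \<Longrightarrow> 0 \<le> K \<Longrightarrow> K * rad \<xi> \<le> 1/600 \<Longrightarrow> 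
      sub \<xi> / (1 + K * rad \<xi>) \<le> u \<xi> \<Longrightarrow> 1 + 1 / (1 + dp \<xi> + u \<xi>) * (200 / rad \<xi>) \<le> 200 / rad (T \<xi>)"
    using rad_step by metis
  define s where "s = min \<rho> (1 / (600 * (K + 1)))"
  have s: "0 < s" "s \<le> \<rho>" using \<rho> K by (auto simp: s_def)
  have Ks: "K * s \<le> 1/600"
  proof -
    have "(K + 1) * s \<le> (K + 1) * (1 / (600 * (K + 1)))" using K by (intro mult_left_mono) (auto simp: s_def)
    also have "\<dots> = 1/600" using K by simp
    finally show ?thesis using s by (simp add: algebra_simps)
  qed
  obtain m where m: "0 < m" "\<And>\<xi>. s \<le> rad \<xi> \<Longrightarrow> m \<le> u \<xi>"
  proof (rule torus_periodic_bounded_below[OF u_cont u_periodic continuous_rad rad_periodic])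
    show "0 < u \<xi>" if "s \<le> rad \<xi>" for \<xi> using that s(1) rad_pos_iff[of \<xi>] u_pos by simp
  qed blast
  obtain R where R: "R > 0" "\<And>\<xi>. rad \<xi> \<le> R" using rad_bounded by blast
  obtain C1 where C1: "C1 > 0" "\<And>\<xi>. u \<xi> \<le> C1 * rad \<xi>" using u_le_rad by blast
  obtain C2 where C2: "C2 > 0" "\<And>\<xi>. v \<xi> \<le> C2 * rad \<xi>" using v_le_rad by blast
  \<comment> \<open>The solution of \<open>1 + 200 / s + M / (1 + m) = M\<close>: away from the
    lattice the additive constant alone carries the inequality.\<close>
  define M where "M = (1 + 200 / s) * (1 + m) / m"
  have M1: "1 \<le> M"
  proof -
    have "1 * m \<le> (1 + 200 / s) * (1 + m)" using s m by (intro mult_mono) auto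
    then show ?thesis using m by (simp add: M_def le_divide_eq)
  qed
  \<comment> \<open>800 and \<open>200 / s\<close> serve the backward bound near and away from the
    lattice, the product serves the bound with \<open>u + v\<close>.\<close>
  define C where "C = 800 + 200 / s + (200 + M * R) * (C1 + C2)"
  have C0: "0 \<le> (200 + M * R) * (C1 + C2)" using M1 R C1 C2 by simp
  have "1 \<le> C" using C0 s by (simp add: C_def add_increasing)
  show thesis
  proof (rule that[OF _ \<open>1 \<le> C\<close> _ _ _ M1])
    show "M > 0" using M1 by simp
    fix \<xi> assume \<xi>: "\<xi> \<notin> torus_lattice"
    have r: "0 < rad \<xi>" "0 < rad (T \<xi>)" using \<xi> by (auto simp: rad_pos_iff)
    show "1 + lam \<xi> * (200 / rad \<xi> + M) \<le> 200 / rad (T \<xi>) + M"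
    proof (cases "rad \<xi> \<le> s")
      case True
      have "K * rad \<xi> \<le> 1/600" using mult_left_mono[OF True K(1)] Ks by linarith
      then have "1 + lam \<xi> * (200 / rad \<xi>) \<le> 200 / rad (T \<xi>)"
        unfolding lam_def using \<rho>(5)[of \<xi> K] True s r K by auto
      moreover have "lam \<xi> * M \<le> 1 * M" using lam_bounds[of \<xi>] M1 by (intro mult_right_mono) auto
      ultimately show ?thesis by (simp add: distrib_left)
    next
      case False
      have mu: "m \<le> u \<xi>" using m(2)[of \<xi>] False by simp
      have "lam \<xi> \<le> 1 / (1 + m)" unfolding lam_def using mu p_nonneg[of "fst \<xi>"] m by (intro divide_left_mono) auto
      then have 1: "lam \<xi> * M \<le> 1 / (1 + m) * M" using M1 by (intro mult_right_mono) auto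
      have "1 / (1 + m) * M = M - (1 + 200 / s)"
      proof -
        have "1 / (1 + m) * (Q * (1 + m) / m) = Q * (1 + m) / m - Q" for Q
        proof -
          have "m \<noteq> 0" "1 + m \<noteq> 0" using m(1) by auto
          then have "1 / (1 + m) * (Q * (1 + m) / m) = Q / m" "Q * (1 + m) / m - Q = Q / m"
            by (simp, simp add: field_simps)
          then show ?thesis by simp
        qed
        then show ?thesis unfolding M_def .
      qed
      moreover have "lam \<xi> * (200 / rad \<xi>) \<le> 1 * (200 / s)"
        using lam_bounds[of \<xi>] False s r by (intro mult_mono divide_left_mono) auto
      ultimately have "1 + lam \<xi> * (200 / rad \<xi> + M) \<le> M" using 1 by (simp add: distrib_left)
      then show ?thesis using r by (simp add: add_increasing)
    qed
    show "200 / rad \<xi> + M \<le> 200 / rad (T \<xi>) + M + C"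
    proof (cases "rad \<xi> \<le> s")
      case True
      have rr: "rad \<xi> \<le> \<rho>" using True s by simp
      have "1/2 * rad \<xi> \<le> rad \<xi> * (1 - 2 * rad \<xi>)" using rr \<rho>(2) r by (simp add: mult.commute[of "1/2"])
      then have lo: "rad \<xi> / 2 \<le> rad (T \<xi>)" using \<rho>(3)[OF rr] by linarith
      \<comment> \<open>The relative change of \<open>rad\<close> in one step is of order
        \<open>rad\<close>, so \<open>1 / rad\<close> changes by a bounded amount.\<close>
      have "rad (T \<xi>) / (rad \<xi> * rad (T \<xi>)) \<le> (rad \<xi> * (1 + 2 * rad \<xi>)) / (rad \<xi> * rad (T \<xi>))"
        using \<rho>(4)[OF rr] r by (intro divide_right_mono) auto
      then have "1 / rad \<xi> \<le> 1 / rad (T \<xi>) + 2 * rad \<xi> / rad (T \<xi>)" using r by (simp add: add_divide_distrib)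
      moreover have "2 * rad \<xi> / rad (T \<xi>) \<le> 4" using lo r by (simp add: divide_le_eq)
      ultimately have "1 / rad \<xi> \<le> 1 / rad (T \<xi>) + 4" by linarith
      then have "200 / rad \<xi> \<le> 200 / rad (T \<xi>) + 800" by simp
      moreover have "0 \<le> 200 / s" using s by simp
      ultimately show ?thesis using C0 unfolding C_def by linarith
    next
      case False
      then have "200 / rad \<xi> \<le> 200 / s" using s by (intro divide_left_mono) auto
      moreover have "0 \<le> 200 / rad (T \<xi>)" using r by simp
      ultimately show ?thesis using C0 unfolding C_def by linarith
    qed
    have "200 / rad \<xi> + M = (200 + M * rad \<xi>) / rad \<xi>" using r by (simp add: field_simps)
    also have "\<dots> \<le> (200 + M * R) / rad \<xi>" using R M1 r by (intro divide_right_mono add_mono mult_left_mono) auto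
    finally have "(200 / rad \<xi> + M) * (u \<xi> + v \<xi>) \<le> (200 + M * R) / rad \<xi> * ((C1 + C2) * rad \<xi>)"
      using C1(2)[of \<xi>] C2(2)[of \<xi>] M1 R r u_nonneg[of \<xi>] v_nonneg[of \<xi>]
      by (intro mult_mono) (auto simp: algebra_simps)
    also have "\<dots> = (200 + M * R) * (C1 + C2)" using r by simp
    also have "\<dots> \<le> C" using s by (simp add: C_def)
    finally show "(200 / rad \<xi> + M) * (u \<xi> + v \<xi>) \<le> C" .
  qed
qed

end

section \<open>Convergence of the gradients\<close>

text \<open>The product of \<open>1 - 1 / (w + i * C)\<close> over \<open>i < n\<close>. It is the
  worst case along a backward orbit: each step multiplies the weight \<open>W\<close> times the
  accumulated rates by at most \<open>1 - 1 / W\<close>, while \<open>W\<close> grows by at most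
  \<open>C\<close>.\<close>

fun decay :: "real \<Rightarrow> nat \<Rightarrow> real \<Rightarrow> real" where
  "decay C 0 w = 1"
| "decay C (Suc n) w = (1 - 1 / w) * decay C n (w + C)"

lemma decay_nonneg: "1 \<le> w \<Longrightarrow> 0 \<le> C \<Longrightarrow> 0 \<le> decay C n w"
  by (induction n arbitrary: w) auto

lemma decay_mono: "1 \<le> w \<Longrightarrow> w \<le> w' \<Longrightarrow> 0 \<le> C \<Longrightarrow> decay C n w \<le> decay C n w'"
proof (induction n arbitrary: w w')
  case (Suc n)
  have "(1 - 1 / w) * decay C n (w + C) \<le> (1 - 1 / w') * decay C n (w' + C)"
    using Suc.prems by (intro mult_mono Suc.IH diff_left_mono divide_left_mono decay_nonneg) auto
  then show ?case by simp
qed simp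

text \<open>Combines \<open>1 - 1 / w \<le> exp (- (1 / w))\<close> with
  \<open>ln (1 + C / w) / C \<le> 1 / w\<close>; the factors \<open>(w + C) / w\<close> telescope.
  The divergence of the harmonic series appears as an unbounded logarithm.\<close>

lemma decay_le:
  assumes "1 \<le> w" "0 < C"
  shows "decay C n w \<le> exp (- (ln (1 + real n * C / w) / C))"
  using assms
proof (induction n arbitrary: w)
  case (Suc n)
  have "decay C (Suc n) w \<le> exp (- (1 / w)) * exp (- (ln (1 + real n * C / (w + C)) / C))"
    using Suc.prems exp_ge_add_one_self[of "- (1 / w)"]
    by (simp only: decay.simps, intro mult_mono Suc.IH decay_nonneg) auto
  also have "\<dots> = exp (- (1 / w) - ln (1 + real n * C / (w + C)) / C)"
    by (simp add: exp_diff exp_minus field_simps)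
  also have "\<dots> \<le> exp (- (ln (1 + real (Suc n) * C / w) / C))"
  proof (subst exp_le_cancel_iff)
    have w: "w > 0" using Suc.prems by simp
    have split: "1 + real (Suc n) * C / w = (1 + C / w) * (1 + real n * C / (w + C))"
    proof -
      have "w + C \<noteq> 0" "w \<noteq> 0" using w Suc.prems by auto
      moreover from this have "1 + C / w = (w + C) / w" by (simp add: field_simps)
      ultimately show ?thesis by (simp add: divide_simps) (simp add: algebra_simps)
    qed
    have "1 + C / w > 0" "1 + real n * C / (w + C) > 0"
      using w Suc.prems by (auto intro!: add_pos_nonneg)
    then have "ln (1 + real (Suc n) * C / w) = ln (1 + C / w) + ln (1 + real n * C / (w + C))"
      unfolding split by (rule ln_mult_pos)
    moreover have "ln (1 + C / w) \<le> C / w" using w Suc.prems by (intro ln_add_one_self_le_self) auto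
    then have "ln (1 + C / w) / C \<le> 1 / w" using Suc.prems w by (simp add: divide_le_eq field_simps)
    ultimately show "- (1 / w) - ln (1 + real n * C / (w + C)) / C \<le> - (ln (1 + real (Suc n) * C / w) / C)"
      by (simp add: add_divide_distrib)
  qed
  finally show ?case .
qed simp

lemma decay_tendsto_0:
  assumes "1 \<le> w" "0 < C"
  shows "(\<lambda>n. decay C n w) \<longlonglongrightarrow> 0"
proof -
  have "filterlim (\<lambda>n. (C / w) * real n) at_top sequentially"
    by (rule filterlim_tendsto_pos_mult_at_top[OF tendsto_const _ filterlim_real_sequentially])
      (use assms in simp)
  then have 1: "filterlim (\<lambda>n. real n * (C / w)) at_top sequentially"
    by (simp only: mult.commute)
  have "filterlim (\<lambda>n. 1 + real n * (C / w)) at_top sequentially"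
    by (rule filterlim_tendsto_add_at_top[OF tendsto_const 1])
  then have "filterlim (\<lambda>n. ln (1 + real n * (C / w))) at_top sequentially"
    by (rule filterlim_compose[OF ln_at_top])
  then have "filterlim (\<lambda>n. inverse C * ln (1 + real n * (C / w))) at_top sequentially"
    using assms by (intro filterlim_tendsto_pos_mult_at_top[OF tendsto_const]) auto
  then have "filterlim (\<lambda>n. - (inverse C * ln (1 + real n * (C / w)))) at_bot sequentially"
    by (simp add: filterlim_uminus_at_top)
  from filterlim_compose[OF exp_at_bot this]
  have lim: "(\<lambda>n. exp (- (ln (1 + real n * C / w) / C))) \<longlonglongrightarrow> 0"
    by (simp add: divide_inverse mult.commute mult.left_commute)
  show ?thesis
    by (rule tendsto_sandwich[OF always_eventually always_eventually tendsto_const lim])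
      (use assms decay_nonneg decay_le in auto)
qed

text \<open>\<open>W\<close> stands for \<open>200 / rad + M\<close>, and the assumptions collect
  the estimates proved so far under one constant \<open>C\<close>. The geometry near the fixed point
  enters the convergence argument only through them.\<close>

locale controlled_slope_fields = slope_fields h u v for h :: "real \<Rightarrow> real" and u v +
  fixes W :: "real \<times> real \<Rightarrow> real" and C :: real
  assumes C_ge_1: "1 \<le> C"
    and W_ge_1: "\<And>\<xi>. \<xi> \<notin> torus_lattice \<Longrightarrow> 1 \<le> W \<xi>"
    and W_step: "\<And>\<xi>. \<xi> \<notin> torus_lattice \<Longrightarrow> 1 + lam \<xi> * W \<xi> \<le> W (T \<xi>)"
    and W_bwd: "\<And>\<xi>. \<xi> \<notin> torus_lattice \<Longrightarrow> W \<xi> \<le> W (T \<xi>) + C"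
    and W_theta: "\<And>\<xi>. \<xi> \<notin> torus_lattice \<Longrightarrow> W \<xi> * (u \<xi> + v \<xi>) \<le> C"
    and W_u: "\<And>\<xi>. \<xi> \<notin> torus_lattice \<Longrightarrow> 1 \<le> C * W \<xi> * u \<xi>"
    and W_cont: "continuous_on (- torus_lattice) W"
    and q_le_u: "\<And>\<xi>. \<bar>q (fst \<xi>)\<bar> \<le> C * u \<xi>"
begin

section \<open>The iterates and the products of contraction rates\<close>

definition theta :: "real \<times> real \<Rightarrow> real" where "theta \<xi> = u \<xi> + v \<xi>"

lemma theta_pos: "\<xi> \<notin> torus_lattice \<Longrightarrow> 0 < theta \<xi>"
  using u_pos[of \<xi>] v_nonneg[of \<xi>] by (simp add: theta_def add_pos_nonneg)

text \<open>The iterates start above \<open>u\<close>, so that their contraction rates \<open>lamU\<close> are at most \<open>lam\<close>.\<close>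

primrec U :: "nat \<Rightarrow> real \<times> real \<Rightarrow> real" where
  "U 0 \<xi> = 1"
| "U (Suc n) \<xi> = slope_map (dp (Ti \<xi>) + U n (Ti \<xi>))"

definition lamU :: "nat \<Rightarrow> real \<times> real \<Rightarrow> real" where
  "lamU n \<xi> = 1 / (1 + dp \<xi> + U n \<xi>)"

primrec Lam :: "nat \<Rightarrow> real \<times> real \<Rightarrow> real" where
  "Lam 0 \<xi> = 1"
| "Lam (Suc n) \<xi> = lam (Ti \<xi>) * Lam n (Ti \<xi>)"

text \<open>\<open>Lam n \<xi>\<close> times \<open>W\<close> at the \<open>n\<close>-th backward
  point. Iterating \<open>W_step\<close> from that point shows that it bounds the sum of all
  \<open>Lam k \<xi>\<close> with \<open>k \<ge> n\<close>, the part of the recursion not yet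
  unrolled after \<open>n\<close> steps.\<close>

primrec Z :: "nat \<Rightarrow> real \<times> real \<Rightarrow> real" where
  "Z 0 \<xi> = W \<xi>"
| "Z (Suc n) \<xi> = lam (Ti \<xi>) * Z n (Ti \<xi>)"

lemma U_ge_u: "u \<xi> \<le> U n \<xi>"
proof (induction n arbitrary: \<xi>)
  case 0
  then show ?case using u_less_1[of \<xi>] by simp
next
  case (Suc n)
  have "u \<xi> = slope_map (dp (Ti \<xi>) + u (Ti \<xi>))" using u_step[of "Ti \<xi>"] by simp
  moreover have "0 \<le> dp (Ti \<xi>) + u (Ti \<xi>)" using p_nonneg u_nonneg by (intro add_nonneg_nonneg)
  ultimately show ?case using Suc[of "Ti \<xi>"] by (auto intro!: slope_map_mono)
qed

lemma U_nonneg: "0 \<le> U n \<xi>"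
  using U_ge_u[of \<xi> n] u_nonneg[of \<xi>] by linarith

lemma lamU_bounds: "0 < lamU n \<xi>" "lamU n \<xi> \<le> lam \<xi>"
  using p_nonneg[of "fst \<xi>"] U_nonneg[of n \<xi>] U_ge_u[of \<xi> n] u_nonneg[of \<xi>]
  by (auto simp: lamU_def lam_def intro!: divide_left_mono mult_pos_pos)

lemma Lam_bounds: "0 < Lam n \<xi>" "Lam n \<xi> \<le> 1"
proof (induction n arbitrary: \<xi>)
  case (Suc n)
  { case 1 then show ?case using lam_bounds Suc by simp }
  { case 2 then show ?case using lam_bounds[of "Ti \<xi>"] Suc[of "Ti \<xi>"]
      mult_mono[of "lam (Ti \<xi>)" 1 "Lam n (Ti \<xi>)" 1] by simp }
qed auto

lemma Lam_Suc_le: "Lam (Suc n) \<xi> \<le> Lam n \<xi>"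
proof (induction n arbitrary: \<xi>)
  case 0
  then show ?case using lam_bounds by simp
next
  case (Suc n)
  then show ?case using lam_bounds[of "Ti \<xi>"] by (auto intro: mult_left_mono)
qed

lemma Lam_sum: "\<xi> \<notin> torus_lattice \<Longrightarrow> (\<Sum>k<n. Lam k \<xi>) \<le> W \<xi>"
proof (induction n arbitrary: \<xi>)
  case 0
  then show ?case using W_ge_1[of \<xi>] by simp
next
  case (Suc n)
  have "(\<Sum>k<Suc n. Lam k \<xi>) = 1 + lam (Ti \<xi>) * (\<Sum>k<n. Lam k (Ti \<xi>))"
    unfolding sum.lessThan_Suc_shift by (simp add: sum_distrib_left)
  also have "\<dots> \<le> 1 + lam (Ti \<xi>) * W (Ti \<xi>)"
    using Suc.IH[of "Ti \<xi>"] Suc.prems lam_bounds[of "Ti \<xi>"] by (auto intro!: mult_left_mono)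
  also have "\<dots> \<le> W \<xi>" using W_step[of "Ti \<xi>"] Suc.prems by simp
  finally show ?case .
qed

text \<open>The terms decrease and their partial sums stay below \<open>W\<close>. This supplies the
  rate \<open>W / n\<close> at which the iterates converge to \<open>u\<close>.\<close>

lemma Lam_le: assumes "\<xi> \<notin> torus_lattice" shows "real n * Lam n \<xi> \<le> W \<xi>"
proof -
  have "Lam n \<xi> \<le> Lam k \<xi>" if "k < n" for k
    using lift_Suc_antimono_le[of "\<lambda>n. Lam n \<xi>" k n] Lam_Suc_le that by auto
  then have "(\<Sum>k<n. Lam n \<xi>) \<le> (\<Sum>k<n. Lam k \<xi>)" by (intro sum_mono) auto
  then show ?thesis using Lam_sum[OF assms, of n] by simp
qed

text \<open>The difference quotient of \<open>slope_map\<close> between the two slopes is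
  \<open>lamU * lam\<close>, at most \<open>lam\<close>; the initial difference is at most
  1.\<close>

lemma U_minus_u_le_Lam: "U n \<xi> - u \<xi> \<le> Lam n \<xi>"
proof (induction n arbitrary: \<xi>)
  case 0
  then show ?case using u_nonneg[of \<xi>] by simp
next
  case (Suc n)
  define \<eta> where "\<eta> = Ti \<xi>"
  have "U (Suc n) \<xi> - u \<xi> = (U n \<eta> - u \<eta>) / ((1 + (dp \<eta> + U n \<eta>)) * (1 + (dp \<eta> + u \<eta>)))"
    using slope_map_diff[of "dp \<eta> + U n \<eta>" "dp \<eta> + u \<eta>"] u_step[of \<eta>] p_nonneg[of "fst \<eta>"]
      U_nonneg[of n \<eta>] u_nonneg[of \<eta>] by (simp add: \<eta>_def)
  also have "\<dots> = lamU n \<eta> * (lam \<eta> * (U n \<eta> - u \<eta>))" by (simp add: lamU_def lam_def add.assoc)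
  also have "\<dots> \<le> 1 * (lam \<eta> * (U n \<eta> - u \<eta>))"
    using lamU_bounds[of n \<eta>] lam_bounds[of \<eta>] U_ge_u[of \<eta> n] by (intro mult_right_mono mult_nonneg_nonneg) auto
  also have "\<dots> \<le> 1 * (lam \<eta> * Lam n \<eta>)"
    using Suc[of \<eta>] lam_bounds[of \<eta>] by (auto intro!: mult_left_mono)
  finally show ?case by (simp add: \<eta>_def)
qed

lemma U_diff_le:
  assumes "\<xi> \<notin> torus_lattice" "0 < N" "N \<le> n"
  shows "\<bar>U n \<xi> - u \<xi>\<bar> \<le> W \<xi> / real N"
proof -
  have "real N * Lam n \<xi> \<le> real n * Lam n \<xi>" using assms Lam_bounds[of n \<xi>] by (intro mult_right_mono) auto
  also have "\<dots> \<le> W \<xi>" by (rule Lam_le[OF assms(1)])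
  finally have "Lam n \<xi> \<le> W \<xi> / real N" using assms by (simp add: field_simps)
  then show ?thesis using U_minus_u_le_Lam[of n \<xi>] U_ge_u[of \<xi> n] by simp
qed

lemma U_tendsto: "\<xi> \<notin> torus_lattice \<Longrightarrow> (\<lambda>n. U n \<xi>) \<longlonglongrightarrow> u \<xi>"
proof (rule LIMSEQ_I)
  fix e :: real assume \<xi>: "\<xi> \<notin> torus_lattice" and e: "e > 0"
  obtain N :: nat where N: "W \<xi> / e < real N" using reals_Archimedean2 by blast
  have "0 < W \<xi> / e" using W_ge_1[OF \<xi>] e by simp
  then have "0 < N" using N by (cases N) auto
  then have "norm (U n \<xi> - u \<xi>) < e" if "N \<le> n" for n
  proof -
    have "W \<xi> / real N < e" using N \<open>0 < N\<close> e by (simp add: field_simps)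
    then show ?thesis using U_diff_le[OF \<xi> \<open>0 < N\<close> that] by simp
  qed
  then show "\<exists>N. \<forall>n\<ge>N. norm (U n \<xi> - u \<xi>) < e" by blast
qed

text \<open>The factor \<open>lam \<xi>\<close> is kept on the right because one of the two gradient
  recursions has the multiplier \<open>lamU\<^sup>2 / lam\<close>.\<close>

lemma lamU_diff:
  assumes "\<xi> \<notin> torus_lattice" "0 < N" "N \<le> i" "N \<le> j"
  shows "\<bar>(lamU i \<xi>)\<^sup>2 - (lamU j \<xi>)\<^sup>2\<bar> \<le> lam \<xi> * (4 * W \<xi> / real N)"
proof -
  have d: "1 + dp \<xi> + U n \<xi> > 0" for n using p_nonneg[of "fst \<xi>"] U_nonneg[of n \<xi>] by linarith
  have "lamU i \<xi> - lamU j \<xi> = lamU i \<xi> * lamU j \<xi> * (U j \<xi> - U i \<xi>)"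
    using d[of i] d[of j] unfolding lamU_def by (simp add: field_simps)
  then have "\<bar>lamU i \<xi> - lamU j \<xi>\<bar> = (lamU i \<xi> * lamU j \<xi>) * \<bar>U j \<xi> - U i \<xi>\<bar>"
    using lamU_bounds(1)[of i \<xi>] lamU_bounds(1)[of j \<xi>] by (simp add: abs_mult)
  also have "\<dots> \<le> 1 * (2 * (W \<xi> / real N))"
  proof (rule mult_mono)
    show "lamU i \<xi> * lamU j \<xi> \<le> 1"
      using lamU_bounds[of i \<xi>] lamU_bounds[of j \<xi>] lam_bounds[of \<xi>] by (intro mult_le_one) auto
    show "\<bar>U j \<xi> - U i \<xi>\<bar> \<le> 2 * (W \<xi> / real N)"
      using U_diff_le[OF assms(1,2,3)] U_diff_le[OF assms(1,2,4)] by linarith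
  qed auto
  finally have 1: "\<bar>lamU i \<xi> - lamU j \<xi>\<bar> \<le> 2 * (W \<xi> / real N)" by simp
  have "\<bar>(lamU i \<xi>)\<^sup>2 - (lamU j \<xi>)\<^sup>2\<bar> = (lamU i \<xi> + lamU j \<xi>) * \<bar>lamU i \<xi> - lamU j \<xi>\<bar>"
  proof -
    have "(lamU i \<xi>)\<^sup>2 - (lamU j \<xi>)\<^sup>2 = (lamU i \<xi> + lamU j \<xi>) * (lamU i \<xi> - lamU j \<xi>)"
      by (simp add: power2_eq_square algebra_simps)
    then show ?thesis using lamU_bounds(1)[of i \<xi>] lamU_bounds(1)[of j \<xi>] by (simp add: abs_mult)
  qed
  also have "\<dots> \<le> (lam \<xi> + lam \<xi>) * (2 * (W \<xi> / real N))"
    using 1 lamU_bounds[of i \<xi>] lamU_bounds[of j \<xi>] lam_bounds[of \<xi>] by (intro mult_mono add_mono) auto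
  finally show ?thesis by (simp add: algebra_simps)
qed

lemma Z_le: "\<xi> \<notin> torus_lattice \<Longrightarrow> Z n \<xi> \<le> W \<xi> * decay C n (W \<xi>)"
proof (induction n arbitrary: \<xi>)
  case (Suc n)
  define \<eta> where "\<eta> = Ti \<xi>"
  have \<eta>: "\<eta> \<notin> torus_lattice" "T \<eta> = \<xi>" using Suc.prems by (auto simp: \<eta>_def)
  have W: "1 \<le> W \<eta>" "1 \<le> W \<xi>" using W_ge_1 \<eta> Suc.prems by auto
  have C: "0 \<le> C" using C_ge_1 by simp
  have "Z (Suc n) \<xi> \<le> lam \<eta> * (W \<eta> * decay C n (W \<eta>))"
    using Suc.IH[OF \<eta>(1)] lam_bounds[of \<eta>] by (simp add: \<eta>_def mult_left_mono)
  also have "\<dots> = (lam \<eta> * W \<eta>) * decay C n (W \<eta>)" by simp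
  also have "\<dots> \<le> (W \<xi> - 1) * decay C n (W \<xi> + C)"
    using W_step[OF \<eta>(1)] W_bwd[OF \<eta>(1)] W C lam_bounds[of \<eta>] unfolding \<eta>(2)
    by (intro mult_mono decay_mono decay_nonneg) auto
  also have "\<dots> = W \<xi> * decay C (Suc n) (W \<xi>)" using W by (simp add: field_simps)
  finally show ?case .
qed simp

text \<open>After \<open>k\<close> backward steps the difference of two members of the sequence is bounded by a multiple of
  \<open>Z k\<close>, up to the error made in replacing \<open>m i\<close> by \<open>m j\<close> in finitely many steps.\<close>

lemma cocycle_uniformly_Cauchy:
  fixes g m :: "nat \<Rightarrow> real \<times> real \<Rightarrow> real" and s :: "real \<times> real \<Rightarrow> real"
  assumes g: "\<And>n \<xi>. \<xi> \<notin> torus_lattice \<Longrightarrow> g (Suc n) (T \<xi>) = m n \<xi> * (s \<xi> + g n \<xi>)"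
    and s: "\<And>\<xi>. \<xi> \<notin> torus_lattice \<Longrightarrow> \<bar>s \<xi>\<bar> \<le> C"
    and m: "\<And>n \<xi>. 0 \<le> m n \<xi>" "\<And>n \<xi>. m n \<xi> \<le> lam \<xi>"
    and m_diff: "\<And>i j N \<xi>. \<xi> \<notin> torus_lattice \<Longrightarrow> 0 < N \<Longrightarrow> N \<le> i \<Longrightarrow> N \<le> j \<Longrightarrow>
      \<bar>m i \<xi> - m j \<xi>\<bar> \<le> 4 * W \<xi> / real N"
    and g_bound: "\<And>n \<xi>. \<xi> \<notin> torus_lattice \<Longrightarrow> \<bar>g n \<xi>\<bar> \<le> C * W \<xi>"
    and e: "0 < e"
  shows "\<exists>N. \<forall>i\<ge>N. \<forall>j\<ge>N. \<forall>\<xi>. \<xi> \<notin> torus_lattice \<longrightarrow> W \<xi> \<le> B \<longrightarrow> \<bar>g i \<xi> - g j \<xi>\<bar> \<le> e"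
proof (cases "1 \<le> B")
  case False
  then have "\<not> W \<xi> \<le> B" if "\<xi> \<notin> torus_lattice" for \<xi> using W_ge_1[OF that] by linarith
  then show ?thesis by blast
next
  case True
  have step: "\<exists>N. \<forall>i\<ge>N. \<forall>j\<ge>N. \<forall>\<xi>. \<xi> \<notin> torus_lattice \<longrightarrow> W \<xi> \<le> B \<longrightarrow> \<bar>g i \<xi> - g j \<xi>\<bar> \<le> 2 * C * Z k \<xi> + e"
    if "0 < e" "1 \<le> B" for k B e
    using that
  proof (induction k arbitrary: B e)
    case 0
    have "\<bar>g i \<xi> - g j \<xi>\<bar> \<le> 2 * C * Z 0 \<xi> + e" if "\<xi> \<notin> torus_lattice" for i j \<xi>
      using g_bound[OF that, of i] g_bound[OF that, of j] \<open>0 < e\<close> by simp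
    then show ?case by blast
  next
    case (Suc k)
    \<comment> \<open>One backward step turns \<open>W \<xi> \<le> B\<close> into
      \<open>W (Ti \<xi>) \<le> B + C\<close>, which is why the induction runs over all
      \<open>B\<close>.\<close>
    define B' where "B' = B + C"
    have B': "1 \<le> B'" using Suc.prems C_ge_1 by (simp add: B'_def)
    obtain N1 where N1: "\<And>i j \<xi>. N1 \<le> i \<Longrightarrow> N1 \<le> j \<Longrightarrow> \<xi> \<notin> torus_lattice \<Longrightarrow> W \<xi> \<le> B' \<Longrightarrow>
        \<bar>g i \<xi> - g j \<xi>\<bar> \<le> 2 * C * Z k \<xi> + e / 2"
      using Suc.IH[OF half_gt_zero[OF Suc.prems(1)] B'] by blast
    define D where "D = 4 * B' * (C + C * B')"
    obtain N2 :: nat where N2: "D / (e / 2) < real N2" using reals_Archimedean2 by blast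
    have D: "D \<ge> 0" using B' C_ge_1 by (simp add: D_def)
    define N where "N = max N1 (Suc N2)"
    have N: "N1 \<le> N" "0 < N" "D / real N \<le> e / 2"
    proof -
      have "D \<le> e / 2 * real N2" using N2 Suc.prems by (simp add: field_simps)
      also have "\<dots> \<le> e / 2 * real N" using Suc.prems by (intro mult_left_mono) (auto simp: N_def)
      finally show "D / real N \<le> e / 2" by (simp add: N_def divide_le_eq)
    qed (auto simp: N_def)
    have "\<bar>g i \<xi> - g j \<xi>\<bar> \<le> 2 * C * Z (Suc k) \<xi> + e"
      if ij: "Suc N \<le> i" "Suc N \<le> j" and \<xi>: "\<xi> \<notin> torus_lattice" "W \<xi> \<le> B" for i j \<xi>
    proof -
      define \<eta> where "\<eta> = Ti \<xi>"
      have \<eta>: "\<eta> \<notin> torus_lattice" "T \<eta> = \<xi>" using \<xi> by (auto simp: \<eta>_def)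
      obtain i' j' where ij': "i = Suc i'" "j = Suc j'" "N \<le> i'" "N \<le> j'"
        using ij by (cases i; cases j) auto
      have W\<eta>: "W \<eta> \<le> B'" using W_bwd[OF \<eta>(1)] \<xi> by (simp add: \<eta>(2) B'_def)
      \<comment> \<open>The first term is carried one step further back; the second is small because
        the multipliers differ by at most \<open>4 * W \<eta> / N\<close>.\<close>
      have "g i \<xi> - g j \<xi> = m i' \<eta> * (g i' \<eta> - g j' \<eta>) + (m i' \<eta> - m j' \<eta>) * (s \<eta> + g j' \<eta>)"
        using g[OF \<eta>(1), of i'] g[OF \<eta>(1), of j'] by (simp add: \<eta>(2) ij' algebra_simps)
      then have "\<bar>g i \<xi> - g j \<xi>\<bar> \<le> m i' \<eta> * \<bar>g i' \<eta> - g j' \<eta>\<bar> + \<bar>m i' \<eta> - m j' \<eta>\<bar> * \<bar>s \<eta> + g j' \<eta>\<bar>"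
        using m(1)[of i' \<eta>] abs_triangle_ineq[of "m i' \<eta> * (g i' \<eta> - g j' \<eta>)"
          "(m i' \<eta> - m j' \<eta>) * (s \<eta> + g j' \<eta>)"] by (simp add: abs_mult)
      also have "\<dots> \<le> lam \<eta> * (2 * C * Z k \<eta> + e / 2) + (4 * B' / real N) * (C + C * B')"
      proof (intro add_mono mult_mono)
        show "\<bar>g i' \<eta> - g j' \<eta>\<bar> \<le> 2 * C * Z k \<eta> + e / 2" using N1 N(1) ij' \<eta> W\<eta> by auto
        have "\<bar>m i' \<eta> - m j' \<eta>\<bar> \<le> 4 * W \<eta> / real N" using m_diff[OF \<eta>(1) N(2)] ij' by auto
        also have "\<dots> \<le> 4 * B' / real N" using W\<eta> by (intro divide_right_mono) auto
        finally show "\<bar>m i' \<eta> - m j' \<eta>\<bar> \<le> 4 * B' / real N" .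
        have "C * W \<eta> \<le> C * B'" using W\<eta> C_ge_1 by (intro mult_left_mono) auto
        then show "\<bar>s \<eta> + g j' \<eta>\<bar> \<le> C + C * B'" using s[OF \<eta>(1)] g_bound[OF \<eta>(1), of j'] by linarith
      qed (use m lam_bounds[of \<eta>] B' in auto)
      also have "(4 * B' / real N) * (C + C * B') = D / real N" by (simp add: D_def)
      also have "lam \<eta> * (2 * C * Z k \<eta> + e / 2) \<le> 2 * C * Z (Suc k) \<xi> + e / 2"
        using lam_bounds[of \<eta>] Suc.prems mult_right_mono[of "lam \<eta>" 1 "e / 2"] by (simp add: \<eta>_def algebra_simps)
      finally show ?thesis using N(3) by linarith
    qed
    then show ?case by blast
  qed
  have "(\<lambda>n. 2 * C * (B * decay C n B)) \<longlonglongrightarrow> 2 * C * (B * 0)"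
    using True C_ge_1 by (intro tendsto_mult tendsto_const decay_tendsto_0) auto
  then have "(\<lambda>n. 2 * C * (B * decay C n B)) \<longlonglongrightarrow> 0" by simp
  \<comment> \<open>The number \<open>k\<close> of backward steps is fixed first, by the tail alone;
    only then is \<open>N\<close> chosen, depending on \<open>k\<close>.\<close>
  from order_tendstoD(2)[OF this half_gt_zero[OF e]] obtain k where k: "2 * C * (B * decay C k B) < e / 2"
    unfolding eventually_sequentially by blast
  obtain N where N: "\<And>i j \<xi>. N \<le> i \<Longrightarrow> N \<le> j \<Longrightarrow> \<xi> \<notin> torus_lattice \<Longrightarrow> W \<xi> \<le> B \<Longrightarrow>
        \<bar>g i \<xi> - g j \<xi>\<bar> \<le> 2 * C * Z k \<xi> + e / 2"
    using step[OF half_gt_zero[OF e] True, of k] by blast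
  have "\<bar>g i \<xi> - g j \<xi>\<bar> \<le> e" if "N \<le> i" "N \<le> j" "\<xi> \<notin> torus_lattice" "W \<xi> \<le> B" for i j \<xi>
  proof -
    have "Z k \<xi> \<le> W \<xi> * decay C k (W \<xi>)" using that by (intro Z_le)
    also have "\<dots> \<le> B * decay C k B" using that W_ge_1[OF that(3)] C_ge_1 True
      by (intro mult_mono decay_mono decay_nonneg) auto
    finally have "2 * C * Z k \<xi> \<le> 2 * C * (B * decay C k B)" using C_ge_1 by (intro mult_left_mono) auto
    then show ?thesis using N[OF that] k by linarith
  qed
  then show ?thesis by blast
qed

text \<open>The chain rule for \<open>U\<close>: the derivative of \<open>slope_map\<close> at
  \<open>dp + U n\<close> is \<open>lamU\<^sup>2\<close>, and the transposed derivative of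
  \<open>Ti\<close> acts on \<open>(q, 0) + G n\<close>.\<close>

primrec G :: "nat \<Rightarrow> real \<times> real \<Rightarrow> real \<times> real" where
  "G 0 \<xi> = 0"
| "G (Suc n) \<xi> =
    ((lamU n (Ti \<xi>))\<^sup>2 * (q (fst (Ti \<xi>)) + fst (G n (Ti \<xi>)) - dp (Ti \<xi>) * snd (G n (Ti \<xi>))),
     (lamU n (Ti \<xi>))\<^sup>2 * ((1 + dp (Ti \<xi>)) * snd (G n (Ti \<xi>)) - q (fst (Ti \<xi>)) - fst (G n (Ti \<xi>))))"

text \<open>The derivatives of \<open>U n\<close> along the unstable and the stable vector. The latter is divided by \<open>theta\<close>
  because the expansion of stable vectors under the inverse map is the quotient of the values of
  \<open>theta\<close> divided by \<open>lam\<close> (the map preserves area); then both satisfy a recursion with factor at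
  most \<open>lam\<close>.\<close>

definition al :: "nat \<Rightarrow> real \<times> real \<Rightarrow> real" where
  "al n \<xi> = fst (G n \<xi>) + u \<xi> * snd (G n \<xi>)"

definition ga :: "nat \<Rightarrow> real \<times> real \<Rightarrow> real" where
  "ga n \<xi> = (fst (G n \<xi>) - v \<xi> * snd (G n \<xi>)) / theta \<xi>"

lemma has_derivative_U: "(U n has_derivative (\<lambda>w. G n \<xi> \<bullet> w)) (at \<xi>)"
proof (induction n arbitrary: \<xi>)
  case 0
  then show ?case by simp
next
  case (Suc n)
  define \<eta> where "\<eta> = Ti \<xi>"
  define a where "a = dp \<eta> + U n \<eta>"
  have a: "1 + a \<noteq> 0" using p_nonneg[of "fst \<eta>"] U_nonneg[of n \<eta>] by (simp add: a_def)
  have "(slope_map has_real_derivative 1 / (1 + a)^2) (at a)"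
    unfolding slope_map_def using a by (auto intro!: derivative_eq_intros simp: power2_eq_square divide_simps)
  then have "(slope_map has_derivative (\<lambda>w. w * (1 / (1 + a)^2))) (at a)"
    by (simp only: has_field_derivative_def mult_commute_abs)
  moreover have "1 / (1 + a)^2 = (lamU n \<eta>)^2" by (simp add: lamU_def a_def power_divide add.assoc)
  ultimately have F: "(slope_map has_derivative (\<lambda>w. w * (lamU n \<eta>)^2)) (at a)" by simp
  have "((\<lambda>\<zeta>. p (fst \<zeta>)) has_derivative (\<lambda>w. fst w * q (fst \<eta>))) (at \<eta>)"
    by (rule has_derivative_compose[OF _ has_derivative_p]) (auto intro!: derivative_eq_intros)
  then have "((\<lambda>\<zeta>. p (fst \<zeta>) + U n \<zeta>) has_derivative (\<lambda>w. fst w * q (fst \<eta>) + G n \<eta> \<bullet> w)) (at \<eta>)"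
    by (intro has_derivative_add Suc)
  from has_derivative_compose[OF has_derivative_compose[OF has_derivative_Ti[of \<xi>] this[unfolded \<eta>_def]],
      of slope_map "\<lambda>w. w * (lamU n \<eta>)^2"] F
  have "((\<lambda>\<xi>. slope_map (p (fst (Ti \<xi>)) + U n (Ti \<xi>))) has_derivative
      (\<lambda>w. (fst (fst w - snd w, snd w - dp (Ti \<xi>) * (fst w - snd w)) * q (fst (Ti \<xi>)) +
        G n (Ti \<xi>) \<bullet> (fst w - snd w, snd w - dp (Ti \<xi>) * (fst w - snd w))) * (lamU n (Ti \<xi>))^2)) (at \<xi>)"
    by (simp add: a_def \<eta>_def)
  moreover have "(\<lambda>\<xi>. slope_map (p (fst (Ti \<xi>)) + U n (Ti \<xi>))) = U (Suc n)" by auto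
  moreover have "(\<lambda>w. (fst (fst w - snd w, snd w - dp (Ti \<xi>) * (fst w - snd w)) * q (fst (Ti \<xi>)) +
        G n (Ti \<xi>) \<bullet> (fst w - snd w, snd w - dp (Ti \<xi>) * (fst w - snd w))) * (lamU n (Ti \<xi>))^2)
      = (\<lambda>w. G (Suc n) \<xi> \<bullet> w)"
    by (rule ext) (simp add: inner_prod_def algebra_simps)
  ultimately show ?case by simp
qed

lemma continuous_U: "continuous_on S (U n)"
  using has_derivative_U[of n] by (meson continuous_at_imp_continuous_on has_derivative_continuous)

lemma continuous_lamU: "continuous_on UNIV (lamU n)"
proof -
  have "1 + p (fst \<xi>) + U n \<xi> \<noteq> 0" for \<xi> using p_nonneg[of "fst \<xi>"] U_nonneg[of n \<xi>] by linarith
  then show ?thesis unfolding lamU_def by (intro continuous_intros continuous_U) auto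
qed

lemma continuous_G: "continuous_on UNIV (G n)"
proof (induction n)
  case (Suc n)
  have Ti: "continuous_on UNIV Ti" using continuous_Ti[OF continuous_on_id] by simp
  have "continuous_on UNIV (\<lambda>\<xi>. G n (Ti \<xi>))"
    by (rule continuous_on_compose2[OF Suc Ti]) simp
  moreover have "continuous_on UNIV (\<lambda>\<xi>. lamU n (Ti \<xi>))"
    by (rule continuous_on_compose2[OF continuous_lamU Ti]) simp
  ultimately show ?case unfolding G.simps by (intro continuous_intros Ti)
qed simp

text \<open>\<open>theta\<close> is the area of the parallelogram spanned by \<open>(1, u)\<close>
  and \<open>(1, - v)\<close>. The derivative of \<open>T\<close> preserves area and multiplies the
  first components of these vectors by \<open>1 / lam \<xi>\<close> and
  \<open>1 / (1 + v (T \<xi>))\<close>.\<close>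

lemma theta_step: "theta (T \<xi>) = theta \<xi> * lam \<xi> * (1 + v (T \<xi>))"
proof -
  have 1: "1 + dp \<xi> + u \<xi> > 0" using p_nonneg[of "fst \<xi>"] u_nonneg[of \<xi>] by linarith
  have 2: "1 + v (T \<xi>) > 0" using v_nonneg[of "T \<xi>"] by linarith
  have v: "v \<xi> * (1 + v (T \<xi>)) = dp \<xi> * (1 + v (T \<xi>)) + v (T \<xi>)"
    using v_step[of \<xi>] 2 by (simp add: slope_map_def field_simps)
  have "u (T \<xi>) * (1 + dp \<xi> + u \<xi>) = dp \<xi> + u \<xi>"
    using u_step[of \<xi>] 1 by (simp add: slope_map_def add.assoc)
  then have "theta (T \<xi>) * (1 + dp \<xi> + u \<xi>) = theta \<xi> * (1 + v (T \<xi>))"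
    unfolding theta_def using v by (simp add: algebra_simps)
  then show ?thesis using 1 by (simp add: lam_def field_simps)
qed

text \<open>The derivative of \<open>Ti\<close> multiplies the unstable vector by
  \<open>lam\<close>; the other factor is the derivative of \<open>slope_map\<close>.\<close>

lemma al_step: "al (Suc n) (T \<xi>) = (lam \<xi> * (lamU n \<xi>)\<^sup>2) * (q (fst \<xi>) + al n \<xi>)"
proof -
  have 1: "1 + dp \<xi> + u \<xi> > 0" using p_nonneg[of "fst \<xi>"] u_nonneg[of \<xi>] by linarith
  have u1: "u (T \<xi>) = (dp \<xi> + u \<xi>) * lam \<xi>" using u_step[of \<xi>] by (simp add: slope_map_def lam_def add.assoc)
  have l: "lam \<xi> * (1 + dp \<xi> + u \<xi>) = 1" using 1 by (simp add: lam_def)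
  have e1: "1 - u (T \<xi>) = lam \<xi>" unfolding u1 using l by (simp add: algebra_simps)
  have e2: "u (T \<xi>) * (1 + dp \<xi>) - dp \<xi> = lam \<xi> * u \<xi>"
  proof -
    have "u (T \<xi>) * (1 + dp \<xi>) - dp \<xi> = lam \<xi> * u \<xi> + dp \<xi> * (lam \<xi> * (1 + dp \<xi> + u \<xi>) - 1)"
      unfolding u1 by (simp add: algebra_simps)
    then show ?thesis using l by simp
  qed
  have "al (Suc n) (T \<xi>) = (lamU n \<xi>)\<^sup>2 * ((q (fst \<xi>) + fst (G n \<xi>)) * (1 - u (T \<xi>)) +
      snd (G n \<xi>) * (u (T \<xi>) * (1 + dp \<xi>) - dp \<xi>))"
    unfolding al_def by (simp add: algebra_simps)
  then show ?thesis unfolding e1 e2 al_def by (simp add: algebra_simps)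
qed

lemma ga_step:
  assumes \<xi>: "\<xi> \<notin> torus_lattice"
  shows "ga (Suc n) (T \<xi>) = ((lamU n \<xi>)\<^sup>2 / lam \<xi>) * (q (fst \<xi>) / theta \<xi> + ga n \<xi>)"
proof -
  have 2: "1 + v (T \<xi>) > 0" using v_nonneg[of "T \<xi>"] by linarith
  have v: "v (T \<xi>) * (1 + dp \<xi>) + dp \<xi> = v \<xi> * (1 + v (T \<xi>))"
    using v_step[of \<xi>] 2 by (simp add: slope_map_def field_simps)
  have "fst (G (Suc n) (T \<xi>)) - v (T \<xi>) * snd (G (Suc n) (T \<xi>)) =
      (lamU n \<xi>)\<^sup>2 * ((q (fst \<xi>) + fst (G n \<xi>)) * (1 + v (T \<xi>)) - snd (G n \<xi>) * (v (T \<xi>) * (1 + dp \<xi>) + dp \<xi>))"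
    by (simp add: algebra_simps)
  also have "\<dots> = (1 + v (T \<xi>)) * ((lamU n \<xi>)\<^sup>2 * (q (fst \<xi>) + (fst (G n \<xi>) - v \<xi> * snd (G n \<xi>))))"
    unfolding v by (simp add: algebra_simps)
  finally have "ga (Suc n) (T \<xi>) = (1 + v (T \<xi>)) * ((lamU n \<xi>)\<^sup>2 * (q (fst \<xi>) + (fst (G n \<xi>) - v \<xi> * snd (G n \<xi>)))) /
      (theta \<xi> * lam \<xi> * (1 + v (T \<xi>)))" unfolding ga_def theta_step by simp
  also have "\<dots> = (lamU n \<xi>)\<^sup>2 * (q (fst \<xi>) + (fst (G n \<xi>) - v \<xi> * snd (G n \<xi>))) / (theta \<xi> * lam \<xi>)"
    using 2 by simp
  also have "\<dots> = ((lamU n \<xi>)\<^sup>2 / lam \<xi>) * (q (fst \<xi>) / theta \<xi> + ga n \<xi>)"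
    unfolding ga_def by (simp add: add_divide_distrib distrib_left mult.commute[of "theta \<xi>"])
  finally show ?thesis .
qed

lemma lamU_sq_le: "(lamU n \<xi>)\<^sup>2 \<le> lam \<xi> * lam \<xi>"
  using lamU_bounds[of n \<xi>] lam_bounds[of \<xi>] by (simp add: power2_eq_square mult_mono)

lemma lam_lamU_sq_le: "lam \<xi> * (lamU n \<xi>)\<^sup>2 \<le> lam \<xi>"
proof -
  have "lam \<xi> * (lamU n \<xi>)\<^sup>2 \<le> lam \<xi> * (1 * 1)"
    using lamU_sq_le[of n \<xi>] lam_bounds[of \<xi>] mult_mono[of "lam \<xi>" 1 "lam \<xi>" 1] by (intro mult_left_mono) auto
  then show ?thesis by simp
qed

lemma lamU_sq_div_lam_le: "(lamU n \<xi>)\<^sup>2 / lam \<xi> \<le> lam \<xi>"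
  using lamU_sq_le[of n \<xi>] lam_bounds[of \<xi>] by (simp add: divide_le_eq)

lemma lamU_sq_div_lam_nonneg: "0 \<le> (lamU n \<xi>)\<^sup>2 / lam \<xi>"
  using lam_bounds(1)[of \<xi>] by simp

text \<open>Nothing accumulates in the unstable direction: the source is at most
  \<open>C * u\<close> and the contraction is by \<open>1 / (1 + dp + u)\<close>, so
  \<open>lam * (C * u + C) \<le> C\<close>.\<close>

lemma al_bound: "\<bar>al n \<xi>\<bar> \<le> C"
proof (induction n arbitrary: \<xi>)
  case 0
  then show ?case using C_ge_1 by (simp add: al_def)
next
  case (Suc n)
  define \<eta> where "\<eta> = Ti \<xi>"
  have T: "T \<eta> = \<xi>" by (simp add: \<eta>_def)
  have 1: "1 + dp \<eta> + u \<eta> > 0" using p_nonneg[of "fst \<eta>"] u_nonneg[of \<eta>] by linarith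
  have "\<bar>al (Suc n) \<xi>\<bar> = (lam \<eta> * (lamU n \<eta>)\<^sup>2) * \<bar>q (fst \<eta>) + al n \<eta>\<bar>"
    using al_step[of n \<eta>] lam_bounds[of \<eta>] by (simp add: T abs_mult)
  also have "\<dots> \<le> lam \<eta> * (C * (1 + dp \<eta> + u \<eta>))"
  proof (rule mult_mono)
    have "\<bar>q (fst \<eta>) + al n \<eta>\<bar> \<le> C * u \<eta> + C" using q_le_u[of \<eta>] Suc[of \<eta>] by linarith
    moreover have "0 \<le> C * dp \<eta>" using C_ge_1 p_nonneg by simp
    ultimately show "\<bar>q (fst \<eta>) + al n \<eta>\<bar> \<le> C * (1 + dp \<eta> + u \<eta>)" by (simp add: algebra_simps)
  qed (use lam_lamU_sq_le lam_bounds[of \<eta>] in auto)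
  also have "\<dots> = C" using 1 by (simp add: lam_def)
  finally show ?case .
qed

lemma q_div_theta: assumes "\<xi> \<notin> torus_lattice" shows "\<bar>q (fst \<xi>) / theta \<xi>\<bar> \<le> C"
proof -
  have "\<bar>q (fst \<xi>)\<bar> \<le> C * u \<xi>" by (rule q_le_u)
  also have "\<dots> \<le> C * theta \<xi>" using C_ge_1 v_nonneg by (simp add: theta_def)
  finally show ?thesis using theta_pos[OF assms] by (simp add: divide_le_eq)
qed

text \<open>After division by \<open>theta\<close> the source is merely bounded, so this component
  does accumulate along the backward orbit; \<open>W_step\<close> sums it up.\<close>

lemma ga_bound: "\<xi> \<notin> torus_lattice \<Longrightarrow> \<bar>ga n \<xi>\<bar> \<le> C * W \<xi>"
proof (induction n arbitrary: \<xi>)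
  case 0
  then show ?case using C_ge_1 W_ge_1[of \<xi>] by (simp add: ga_def)
next
  case (Suc n)
  define \<eta> where "\<eta> = Ti \<xi>"
  have \<eta>: "\<eta> \<notin> torus_lattice" "T \<eta> = \<xi>" using Suc.prems by (auto simp: \<eta>_def)
  have "\<bar>ga (Suc n) \<xi>\<bar> = ((lamU n \<eta>)\<^sup>2 / lam \<eta>) * \<bar>q (fst \<eta>) / theta \<eta> + ga n \<eta>\<bar>"
    using ga_step[OF \<eta>(1), of n] lam_bounds[of \<eta>] by (simp add: \<eta>(2) abs_mult)
  also have "\<dots> \<le> lam \<eta> * (C + C * W \<eta>)"
  proof (rule mult_mono)
    show "\<bar>q (fst \<eta>) / theta \<eta> + ga n \<eta>\<bar> \<le> C + C * W \<eta>"
      using q_div_theta[OF \<eta>(1)] Suc.IH[OF \<eta>(1)] by linarith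
  qed (use lamU_sq_div_lam_le lam_bounds[of \<eta>] in auto)
  also have "\<dots> = C * (lam \<eta> + lam \<eta> * W \<eta>)" by (simp add: algebra_simps)
  also have "\<dots> \<le> C * W \<xi>" using C_ge_1 W_step[OF \<eta>(1)] lam_bounds[of \<eta>] \<eta>(2) by (intro mult_left_mono) auto
  finally show ?case .
qed

lemma al_Cauchy:
  "0 < e \<Longrightarrow> \<exists>N. \<forall>i\<ge>N. \<forall>j\<ge>N. \<forall>\<xi>. \<xi> \<notin> torus_lattice \<longrightarrow> W \<xi> \<le> B \<longrightarrow> \<bar>al i \<xi> - al j \<xi>\<bar> \<le> e"
proof (rule cocycle_uniformly_Cauchy[where g = al and m = "\<lambda>n \<xi>. lam \<xi> * (lamU n \<xi>)\<^sup>2" and s = "\<lambda>\<xi>. q (fst \<xi>)"])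
  fix \<xi> assume \<xi>: "\<xi> \<notin> torus_lattice"
  have "C * u \<xi> \<le> C * 1" using u_less_1[of \<xi>] C_ge_1 by (intro mult_left_mono) auto
  then show "\<bar>q (fst \<xi>)\<bar> \<le> C" using q_le_u[of \<xi>] by linarith
  show "\<bar>al n \<xi>\<bar> \<le> C * W \<xi>" for n
  proof -
    have "C * 1 \<le> C * W \<xi>" using W_ge_1[OF \<xi>] C_ge_1 by (intro mult_left_mono) auto
    then show ?thesis using al_bound[of n \<xi>] by linarith
  qed
  fix i j N :: nat assume N: "0 < N" "N \<le> i" "N \<le> j"
  have "\<bar>lam \<xi> * (lamU i \<xi>)\<^sup>2 - lam \<xi> * (lamU j \<xi>)\<^sup>2\<bar> = lam \<xi> * \<bar>(lamU i \<xi>)\<^sup>2 - (lamU j \<xi>)\<^sup>2\<bar>"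
    using lam_bounds[of \<xi>] by (simp add: abs_mult flip: right_diff_distrib)
  also have "\<dots> \<le> 1 * (1 * (4 * W \<xi> / real N))"
    using lamU_diff[OF \<xi> N] lam_bounds[of \<xi>] W_ge_1[OF \<xi>]
    by (intro mult_mono order_trans[OF lamU_diff[OF \<xi> N]]) auto
  finally show "\<bar>lam \<xi> * (lamU i \<xi>)\<^sup>2 - lam \<xi> * (lamU j \<xi>)\<^sup>2\<bar> \<le> 4 * W \<xi> / real N" by simp
next
  show "0 \<le> lam \<xi> * (lamU n \<xi>)\<^sup>2" for n \<xi> using lam_bounds(1)[of \<xi>] by simp
qed (rule al_step lam_lamU_sq_le | assumption)+

lemma ga_Cauchy:
  "0 < e \<Longrightarrow> \<exists>N. \<forall>i\<ge>N. \<forall>j\<ge>N. \<forall>\<xi>. \<xi> \<notin> torus_lattice \<longrightarrow> W \<xi> \<le> B \<longrightarrow> \<bar>ga i \<xi> - ga j \<xi>\<bar> \<le> e"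
proof (rule cocycle_uniformly_Cauchy[where g = ga and m = "\<lambda>n \<xi>. (lamU n \<xi>)\<^sup>2 / lam \<xi>"
      and s = "\<lambda>\<xi>. q (fst \<xi>) / theta \<xi>"])
  fix \<xi> assume \<xi>: "\<xi> \<notin> torus_lattice"
  show "ga (Suc n) (T \<xi>) = ((lamU n \<xi>)\<^sup>2 / lam \<xi>) * (q (fst \<xi>) / theta \<xi> + ga n \<xi>)" for n
    by (rule ga_step[OF \<xi>])
  show "\<bar>q (fst \<xi>) / theta \<xi>\<bar> \<le> C" by (rule q_div_theta[OF \<xi>])
  show "\<bar>ga n \<xi>\<bar> \<le> C * W \<xi>" for n by (rule ga_bound[OF \<xi>])
  fix i j N :: nat assume N: "0 < N" "N \<le> i" "N \<le> j"
  have "\<bar>(lamU i \<xi>)\<^sup>2 / lam \<xi> - (lamU j \<xi>)\<^sup>2 / lam \<xi>\<bar> = \<bar>(lamU i \<xi>)\<^sup>2 - (lamU j \<xi>)\<^sup>2\<bar> / lam \<xi>"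
    using lam_bounds[of \<xi>] by (simp add: abs_div flip: diff_divide_distrib)
  also have "\<dots> \<le> lam \<xi> * (4 * W \<xi> / real N) / lam \<xi>"
    using lamU_diff[OF \<xi> N] lam_bounds[of \<xi>] by (intro divide_right_mono) auto
  finally show "\<bar>(lamU i \<xi>)\<^sup>2 / lam \<xi> - (lamU j \<xi>)\<^sup>2 / lam \<xi>\<bar> \<le> 4 * W \<xi> / real N"
    using lam_bounds[of \<xi>] by simp
qed (rule lamU_sq_div_lam_nonneg lamU_sq_div_lam_le | assumption)+

text \<open>Inverts the change of basis to \<open>(1, u)\<close> and \<open>(1, - v)\<close>, whose
  determinant is \<open>- theta\<close>.\<close>

lemma G_eq:
  assumes "\<xi> \<notin> torus_lattice"
  shows "fst (G n \<xi>) = v \<xi> / theta \<xi> * al n \<xi> + u \<xi> * ga n \<xi>"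
    "snd (G n \<xi>) = 1 / theta \<xi> * al n \<xi> - ga n \<xi>"
proof -
  define P Q where "P = fst (G n \<xi>)" and "Q = snd (G n \<xi>)"
  have t: "theta \<xi> \<noteq> 0" using theta_pos[OF assms] by simp
  have "v \<xi> * (P + u \<xi> * Q) + u \<xi> * (P - v \<xi> * Q) = theta \<xi> * P" by (simp add: theta_def algebra_simps)
  then have "(v \<xi> * (P + u \<xi> * Q) + u \<xi> * (P - v \<xi> * Q)) / theta \<xi> = P" using t by simp
  then show "fst (G n \<xi>) = v \<xi> / theta \<xi> * al n \<xi> + u \<xi> * ga n \<xi>"
    unfolding al_def ga_def P_def[symmetric] Q_def[symmetric]
    by (simp only: times_divide_eq_left times_divide_eq_right add_divide_distrib[symmetric])
  have "(P + u \<xi> * Q) - (P - v \<xi> * Q) = theta \<xi> * Q" by (simp add: theta_def algebra_simps)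
  then have "((P + u \<xi> * Q) - (P - v \<xi> * Q)) / theta \<xi> = Q"
    by (simp only: nonzero_mult_div_cancel_left[OF t])
  then show "snd (G n \<xi>) = 1 / theta \<xi> * al n \<xi> - ga n \<xi>"
    unfolding al_def ga_def P_def[symmetric] Q_def[symmetric]
    by (simp only: times_divide_eq_left mult_1_left diff_divide_distrib[symmetric])
qed

lemma inverse_theta_le: assumes "\<xi> \<notin> torus_lattice" shows "1 / theta \<xi> \<le> C * W \<xi>"
proof -
  have "1 \<le> C * W \<xi> * u \<xi>" by (rule W_u[OF assms])
  also have "\<dots> \<le> C * W \<xi> * theta \<xi>" using C_ge_1 W_ge_1[OF assms] v_nonneg by (intro mult_left_mono) (auto simp: theta_def)
  finally show ?thesis using theta_pos[OF assms] by (simp add: divide_le_eq)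
qed

lemma norm_pair_le: "norm (w :: real \<times> real) \<le> \<bar>fst w\<bar> + \<bar>snd w\<bar>"
  using norm_Pair_le[of "fst w" "snd w"] by simp

lemma v_div_theta: "\<xi> \<notin> torus_lattice \<Longrightarrow> 0 \<le> v \<xi> / theta \<xi> \<and> v \<xi> / theta \<xi> \<le> 1"
  using theta_pos[of \<xi>] v_nonneg[of \<xi>] u_nonneg[of \<xi>] by (simp add: divide_le_eq theta_def)

lemma norm_combination_le:
  assumes \<xi>: "\<xi> \<notin> torus_lattice"
  shows "norm (v \<xi> / theta \<xi> * a + u \<xi> * g, 1 / theta \<xi> * a - g) \<le> (1 + 1 / theta \<xi>) * \<bar>a\<bar> + 2 * \<bar>g\<bar>"
proof -
  have "\<bar>v \<xi> / theta \<xi> * a\<bar> \<le> 1 * \<bar>a\<bar>" unfolding abs_mult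
    using v_div_theta[OF \<xi>] by (intro mult_right_mono) auto
  moreover have "\<bar>u \<xi> * g\<bar> \<le> 1 * \<bar>g\<bar>" unfolding abs_mult
    using u_nonneg[of \<xi>] u_less_1[of \<xi>] by (intro mult_right_mono) auto
  moreover have "\<bar>1 / theta \<xi> * a\<bar> = 1 / theta \<xi> * \<bar>a\<bar>" using theta_pos[OF \<xi>] by (simp add: abs_mult)
  ultimately have "\<bar>v \<xi> / theta \<xi> * a + u \<xi> * g\<bar> + \<bar>1 / theta \<xi> * a - g\<bar> \<le> \<bar>a\<bar> + \<bar>g\<bar> + (1 / theta \<xi> * \<bar>a\<bar> + \<bar>g\<bar>)"
    by linarith
  then show ?thesis using norm_pair_le[of "(v \<xi> / theta \<xi> * a + u \<xi> * g, 1 / theta \<xi> * a - g)"]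
    by (simp add: distrib_right)
qed

lemma G_uniformly_Cauchy: "uniformly_Cauchy_on {\<xi>. \<xi> \<notin> torus_lattice \<and> W \<xi> \<le> B} G"
  unfolding uniformly_Cauchy_on_def
proof (intro allI impI)
  fix e :: real assume e: "e > 0"
  \<comment> \<open>\<open>1 + C * \<bar>B\<bar>\<close> comes from \<open>al\<close> through
    \<open>1 / theta \<le> C * W\<close>, and 2 from \<open>ga\<close>; taking 4 for their constant
    part 3 makes the final inequality strict.\<close>
  define K where "K = 4 + C * \<bar>B\<bar>"
  have K: "K > 0" using C_ge_1 by (simp add: K_def add_pos_nonneg)
  define e' where "e' = e / (2 * K)"
  have e': "e' > 0" using e K by (simp add: e'_def)
  obtain N1 where N1: "\<And>i j \<xi>. N1 \<le> i \<Longrightarrow> N1 \<le> j \<Longrightarrow> \<xi> \<notin> torus_lattice \<Longrightarrow> W \<xi> \<le> B \<Longrightarrow> \<bar>al i \<xi> - al j \<xi>\<bar> \<le> e'"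
    using al_Cauchy[OF e', of B] by blast
  obtain N2 where N2: "\<And>i j \<xi>. N2 \<le> i \<Longrightarrow> N2 \<le> j \<Longrightarrow> \<xi> \<notin> torus_lattice \<Longrightarrow> W \<xi> \<le> B \<Longrightarrow> \<bar>ga i \<xi> - ga j \<xi>\<bar> \<le> e'"
    using ga_Cauchy[OF e', of B] by blast
  have "dist (G i \<xi>) (G j \<xi>) < e" if \<xi>: "\<xi> \<notin> torus_lattice" "W \<xi> \<le> B" and ij: "max N1 N2 \<le> i" "max N1 N2 \<le> j" for \<xi> i j
  proof -
    have "G i \<xi> - G j \<xi> = (v \<xi> / theta \<xi> * (al i \<xi> - al j \<xi>) + u \<xi> * (ga i \<xi> - ga j \<xi>),
        1 / theta \<xi> * (al i \<xi> - al j \<xi>) - (ga i \<xi> - ga j \<xi>))"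
      by (rule prod_eqI) (simp_all only: fst_diff snd_diff fst_conv snd_conv G_eq[OF \<xi>(1)] right_diff_distrib)
    then have "dist (G i \<xi>) (G j \<xi>) \<le> (1 + 1 / theta \<xi>) * \<bar>al i \<xi> - al j \<xi>\<bar> + 2 * \<bar>ga i \<xi> - ga j \<xi>\<bar>"
      using norm_combination_le[OF \<xi>(1)] by (simp add: dist_norm)
    also have "\<dots> \<le> (1 + C * \<bar>B\<bar>) * e' + 2 * e'"
    proof (intro add_mono mult_mono)
      have "C * W \<xi> \<le> C * \<bar>B\<bar>" using \<xi> C_ge_1 by (intro mult_left_mono) auto
      then show "1 / theta \<xi> \<le> C * \<bar>B\<bar>" using inverse_theta_le[OF \<xi>(1)] by linarith
      show "\<bar>al i \<xi> - al j \<xi>\<bar> \<le> e'" "\<bar>ga i \<xi> - ga j \<xi>\<bar> \<le> e'" using N1 N2 ij \<xi> by auto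
    qed (use C_ge_1 in auto)
    also have "\<dots> < K * e'" using e' by (simp add: K_def algebra_simps)
    also have "\<dots> \<le> e" using K e by (simp add: e'_def)
    finally show ?thesis .
  qed
  then show "\<exists>M. \<forall>\<xi>\<in>{\<xi>. \<xi> \<notin> torus_lattice \<and> W \<xi> \<le> B}. \<forall>i\<ge>M. \<forall>j\<ge>M. dist (G i \<xi>) (G j \<xi>) < e" by blast
qed

section \<open>The limit of the gradients\<close>

definition grad :: "real \<times> real \<Rightarrow> real \<times> real" where
  "grad \<xi> = lim (\<lambda>n. G n \<xi>)"

lemma G_uniform_limit: "uniform_limit {\<xi>. \<xi> \<notin> torus_lattice \<and> W \<xi> \<le> B} G grad sequentially"
  unfolding grad_def using Cauchy_uniformly_convergent[OF G_uniformly_Cauchy]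
  by (simp add: uniformly_convergent_uniform_limit_iff)

lemma closed_torus_lattice: "closed torus_lattice"
  unfolding torus_lattice_def by (intro closed_Times closed_Ints)

text \<open>\<open>W\<close> is continuous off the closed lattice, so uniform convergence on its
  sublevel sets is locally uniform convergence there.\<close>

lemma grad_neighbourhood:
  assumes \<xi>: "\<xi> \<notin> torus_lattice"
  obtains r B where "r > 0" "ball \<xi> r \<subseteq> {\<xi>. \<xi> \<notin> torus_lattice \<and> W \<xi> \<le> B}"
proof -
  have op: "open (- torus_lattice :: (real \<times> real) set)" using closed_torus_lattice by blast
  define S where "S = W -` {..<W \<xi> + 1} \<inter> - torus_lattice"
  have "open S" unfolding S_def
    by (rule continuous_on_open_vimage[OF op, THEN iffD1, OF W_cont, rule_format]) simp
  moreover have "\<xi> \<in> S" using \<xi> by (simp add: S_def)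
  ultimately obtain r where "r > 0" "ball \<xi> r \<subseteq> S" by (rule openE)
  moreover have "S \<subseteq> {\<xi>'. \<xi>' \<notin> torus_lattice \<and> W \<xi>' \<le> W \<xi> + 1}" unfolding S_def by auto
  ultimately show thesis by (intro that[of r "W \<xi> + 1"]) (assumption, rule order_trans)
qed

lemma has_derivative_u:
  assumes \<xi>: "\<xi> \<notin> torus_lattice"
  shows "(u has_derivative (\<lambda>w. grad \<xi> \<bullet> w)) (at \<xi>)"
proof -
  obtain r B where r: "r > 0" and sub: "ball \<xi> r \<subseteq> {\<xi>. \<xi> \<notin> torus_lattice \<and> W \<xi> \<le> B}"
    using grad_neighbourhood[OF \<xi>] by blast
  have ul: "uniform_limit (ball \<xi> r) G grad sequentially"
    by (rule uniform_limit_on_subset[OF G_uniform_limit sub])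
  have "\<exists>g. \<forall>x\<in>ball \<xi> r. (\<lambda>n. U n x) \<longlonglongrightarrow> g x \<and> (g has_derivative (\<lambda>w. grad x \<bullet> w)) (at x within ball \<xi> r)"
  proof (rule has_derivative_sequence)
    show "(U n has_derivative (\<lambda>w. G n x \<bullet> w)) (at x within ball \<xi> r)" for n x
      by (rule has_derivative_at_withinI[OF has_derivative_U])
    show "(\<lambda>n. U n \<xi>) \<longlonglongrightarrow> u \<xi>" by (rule U_tendsto[OF \<xi>])
    fix e :: real assume "e > 0"
    then have "\<forall>\<^sub>F n in sequentially. \<forall>x\<in>ball \<xi> r. dist (G n x) (grad x) < e"
      using ul by (auto simp: uniform_limit_iff)
    then show "\<forall>\<^sub>F n in sequentially. \<forall>x\<in>ball \<xi> r. \<forall>w :: real \<times> real. norm (G n x \<bullet> w - grad x \<bullet> w) \<le> e * norm w"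
    proof (rule eventually_mono, intro ballI allI)
      fix n x and w :: "real \<times> real" assume "\<forall>x\<in>ball \<xi> r. dist (G n x) (grad x) < e" "x \<in> ball \<xi> r"
      then have "norm (G n x - grad x) \<le> e" by (auto simp: dist_norm intro: less_imp_le)
      then have "norm (G n x - grad x) * norm w \<le> e * norm w" by (rule mult_right_mono) simp
      then show "norm (G n x \<bullet> w - grad x \<bullet> w) \<le> e * norm w"
        using Cauchy_Schwarz_ineq2[of "G n x - grad x" w] by (simp add: inner_diff_left)
    qed
  qed (use r in auto)
  then obtain g where g: "\<And>x. x \<in> ball \<xi> r \<Longrightarrow> (\<lambda>n. U n x) \<longlonglongrightarrow> g x"
    "\<And>x. x \<in> ball \<xi> r \<Longrightarrow> (g has_derivative (\<lambda>w. grad x \<bullet> w)) (at x within ball \<xi> r)" by blast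
  have eq: "g x = u x" if "x \<in> ball \<xi> r" for x
    using LIMSEQ_unique[OF g(1)[OF that] U_tendsto] sub that by auto
  have "(u has_derivative (\<lambda>w. grad \<xi> \<bullet> w)) (at \<xi> within ball \<xi> r)"
    by (rule has_derivative_transform[OF _ _ g(2)]) (use r eq in auto)
  then show ?thesis using r by (simp add: at_within_open[OF _ open_ball])
qed

lemma continuous_grad: "continuous_on (- torus_lattice) grad"
proof (rule continuous_at_imp_continuous_on, rule ballI)
  fix \<xi> :: "real \<times> real" assume "\<xi> \<in> - torus_lattice"
  then have \<xi>: "\<xi> \<notin> torus_lattice" by simp
  obtain r B where r: "r > 0" and sub: "ball \<xi> r \<subseteq> {\<xi>. \<xi> \<notin> torus_lattice \<and> W \<xi> \<le> B}"
    using grad_neighbourhood[OF \<xi>] by blast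
  have "continuous_on (ball \<xi> r) grad"
  proof (rule uniform_limit_theorem[OF _ uniform_limit_on_subset[OF G_uniform_limit sub]])
    show "\<forall>\<^sub>F n in sequentially. continuous_on (ball \<xi> r) (G n)"
      by (intro always_eventually allI continuous_on_subset[OF continuous_G] subset_UNIV)
  qed simp
  then show "isCont grad \<xi>" using r by (simp add: continuous_on_eq_continuous_at)
qed

lemma norm_grad_le:
  assumes \<xi>: "\<xi> \<notin> torus_lattice"
  shows "norm (grad \<xi>) \<le> (3 * C\<^sup>2 + C) * inverse (u \<xi> + v \<xi>)"
proof -
  have t: "theta \<xi> > 0" by (rule theta_pos[OF \<xi>])
  have W: "W \<xi> \<le> C / theta \<xi>" using W_theta[OF \<xi>] t by (simp add: theta_def le_divide_eq)
  have "norm (G n \<xi>) \<le> (3 * C\<^sup>2 + C) * inverse (u \<xi> + v \<xi>)" for n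
  proof -
    have "G n \<xi> = (v \<xi> / theta \<xi> * al n \<xi> + u \<xi> * ga n \<xi>, 1 / theta \<xi> * al n \<xi> - ga n \<xi>)"
      by (rule prod_eqI) (simp_all only: fst_conv snd_conv G_eq[OF \<xi>])
    then have "norm (G n \<xi>) \<le> (1 + 1 / theta \<xi>) * \<bar>al n \<xi>\<bar> + 2 * \<bar>ga n \<xi>\<bar>"
      using norm_combination_le[OF \<xi>] by metis
    also have "\<dots> \<le> (1 + 1 / theta \<xi>) * C + 2 * (C * W \<xi>)"
      using al_bound[of n \<xi>] ga_bound[OF \<xi>, of n] t by (intro add_mono mult_left_mono) auto
    \<comment> \<open>The summand 1 is absorbed by
      \<open>1 \<le> W \<xi> \<le> C / theta \<xi>\<close>.\<close>
    also have "\<dots> \<le> (C / theta \<xi> + 1 / theta \<xi>) * C + 2 * (C * (C / theta \<xi>))"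
      using W W_ge_1[OF \<xi>] C_ge_1 by (intro add_mono mult_right_mono mult_left_mono) auto
    also have "\<dots> = (3 * C\<^sup>2 + C) * inverse (u \<xi> + v \<xi>)"
      by (simp add: theta_def power2_eq_square divide_inverse algebra_simps)
    finally show ?thesis .
  qed
  moreover have "(\<lambda>n. G n \<xi>) \<longlonglongrightarrow> grad \<xi>"
    using tendsto_uniform_limitI[OF G_uniform_limit[of "W \<xi>"]] \<xi> by auto
  ultimately show ?thesis by (intro LIMSEQ_le_const2[OF tendsto_norm]) auto
qed

end

context slope_fields
begin

lemma slope_gradient:
  obtains g K where "K > 0" "\<And>\<xi>. \<xi> \<notin> torus_lattice \<Longrightarrow> (u has_derivative (\<lambda>w. g \<xi> \<bullet> w)) (at \<xi>)"
    "continuous_on (- torus_lattice) g"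
    "\<And>\<xi>. \<xi> \<notin> torus_lattice \<Longrightarrow> norm (g \<xi>) \<le> K * inverse (u \<xi> + v \<xi>)"
proof -
  obtain M C where MC: "M > 0" "C \<ge> 1"
    "\<And>\<xi>. \<xi> \<notin> torus_lattice \<Longrightarrow> 1 + lam \<xi> * (200 / rad \<xi> + M) \<le> 200 / rad (T \<xi>) + M"
    "\<And>\<xi>. \<xi> \<notin> torus_lattice \<Longrightarrow> 200 / rad \<xi> + M \<le> 200 / rad (T \<xi>) + M + C"
    "\<And>\<xi>. \<xi> \<notin> torus_lattice \<Longrightarrow> (200 / rad \<xi> + M) * (u \<xi> + v \<xi>) \<le> C" "1 \<le> M"
    using supersolution by metis
  obtain b where b: "b > 0" "\<And>\<xi>. b * rad \<xi> \<le> u \<xi>" using u_ge_rad by blast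
  obtain B where B: "B > 0" "\<And>x. \<bar>q x\<bar> \<le> B * \<bar>frac_part x\<bar>" using q_bound by blast
  \<comment> \<open>The second summand comes from \<open>\<bar>q\<bar> \<le> B * rad / c\<close> and
    \<open>b * rad \<le> u\<close>; the third makes
    \<open>C' * (200 / rad \<xi>) * (b * rad \<xi>)\<close> at least 1.\<close>
  define C' where "C' = C + B / (c * b) + 1 / (200 * b)"
  have C': "C \<le> C'" "B / (c * b) \<le> C'" "1 / (200 * b) \<le> C'" using MC(2) B b c_pos by (auto simp: C'_def add_increasing)
  interpret controlled_slope_fields h u v "\<lambda>\<xi>. 200 / rad \<xi> + M" C'
  proof
    show "1 \<le> C'" using C' MC by simp
    show "continuous_on (- torus_lattice) (\<lambda>\<xi>. 200 / rad \<xi> + M)"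
      using rad_eq_0_iff by (intro continuous_intros continuous_on_subset[OF continuous_rad]) auto
    show "\<bar>q (fst \<xi>)\<bar> \<le> C' * u \<xi>" for \<xi>
    proof -
      have 1: "\<bar>frac_part (fst \<xi>)\<bar> \<le> rad \<xi> / c"
        using abs_le_radius[of "c * frac_part (fst \<xi>)" "c * frac_part (snd \<xi>)"] c_pos
        by (simp add: rad_def abs_mult le_divide_eq mult.commute)
      have 2: "rad \<xi> \<le> u \<xi> / b" using b(2)[of \<xi>] b(1) by (simp add: le_divide_eq mult.commute)
      have "\<bar>frac_part (fst \<xi>)\<bar> \<le> u \<xi> / b / c" using 1 divide_right_mono[OF 2, of c] c_pos by simp
      then have "B * \<bar>frac_part (fst \<xi>)\<bar> \<le> B * (u \<xi> / b / c)" using B(1) by (intro mult_left_mono) auto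
      also have "\<dots> = B / (c * b) * u \<xi>" by (simp add: mult.commute)
      also have "\<dots> \<le> C' * u \<xi>" using C' u_nonneg by (intro mult_right_mono)
      finally show ?thesis using B(2)[of "fst \<xi>"] by linarith
    qed
    fix \<xi> :: "real \<times> real" assume \<xi>: "\<xi> \<notin> torus_lattice"
    have r: "rad \<xi> > 0" using \<xi> by (simp add: rad_pos_iff)
    show "1 \<le> 200 / rad \<xi> + M" using r MC(6) by (simp add: add_increasing)
    show "1 + lam \<xi> * (200 / rad \<xi> + M) \<le> 200 / rad (T \<xi>) + M" by (rule MC(3)[OF \<xi>])
    show "200 / rad \<xi> + M \<le> 200 / rad (T \<xi>) + M + C'" using MC(4)[OF \<xi>] C' by linarith
    show "(200 / rad \<xi> + M) * (u \<xi> + v \<xi>) \<le> C'" using MC(5)[OF \<xi>] C' by linarith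
    show "1 \<le> C' * (200 / rad \<xi> + M) * u \<xi>"
    proof -
      have "1 = 1 / (200 * b) * (200 / rad \<xi>) * (b * rad \<xi>)" using r b by simp
      also have "\<dots> \<le> C' * (200 / rad \<xi> + M) * u \<xi>"
        using r b C' MC by (intro mult_mono b(2)) auto
      finally show ?thesis .
    qed
  qed
  show thesis
    by (rule that[of "3 * C'\<^sup>2 + C'" grad])
      (use C' MC has_derivative_u continuous_grad norm_grad_le in \<open>auto intro!: add_nonneg_pos\<close>)
qed

lemma v_gradient:
  assumes g: "\<And>\<xi>. \<xi> \<notin> torus_lattice \<Longrightarrow> (u has_derivative (\<lambda>w. g \<xi> \<bullet> w)) (at \<xi>)"
    and g_cont: "continuous_on (- torus_lattice) g"
  obtains g' where "\<And>\<xi>. \<xi> \<notin> torus_lattice \<Longrightarrow> (v has_derivative (\<lambda>w. g' \<xi> \<bullet> w)) (at \<xi>)"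
    "continuous_on (- torus_lattice) g'"
proof
  define k where "k \<xi> = 1 / (1 - u (reversor \<xi>))\<^sup>2" for \<xi>
  define g' where "g' \<xi> = k \<xi> *\<^sub>R (fst (g (reversor \<xi>)), - fst (g (reversor \<xi>)) - snd (g (reversor \<xi>)))" for \<xi>
  have u1: "1 - u (reversor \<xi>) \<noteq> 0" for \<xi> using u_less_1[of "reversor \<xi>"] by simp
  show "(v has_derivative (\<lambda>w. g' \<xi> \<bullet> w)) (at \<xi>)" if \<xi>: "\<xi> \<notin> torus_lattice" for \<xi>
  proof -
    have R: "(reversor has_derivative reversor) (at \<xi>)"
      unfolding reversor_def case_prod_beta by (auto intro!: derivative_eq_intros)
    have "((\<lambda>\<xi>. u (reversor \<xi>)) has_derivative (\<lambda>w. g (reversor \<xi>) \<bullet> reversor w)) (at \<xi>)"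
      by (rule has_derivative_compose[OF R g]) (simp add: \<xi>)
    moreover have "((\<lambda>t. t / (1 - t)) has_derivative (\<lambda>w. w * k \<xi>)) (at (u (reversor \<xi>)))"
    proof -
      have "((\<lambda>t. t / (1 - t)) has_real_derivative k \<xi>) (at (u (reversor \<xi>)))"
        unfolding k_def using u1[of \<xi>] by (auto intro!: derivative_eq_intros simp: power2_eq_square divide_simps)
      then show ?thesis by (simp only: has_field_derivative_def mult_commute_abs)
    qed
    ultimately have "((\<lambda>\<xi>. u (reversor \<xi>) / (1 - u (reversor \<xi>))) has_derivative
        (\<lambda>w. (g (reversor \<xi>) \<bullet> reversor w) * k \<xi>)) (at \<xi>)"
      by (rule has_derivative_compose)
    moreover have "(\<lambda>\<xi>. u (reversor \<xi>) / (1 - u (reversor \<xi>))) = v" using v_eq by (simp add: fun_eq_iff)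
    moreover have "(\<lambda>w. (g (reversor \<xi>) \<bullet> reversor w) * k \<xi>) = (\<lambda>w. g' \<xi> \<bullet> w)"
      by (rule ext) (simp add: g'_def reversor_def case_prod_beta inner_prod_def algebra_simps)
    ultimately show ?thesis by simp
  qed
  have "continuous_on (- torus_lattice) (\<lambda>\<xi>. g (reversor \<xi>))"
    by (rule continuous_on_compose2[OF g_cont]) (auto intro!: continuous_intros)
  moreover have "continuous_on (- torus_lattice) (\<lambda>\<xi>. u (reversor \<xi>))"
    by (rule continuous_on_compose2[OF u_cont]) (auto intro!: continuous_intros)
  ultimately show "continuous_on (- torus_lattice) g'"
    unfolding g'_def k_def using u1 by (intro continuous_intros) auto
qed

end

section \<open>Oseledets directions\<close>

lemma exponential_growth_at_top:
  fixes a :: "nat \<Rightarrow> real"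
  assumes lim: "(\<lambda>n. ln (a n) / real n) \<longlonglongrightarrow> \<mu>" and \<mu>: "0 < \<mu>" and a: "\<And>n. 0 \<le> a n"
  shows "filterlim a at_top sequentially"
proof (rule filterlim_at_top_mono)
  have "filterlim (\<lambda>n. (\<mu> / 2) * real n) at_top sequentially"
    by (rule filterlim_tendsto_pos_mult_at_top[OF tendsto_const _ filterlim_real_sequentially]) (use \<mu> in simp)
  then show "filterlim (\<lambda>n. \<mu> / 2 * real n) at_top sequentially" by simp
  have "\<forall>\<^sub>F n in sequentially. \<mu> / 2 < ln (a n) / real n"
    by (rule order_tendstoD(1)[OF lim]) (use \<mu> in simp)
  then show "\<forall>\<^sub>F n in sequentially. \<mu> / 2 * real n \<le> a n"
    using eventually_gt_at_top[of 0]
  proof eventually_elim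
    case (elim n)
    then have 1: "\<mu> / 2 * real n < ln (a n)" by (simp add: less_divide_eq)
    moreover have "0 < \<mu> / 2 * real n" using \<mu> elim by simp
    \<comment> \<open>The convention \<open>ln 0 = 0\<close> matters here: a positive logarithm
      excludes the value 0.\<close>
    ultimately have "a n \<noteq> 0" by auto
    then have "ln (a n) \<le> a n - 1" using a[of n] by (intro ln_le_minus_one) simp
    then show ?case using 1 by linarith
  qed
qed

text \<open>The reciprocals grow: the conventions \<open>inverse 0 = 0\<close> and
  \<open>ln 0 = 0\<close> make their logarithm \<open>- ln (a n)\<close> in every case.\<close>

lemma exponential_decay_tendsto_0:
  fixes a :: "nat \<Rightarrow> real"
  assumes lim: "(\<lambda>n. ln (a n) / real n) \<longlonglongrightarrow> \<mu>" and \<mu>: "\<mu> < 0" and a: "\<And>n. 0 \<le> a n"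
  shows "a \<longlonglongrightarrow> 0"
proof -
  have "(\<lambda>n. ln (inverse (a n)) / real n) \<longlonglongrightarrow> - \<mu>"
    using tendsto_minus[OF lim] by (simp add: ln_inverse)
  then have "filterlim (\<lambda>n. inverse (a n)) at_top sequentially"
    by (rule exponential_growth_at_top) (use \<mu> a in auto)
  from tendsto_inverse_0_at_top[OF this] show ?thesis by simp
qed

text \<open>In the basis \<open>(1, s)\<close>, \<open>(1, t)\<close> a nonzero second coefficient
  of \<open>w\<close> would force \<open>L n (1, t)\<close> to tend to 0 along with
  \<open>L n w\<close> and \<open>L n (1, s)\<close>.\<close>

lemma contracted_direction:
  fixes L :: "nat \<Rightarrow> real \<times> real \<Rightarrow> real \<times> real"
  assumes lin: "\<And>n. linear (L n)"
    and e: "(\<lambda>n. norm (L n (1, s))) \<longlonglongrightarrow> 0" and f: "filterlim (\<lambda>n. norm (L n (1, t))) at_top sequentially"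
    and w: "(\<lambda>n. norm (L n w)) \<longlonglongrightarrow> 0"
  shows "snd w = s * fst w"
proof -
  have st: "s \<noteq> t"
  proof
    assume "s = t"
    then have "filterlim (\<lambda>n. norm (L n (1, t))) (nhds 0) sequentially" using e by simp
    then show False using f not_tendsto_and_filterlim_at_infinity[of sequentially "\<lambda>n. norm (L n (1, t))" 0]
        filterlim_at_top_imp_at_infinity[OF f] by simp
  qed
  define b where "b = (snd w - s * fst w) / (t - s)"
  define a where "a = fst w - b"
  have "b * (t - s) = snd w - s * fst w" using st by (simp add: b_def)
  then have decomp: "w = a *\<^sub>R (1, s) + b *\<^sub>R (1, t)"
    by (intro prod_eqI) (simp_all add: a_def algebra_simps)
  have "b = 0"
  proof (rule ccontr)
    assume b: "b \<noteq> 0"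
    have "norm (L n (1, t)) \<le> (norm (L n w) + \<bar>a\<bar> * norm (L n (1, s))) / \<bar>b\<bar>" for n
    proof -
      have "L n w = a *\<^sub>R L n (1, s) + b *\<^sub>R L n (1, t)"
        by (subst decomp) (simp only: linear_add[OF lin] linear_scale[OF lin])
      then have "b *\<^sub>R L n (1, t) = L n w - a *\<^sub>R L n (1, s)" by simp
      then have "\<bar>b\<bar> * norm (L n (1, t)) \<le> norm (L n w) + \<bar>a\<bar> * norm (L n (1, s))"
        by (metis norm_scaleR norm_triangle_ineq4)
      then show ?thesis using b by (simp add: le_divide_eq mult.commute)
    qed
    note bound = this
    have "(\<lambda>n. (norm (L n w) + \<bar>a\<bar> * norm (L n (1, s))) / \<bar>b\<bar>) \<longlonglongrightarrow> (0 + \<bar>a\<bar> * 0) / \<bar>b\<bar>"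
      using b by (intro tendsto_intros e w) auto
    then have lim: "(\<lambda>n. (norm (L n w) + \<bar>a\<bar> * norm (L n (1, s))) / \<bar>b\<bar>) \<longlonglongrightarrow> 0" by simp
    have "(\<lambda>n. norm (L n (1, t))) \<longlonglongrightarrow> 0"
      by (rule tendsto_sandwich[OF _ _ tendsto_const lim]; rule always_eventually; use bound in simp)
    then show False using not_tendsto_and_filterlim_at_infinity[of sequentially "\<lambda>n. norm (L n (1, t))" 0]
        filterlim_at_top_imp_at_infinity[OF f] by simp
  qed
  then show ?thesis using st by (simp add: b_def)
qed

lemma frechet_derivative_translate:
  fixes f :: "'a::real_normed_vector \<Rightarrow> 'b::real_normed_vector"
  assumes f: "f differentiable (at x)" and shift: "\<And>y. f (y + k) = f y + k'"
  shows "frechet_derivative f (at (x + k)) = frechet_derivative f (at x)"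
proof -
  have "(f has_derivative frechet_derivative f (at x)) (at x)" using f by (simp add: frechet_derivative_works)
  then have "(f has_derivative frechet_derivative f (at x)) (at ((x + k) - k))" by simp
  then have "((\<lambda>y. f (y - k)) has_derivative frechet_derivative f (at x)) (at (x + k))"
    by (rule has_derivative_compose[of "\<lambda>y. y - k" "\<lambda>w. w", rotated]) (auto intro!: derivative_eq_intros)
  then have "((\<lambda>y. f (y - k) + k') has_derivative frechet_derivative f (at x)) (at (x + k))"
    by (auto intro!: derivative_eq_intros)
  moreover have "(\<lambda>y. f (y - k) + k') = f"
  proof
    show "f (y - k) + k' = f y" for y using shift[of "y - k"] by simp
  qed
  ultimately have "(f has_derivative frechet_derivative f (at x)) (at (x + k))" by simp
  from frechet_derivative_at[OF this] show ?thesis by simp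
qed

lemma countable_torus_lattice: "countable torus_lattice"
  unfolding torus_lattice_def Ints_def by (intro countable_SIGMA countable_image) auto

section \<open>Derivatives of the iterates, and invariance of the contracted directions\<close>

context slow_torus_map
begin

definition DT :: "real \<times> real \<Rightarrow> real \<times> real \<Rightarrow> real \<times> real" where
  "DT \<xi> w = (fst w + fst w * dp \<xi> + snd w, fst w * dp \<xi> + snd w)"

lemma has_derivative_T: "(T has_derivative DT \<xi>) (at \<xi>)"
proof -
  have "((\<lambda>\<xi>. h (fst \<xi>)) has_derivative (\<lambda>w. fst w * dp \<xi>)) (at \<xi>)"
    by (rule has_derivative_compose[OF _ has_derivative_h]) (auto intro!: derivative_eq_intros)
  then have "((\<lambda>\<xi>. (fst \<xi> + h (fst \<xi>) + snd \<xi>, h (fst \<xi>) + snd \<xi>)) has_derivative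
     (\<lambda>w. (fst w + fst w * dp \<xi> + snd w, fst w * dp \<xi> + snd w))) (at \<xi>)"
    by (intro has_derivative_Pair has_derivative_add has_derivative_fst has_derivative_snd has_derivative_ident)
  moreover have "T = (\<lambda>\<xi>. (fst \<xi> + h (fst \<xi>) + snd \<xi>, h (fst \<xi>) + snd \<xi>))"
    by (auto simp: torus_map_def)
  moreover have "DT \<xi> = (\<lambda>w. (fst w + fst w * dp \<xi> + snd w, fst w * dp \<xi> + snd w))"
    by (auto simp: DT_def)
  ultimately show ?thesis by simp
qed

definition fwd :: "nat \<Rightarrow> real \<times> real \<Rightarrow> real \<times> real \<Rightarrow> real \<times> real" where
  "fwd n \<xi> = frechet_derivative (T ^^ n) (at \<xi>)"

definition bwd :: "nat \<Rightarrow> real \<times> real \<Rightarrow> real \<times> real \<Rightarrow> real \<times> real" where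
  "bwd n \<xi> = frechet_derivative (Ti ^^ n) (at \<xi>)"

lemma differentiable_funpow:
  assumes "\<And>\<xi>. (f :: real \<times> real \<Rightarrow> real \<times> real) differentiable (at \<xi>)"
  shows "(f ^^ n) differentiable (at \<xi>)"
proof (induction n)
  case (Suc n)
  show ?case unfolding funpow.simps by (rule differentiable_chain_at[OF Suc assms])
qed (simp add: id_def)

lemma T_differentiable: "T differentiable (at \<xi>)" and Ti_differentiable: "Ti differentiable (at \<xi>)"
  unfolding differentiable_def using has_derivative_T[of \<xi>] has_derivative_Ti[of \<xi>] by blast+

lemma T_pow_differentiable: "(T ^^ n) differentiable (at \<xi>)"
  and Ti_pow_differentiable: "(Ti ^^ n) differentiable (at \<xi>)"
  by (rule differentiable_funpow T_differentiable Ti_differentiable)+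

lemma linear_fwd: "linear (fwd n \<xi>)" and linear_bwd: "linear (bwd n \<xi>)"
  unfolding fwd_def bwd_def by (rule linear_frechet_derivative T_pow_differentiable Ti_pow_differentiable)+

lemma fwd_Suc: "fwd (Suc n) \<xi> w = fwd n (T \<xi>) (DT \<xi> w)"
proof -
  have "frechet_derivative (T ^^ n \<circ> T) (at \<xi>) = frechet_derivative (T ^^ n) (at (T \<xi>)) \<circ> frechet_derivative T (at \<xi>)"
    by (rule frechet_derivative_compose[OF T_differentiable T_pow_differentiable])
  then show ?thesis using frechet_derivative_at[OF has_derivative_T, of \<xi>]
    by (simp only: fwd_def funpow_Suc_right comp_apply)
qed

text \<open>Since \<open>Ti ^^ Suc n \<circ> T = Ti ^^ n\<close>, the chain rule moves a vector
  contracted by the backward iterates at \<open>\<xi>\<close> to one at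
  \<open>T \<xi>\<close>.\<close>

lemma bwd_Suc: "bwd (Suc n) (T \<xi>) (DT \<xi> w) = bwd n \<xi> w"
proof -
  have "frechet_derivative (Ti ^^ Suc n \<circ> T) (at \<xi>) =
      frechet_derivative (Ti ^^ Suc n) (at (T \<xi>)) \<circ> frechet_derivative T (at \<xi>)"
    by (rule frechet_derivative_compose[OF T_differentiable Ti_pow_differentiable])
  moreover have "Ti ^^ Suc n \<circ> T = Ti ^^ n" by (simp only: funpow_Suc_right) (simp add: fun_eq_iff)
  ultimately show ?thesis using frechet_derivative_at[OF has_derivative_T, of \<xi>]
    by (simp only: bwd_def comp_apply)
qed

lemma funpow_translate:
  assumes "\<And>k. k \<in> torus_lattice \<Longrightarrow> \<exists>k'\<in>torus_lattice. \<forall>\<xi>. f (\<xi> + k) = f \<xi> + k'" "k \<in> torus_lattice"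
  shows "\<exists>k'\<in>torus_lattice. \<forall>\<xi>. (f ^^ n) (\<xi> + k) = (f ^^ n) \<xi> + k'"
proof (induction n)
  case (Suc n)
  then obtain k1 where k1: "k1 \<in> torus_lattice" "\<And>\<xi>. (f ^^ n) (\<xi> + k) = (f ^^ n) \<xi> + k1" by blast
  obtain k2 where "k2 \<in> torus_lattice" "\<And>\<xi>. f (\<xi> + k1) = f \<xi> + k2" using assms(1)[OF k1(1)] by blast
  then show ?case using k1(2) by (intro bexI[of _ k2]) auto
qed (use assms(2) in auto)

lemma fwd_periodic: "k \<in> torus_lattice \<Longrightarrow> fwd n (\<xi> + k) = fwd n \<xi>"
  and bwd_periodic: "k \<in> torus_lattice \<Longrightarrow> bwd n (\<xi> + k) = bwd n \<xi>"
proof -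
  assume k: "k \<in> torus_lattice"
  have *: "\<exists>k'\<in>torus_lattice. \<forall>\<xi>. T (\<xi> + k) = T \<xi> + k'"
    "\<exists>k'\<in>torus_lattice. \<forall>\<xi>. Ti (\<xi> + k) = Ti \<xi> + k'" if "k \<in> torus_lattice" for k
    by (rule T_translate[OF that], blast) (rule Ti_translate[OF that], blast)
  obtain k1 where "\<And>\<xi>. (T ^^ n) (\<xi> + k) = (T ^^ n) \<xi> + k1"
    using funpow_translate[OF *(1) k, of n] by blast
  then show "fwd n (\<xi> + k) = fwd n \<xi>"
    unfolding fwd_def by (intro frechet_derivative_translate T_pow_differentiable)
  obtain k2 where "\<And>\<xi>. (Ti ^^ n) (\<xi> + k) = (Ti ^^ n) \<xi> + k2"
    using funpow_translate[OF *(2) k, of n] by blast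
  then show "bwd n (\<xi> + k) = bwd n \<xi>"
    unfolding bwd_def by (intro frechet_derivative_translate Ti_pow_differentiable)
qed

text \<open>Keeps contraction and growth but forgets the exponents, which are given point by point
  and might differ between \<open>\<xi>\<close> and \<open>T \<xi>\<close>.\<close>

definition hyperbolic_slopes :: "(real \<times> real \<Rightarrow> real) \<Rightarrow> (real \<times> real \<Rightarrow> real) \<Rightarrow> real \<times> real \<Rightarrow> bool" where
  "hyperbolic_slopes u v \<xi> \<longleftrightarrow> 0 \<le> u \<xi> \<and> 0 \<le> v \<xi> \<and>
    (\<lambda>n. norm (bwd n \<xi> (1, u \<xi>))) \<longlonglongrightarrow> 0 \<and> filterlim (\<lambda>n. norm (fwd n \<xi> (1, u \<xi>))) at_top sequentially \<and>
    (\<lambda>n. norm (fwd n \<xi> (1, - v \<xi>))) \<longlonglongrightarrow> 0 \<and> filterlim (\<lambda>n. norm (bwd n \<xi> (1, - v \<xi>))) at_top sequentially"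

lemma oseledets_space_growth:
  assumes "w \<in> oseledets_space T \<xi> \<mu>" "w \<noteq> 0"
  shows "0 < \<mu> \<Longrightarrow> (\<lambda>n. norm (bwd n \<xi> w)) \<longlonglongrightarrow> 0"
    "0 < \<mu> \<Longrightarrow> filterlim (\<lambda>n. norm (fwd n \<xi> w)) at_top sequentially"
    "\<mu> < 0 \<Longrightarrow> (\<lambda>n. norm (fwd n \<xi> w)) \<longlonglongrightarrow> 0"
    "\<mu> < 0 \<Longrightarrow> filterlim (\<lambda>n. norm (bwd n \<xi> w)) at_top sequentially"
proof -
  have f: "(\<lambda>n. ln (norm (fwd n \<xi> w)) / real n) \<longlonglongrightarrow> \<mu>"
    and "(\<lambda>n. ln (norm (bwd n \<xi> w)) / (- real n)) \<longlonglongrightarrow> \<mu>"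
    using assms by (auto simp: oseledets_space_def fwd_def bwd_def inv_T)
  from tendsto_minus[OF this(2)] have b: "(\<lambda>n. ln (norm (bwd n \<xi> w)) / real n) \<longlonglongrightarrow> - \<mu>" by simp
  show "0 < \<mu> \<Longrightarrow> (\<lambda>n. norm (bwd n \<xi> w)) \<longlonglongrightarrow> 0" by (rule exponential_decay_tendsto_0[OF b]) auto
  show "0 < \<mu> \<Longrightarrow> filterlim (\<lambda>n. norm (fwd n \<xi> w)) at_top sequentially" by (rule exponential_growth_at_top[OF f]) auto
  show "\<mu> < 0 \<Longrightarrow> (\<lambda>n. norm (fwd n \<xi> w)) \<longlonglongrightarrow> 0" by (rule exponential_decay_tendsto_0[OF f]) auto
  show "\<mu> < 0 \<Longrightarrow> filterlim (\<lambda>n. norm (bwd n \<xi> w)) at_top sequentially" by (rule exponential_growth_at_top[OF b]) auto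
qed

lemma hyperbolic_slopes_AE:
  assumes "unstable_stable_slopes T u v"
  shows "AE \<xi> in torus_measure. hyperbolic_slopes u v \<xi>"
proof -
  have "AE \<xi> in torus_measure. u \<xi> \<ge> 0 \<and> v \<xi> \<ge> 0 \<and>
        (\<exists>\<mu> \<nu>. \<mu> > 0 \<and> \<nu> < 0 \<and>
           oseledets_space T \<xi> \<mu> = span {(1, u \<xi>)} \<and>
           oseledets_space T \<xi> \<nu> = span {(1, - v \<xi>)})"
    using assms by (simp add: unstable_stable_slopes_def)
  then show ?thesis
  proof eventually_elim
    case (elim \<xi>)
    then obtain \<mu> \<nu> where \<mu>: "\<mu> > 0" "(1, u \<xi>) \<in> oseledets_space T \<xi> \<mu>"
      and \<nu>: "\<nu> < 0" "(1, - v \<xi>) \<in> oseledets_space T \<xi> \<nu>"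
      by (metis insertI1 span_base)
    have nz: "(1 :: real, u \<xi>) \<noteq> 0" "(1 :: real, - v \<xi>) \<noteq> 0" by (auto simp: zero_prod_def)
    show ?case unfolding hyperbolic_slopes_def
      using elim oseledets_space_growth(1,2)[OF \<mu>(2) nz(1) \<mu>(1)] oseledets_space_growth(3,4)[OF \<nu>(2) nz(2) \<nu>(1)]
      by blast
  qed
qed

text \<open>The almost-everywhere statement concerns one fundamental square. Lattice translations do
  not change the derivatives of the iterates, so the bad set is covered by countably many translates
  of its part in that square.\<close>

lemma negligible_not_hyperbolic:
  assumes uv: "unstable_stable_slopes T u v"
  shows "negligible {\<xi>. \<not> hyperbolic_slopes u v \<xi>}"
proof -
  define S :: "(real \<times> real) set" where "S = {0..<1} \<times> {0..<1}"
  define bad where "bad = {\<xi>. \<not> hyperbolic_slopes u v \<xi>}"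
  have per: "torus_periodic u" "torus_periodic v" using uv by (simp_all add: unstable_stable_slopes_def)
  have bad_per: "\<xi> + k \<in> bad \<longleftrightarrow> \<xi> \<in> bad" if k: "k \<in> torus_lattice" for \<xi> k
    unfolding bad_def mem_Collect_eq hyperbolic_slopes_def torus_periodicD[OF per(1) k]
      torus_periodicD[OF per(2) k] fwd_periodic[OF k] bwd_periodic[OF k] by (rule refl)
  have "S \<in> sets borel" unfolding S_def by (intro borel_Times) auto
  then have S: "S \<inter> space lebesgue \<in> sets lebesgue" by simp
  have "AE \<xi> in lebesgue_on S. hyperbolic_slopes u v \<xi>"
    using hyperbolic_slopes_AE[OF uv] unfolding torus_measure_def S_def .
  then have "AE \<xi> in lebesgue. \<xi> \<in> S \<longrightarrow> hyperbolic_slopes u v \<xi>"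
    by (simp only: AE_restrict_space_iff[OF S])
  then obtain N where "negligible N" "{\<xi>. \<not> (\<xi> \<in> S \<longrightarrow> hyperbolic_slopes u v \<xi>)} \<subseteq> N"
    unfolding eventually_ae_filter_negligible by blast
  then have N: "negligible (bad \<inter> S)"
    by (rule negligible_subset[OF _ order_trans[rotated]]) (auto simp: bad_def)
  have "negligible (\<Union> ((\<lambda>k. (+) k ` (bad \<inter> S)) ` torus_lattice))"
  proof (rule negligible_countable_Union)
    show "countable ((\<lambda>k. (+) k ` (bad \<inter> S)) ` torus_lattice)"
      using countable_torus_lattice by (rule countable_image)
    show "negligible X" if "X \<in> (\<lambda>k. (+) k ` (bad \<inter> S)) ` torus_lattice" for X
      using that negligible_translation[OF N] by blast
  qed
  moreover have "bad \<subseteq> \<Union> ((\<lambda>k. (+) k ` (bad \<inter> S)) ` torus_lattice)"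
  proof
    fix \<xi> assume \<xi>: "\<xi> \<in> bad"
    obtain k where k: "k \<in> torus_lattice" "\<xi> - k \<in> S" unfolding S_def by (rule torus_representative)
    have "\<xi> - k + k \<in> bad" using \<xi> by (simp only: diff_add_cancel)
    then have "\<xi> - k \<in> bad \<inter> S" using bad_per[OF k(1)] k(2) by blast
    then have "k + (\<xi> - k) \<in> (+) k ` (bad \<inter> S)" by (rule imageI)
    moreover have "k + (\<xi> - k) = \<xi>" by simp
    ultimately show "\<xi> \<in> \<Union> ((\<lambda>k. (+) k ` (bad \<inter> S)) ` torus_lattice)" using k(1) by (metis UN_I)
  qed
  ultimately show ?thesis unfolding bad_def by (rule negligible_subset)
qed

text \<open>The unstable direction is the only one contracted by all backward iterates, the stable one
  the only one contracted by all forward iterates; hence both are mapped to themselves.\<close>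

lemma hyperbolic_slopes_invariant:
  assumes 1: "hyperbolic_slopes u v \<xi>" and 2: "hyperbolic_slopes u v (T \<xi>)"
  shows "u (T \<xi>) * (1 + dp \<xi> + u \<xi>) = dp \<xi> + u \<xi>"
    "(v \<xi> - dp \<xi>) * (1 + v (T \<xi>)) = v (T \<xi>)"
proof -
  note g1 = 1[unfolded hyperbolic_slopes_def] and g2 = 2[unfolded hyperbolic_slopes_def]
  have "(\<lambda>n. norm (bwd (Suc n) (T \<xi>) (DT \<xi> (1, u \<xi>)))) \<longlonglongrightarrow> 0" using g1 by (simp only: bwd_Suc)
  then have "(\<lambda>n. norm (bwd n (T \<xi>) (DT \<xi> (1, u \<xi>)))) \<longlonglongrightarrow> 0"
    by (rule LIMSEQ_imp_Suc)
  then have "snd (DT \<xi> (1, u \<xi>)) = u (T \<xi>) * fst (DT \<xi> (1, u \<xi>))"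
    using g2 by (intro contracted_direction[of "\<lambda>n. bwd n (T \<xi>)" "u (T \<xi>)" "- v (T \<xi>)"] linear_bwd) auto
  then show "u (T \<xi>) * (1 + dp \<xi> + u \<xi>) = dp \<xi> + u \<xi>" by (simp add: DT_def)
  have "(\<lambda>n. norm (fwd (Suc n) \<xi> (1, - v \<xi>))) \<longlonglongrightarrow> 0" using g1 LIMSEQ_Suc by blast
  then have "(\<lambda>n. norm (fwd n (T \<xi>) (DT \<xi> (1, - v \<xi>)))) \<longlonglongrightarrow> 0" by (simp only: fwd_Suc)
  then have "snd (DT \<xi> (1, - v \<xi>)) = - v (T \<xi>) * fst (DT \<xi> (1, - v \<xi>))"
    using g2 by (intro contracted_direction[of "\<lambda>n. fwd n (T \<xi>)" "- v (T \<xi>)" "u (T \<xi>)"] linear_fwd) auto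
  then show "(v \<xi> - dp \<xi>) * (1 + v (T \<xi>)) = v (T \<xi>)" by (simp add: DT_def algebra_simps)
qed

lemma slope_fields_of_oseledets:
  assumes uv: "unstable_stable_slopes T u v"
  shows "slope_fields h u v"
proof -
  have c: "continuous_on UNIV u" "continuous_on UNIV v" and per: "torus_periodic u" "torus_periodic v"
    using uv by (auto simp: unstable_stable_slopes_def)
  have T: "continuous_on UNIV T" using continuous_T[OF continuous_on_id] by simp
  have cT: "continuous_on UNIV (\<lambda>\<xi>. u (T \<xi>))" "continuous_on UNIV (\<lambda>\<xi>. v (T \<xi>))"
    by (rule continuous_on_compose2[OF c(1) T] continuous_on_compose2[OF c(2) T]; simp)+
  define bad where "bad = {\<xi>. \<not> hyperbolic_slopes u v \<xi>}"
  \<comment> \<open>The second set collects the points whose image under \<open>T\<close> is bad; it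
    is the image of a null set under a differentiable map.\<close>
  have neg: "negligible (bad \<union> Ti ` bad)"
  proof (rule negligible_Un)
    show nb: "negligible bad" unfolding bad_def by (rule negligible_not_hyperbolic[OF uv])
    show "negligible (Ti ` bad)"
      by (rule negligible_differentiable_image_negligible[OF order_refl nb])
        (auto simp: differentiable_on_def intro: differentiable_at_withinI Ti_differentiable)
  qed
  have good: "hyperbolic_slopes u v \<xi> \<and> hyperbolic_slopes u v (T \<xi>)" if "\<xi> \<notin> bad \<union> Ti ` bad" for \<xi>
    using that imageI[of "T \<xi>" bad Ti] by (auto simp: bad_def)
  \<comment> \<open>A nonempty open set is not null, so a closed condition that holds off a null set
    holds everywhere.\<close>
  have everywhere: "P \<xi>" if "closed {\<xi>. P \<xi>}" "\<And>\<xi>. hyperbolic_slopes u v \<xi> \<Longrightarrow> hyperbolic_slopes u v (T \<xi>) \<Longrightarrow> P \<xi>" for P \<xi>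
  proof -
    have "- {\<xi>. P \<xi>} \<subseteq> bad \<union> Ti ` bad" using that(2) good by blast
    then have "negligible (- {\<xi>. P \<xi>})" using neg negligible_subset by blast
    then have "- {\<xi>. P \<xi>} = {}" using open_not_negligible[of "- {\<xi>. P \<xi>}"] that(1) by (auto simp: closed_def)
    then show ?thesis by blast
  qed
  have u0: "0 \<le> u \<xi>" for \<xi>
    by (rule everywhere) (auto simp: hyperbolic_slopes_def intro!: closed_Collect_le c)
  have v0: "0 \<le> v \<xi>" for \<xi>
    by (rule everywhere) (auto simp: hyperbolic_slopes_def intro!: closed_Collect_le c)
  have ue: "u (T \<xi>) * (1 + dp \<xi> + u \<xi>) = dp \<xi> + u \<xi>" for \<xi>
    by (rule everywhere[OF closed_Collect_eq hyperbolic_slopes_invariant(1)]) (intro continuous_intros c cT | assumption)+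
  have ve: "(v \<xi> - dp \<xi>) * (1 + v (T \<xi>)) = v (T \<xi>)" for \<xi>
    by (rule everywhere[OF closed_Collect_eq hyperbolic_slopes_invariant(2)]) (intro continuous_intros c cT | assumption)+
  show ?thesis
  proof
    show "u (T \<xi>) = slope_map (dp \<xi> + u \<xi>)" for \<xi>
    proof -
      have "1 + dp \<xi> + u \<xi> > 0" using p_nonneg[of "fst \<xi>"] u0[of \<xi>] by linarith
      then show ?thesis using ue[of \<xi>] by (simp add: slope_map_def eq_divide_eq add.assoc)
    qed
    show "v \<xi> = dp \<xi> + slope_map (v (T \<xi>))" for \<xi>
    proof -
      have "1 + v (T \<xi>) \<noteq> 0" using v0[of "T \<xi>"] by linarith
      then have "v \<xi> - dp \<xi> = slope_map (v (T \<xi>))" using ve[of \<xi>] by (simp add: slope_map_def eq_divide_eq)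
      then show ?thesis by linarith
    qed
  qed (use c per u0 v0 in auto)
qed

end

text \<open>Writing the derivative as \<open>J o\<^sub>L blinfun_inner_right (g \<xi>)\<close>
  reduces its continuity in operator norm to that of \<open>g\<close>.\<close>

lemma C1_on_Pair_const:
  fixes f :: "real \<times> real \<Rightarrow> real" and g :: "real \<times> real \<Rightarrow> real \<times> real"
  assumes f: "\<And>\<xi>. \<xi> \<in> S \<Longrightarrow> (f has_derivative (\<lambda>w. g \<xi> \<bullet> w)) (at \<xi>)" and g: "continuous_on S g"
  shows "C1_on S (\<lambda>\<xi>. (1 :: real, f \<xi>))"
  unfolding C1_on_def
proof (intro exI conjI ballI)
  define J :: "real \<Rightarrow>\<^sub>L (real \<times> real)" where "J = Blinfun (\<lambda>t. (0, t))"
  have J: "blinfun_apply J = (\<lambda>t. (0, t))" unfolding J_def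
    by (rule bounded_linear_Blinfun_apply) (intro bounded_linear_Pair bounded_linear_zero bounded_linear_ident)
  show "((\<lambda>\<xi>. (1 :: real, f \<xi>)) has_derivative blinfun_apply (J o\<^sub>L blinfun_inner_right (g \<xi>))) (at \<xi>)"
    if "\<xi> \<in> S" for \<xi>
    using has_derivative_Pair[OF has_derivative_const f[OF that]] by (simp add: blinfun_compose.rep_eq J comp_def)
  show "continuous_on S (\<lambda>\<xi>. J o\<^sub>L blinfun_inner_right (g \<xi>))"
    by (intro bounded_bilinear.continuous_on[OF bounded_bilinear_blinfun_compose] continuous_on_const
        bounded_linear.continuous_on[OF bounded_linear_blinfun_inner_right] g)
qed

theorem lemma6p6:
  fixes h :: "real \<Rightarrow> real"
  assumes "circle_lift h" and "smooth h"
    and "h 0 \<in> \<int>"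
    and "deriv h 0 = 0"
    and "\<And>x. x \<notin> \<int> \<Longrightarrow> deriv h x > 0"
    and "(deriv ^^ 3) h 0 > 0"
    and "\<And>x. h (- x) + h x \<in> \<int>"
  shows "\<exists>C>0. \<forall>u v. unstable_stable_slopes (torus_map h) u v \<longrightarrow>
    C1_on (- torus_lattice) (\<lambda>\<xi>. (1 :: real, u \<xi>)) \<and>
    C1_on (- torus_lattice) (\<lambda>\<xi>. (1 :: real, - v \<xi>)) \<and>
    (\<forall>\<xi>\<in>- torus_lattice.
       onorm (frechet_derivative u (at \<xi>)) \<le> C * inverse (u \<xi> + v \<xi>))"
\<comment> \<open>The constant must be chosen before \<open>u\<close> and \<open>v\<close>. Without
  slope fields any constant will do; otherwise it is taken from one pair, and uniqueness makes it
  serve for every pair.\<close>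
proof (cases "\<exists>u v. unstable_stable_slopes (torus_map h) u v")
  case False
  then show ?thesis by (intro exI[of _ 1]) simp
next
  case True
  interpret slow_torus_map h by standard (fact assms)+
  obtain u v where uv: "unstable_stable_slopes (torus_map h) u v" using True by blast
  interpret slope_fields h u v by (rule slope_fields_of_oseledets[OF uv])
  obtain g K where K: "K > 0" and g: "\<And>\<xi>. \<xi> \<notin> torus_lattice \<Longrightarrow> (u has_derivative (\<lambda>w. g \<xi> \<bullet> w)) (at \<xi>)"
    "continuous_on (- torus_lattice) g"
    "\<And>\<xi>. \<xi> \<notin> torus_lattice \<Longrightarrow> norm (g \<xi>) \<le> K * inverse (u \<xi> + v \<xi>)"
    by (rule slope_gradient, rule that)
  obtain g' where g': "\<And>\<xi>. \<xi> \<notin> torus_lattice \<Longrightarrow> (v has_derivative (\<lambda>w. g' \<xi> \<bullet> w)) (at \<xi>)"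
    "continuous_on (- torus_lattice) g'"
    by (rule v_gradient[OF g(1,2)], assumption, rule that)
  have unique: "u' = u \<and> v' = v" if "unstable_stable_slopes (torus_map h) u' v'" for u' v'
  proof -
    interpret other: slope_fields h u' v' by (rule slope_fields_of_oseledets[OF that])
    have "u' = u" by (rule ext) (rule u_unique[OF other.u_nonneg other.u_step])
    moreover from this have "v' \<xi> = v \<xi>" for \<xi> using other.v_eq[of \<xi>] v_eq[of \<xi>] by simp
    ultimately show ?thesis by blast
  qed
  have "onorm (frechet_derivative u (at \<xi>)) \<le> K * inverse (u \<xi> + v \<xi>)" if "\<xi> \<notin> torus_lattice" for \<xi>
  proof -
    have "onorm (\<lambda>w. g \<xi> \<bullet> w) \<le> norm (g \<xi>)"
      by (rule onorm_le) (simp add: Cauchy_Schwarz_ineq2)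
    then show ?thesis using g(3)[OF that] frechet_derivative_at[OF g(1)[OF that]] by simp
  qed
  moreover have "C1_on (- torus_lattice) (\<lambda>\<xi>. (1 :: real, u \<xi>))"
    by (rule C1_on_Pair_const[of _ u g]) (use g in auto)
  moreover have "C1_on (- torus_lattice) (\<lambda>\<xi>. (1 :: real, - v \<xi>))"
  proof (rule C1_on_Pair_const[of _ "\<lambda>\<xi>. - v \<xi>" "\<lambda>\<xi>. - g' \<xi>"])
    show "((\<lambda>\<xi>. - v \<xi>) has_derivative (\<lambda>w. - g' \<xi> \<bullet> w)) (at \<xi>)" if "\<xi> \<in> - torus_lattice" for \<xi>
      using has_derivative_minus[OF g'(1)[of \<xi>]] that by simp
  qed (intro continuous_intros g')
  ultimately have *: "C1_on (- torus_lattice) (\<lambda>\<xi>. (1 :: real, u \<xi>)) \<and>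
      C1_on (- torus_lattice) (\<lambda>\<xi>. (1 :: real, - v \<xi>)) \<and>
      (\<forall>\<xi>\<in>- torus_lattice. onorm (frechet_derivative u (at \<xi>)) \<le> K * inverse (u \<xi> + v \<xi>))"
    unfolding Compl_iff by (intro conjI ballI) (simp only: Compl_iff)+
  show ?thesis
  proof (intro exI[of _ K] conjI[OF K] allI impI)
    fix u' v' assume "unstable_stable_slopes (torus_map h) u' v'"
    then have eq: "u' = u" "v' = v" using unique by blast+
    show "C1_on (- torus_lattice) (\<lambda>\<xi>. (1 :: real, u' \<xi>)) \<and>
      C1_on (- torus_lattice) (\<lambda>\<xi>. (1 :: real, - v' \<xi>)) \<and>
      (\<forall>\<xi>\<in>- torus_lattice. onorm (frechet_derivative u' (at \<xi>)) \<le> K * inverse (u' \<xi> + v' \<xi>))"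
      unfolding eq by (rule *)
  qed
qed

end
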